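(* Let $(G,+)$ be a finite abelian group and $n$ a positive integer, and let $W=G\wr S_n$. Let $(\sigma,k)$ and $(\tau,\ell)$ be two double partitions of the same size $n$, where $\sigma,\tau$ are partitions and $k,\ell$ are nonnegative integers (with $|\sigma|+k=|\tau|+\ell=n$). Then every nonempty subset $Y\subseteq W$ that is $(\sigma,k)$-transitive is also $(\tau,\ell)$-transitive if and only if $k\le \ell$ and $\sigma\cup(k)\trianglelefteq \tau\cup(\ell)$.
   Context: $[n]=\{1,\dots,n\}$. The wreath product $W=G\wr S_n$ consists of pairs $(g,\pi)$ with $g=(g_1,\dots,g_n)\in G^n$, $\pi\in S_n$, with multiplication $(f,\pi)(g,\sigma)=(f+g^\pi,\pi\sigma)$ where $g^\pi=(g_{\pi^{-1}(1)},\dots,g_{\pi^{-1}(n)})$. If a group acts on a finite set $\Omega$, a nonempty subset $Y$ of the group is transitive on $\Omega$ if there is a constant $c>0$ such that for all $a,b\in\Omega$ exactly $c$ elements $y\in Y$ satisfy $ya=b$. A partition is a weakly decreasing sequence of nonnegative integers with finite sum; $\emptyset$ is the partition of $0$; $\lambda\cup\mu$ is the partition whose parts are the parts of $\lambda$ and of $\mu$ together (so $\sigma\cup(k)$ adds a part $k$, and $\sigma\cup(0)=\sigma$). For partitions $\lambda,\mu$, $\lambda\trianglelefteq\mu$ means $\sum_{i\le m}\lambda_i\le\sum_{i\le m}\mu_i$ for all $m\ge1$. For a map $\underline\sigma$ from the set of subgroups of $G$ to partitions with $\sum_{U\le G}|\underline\sigma(U)|=n$, a $\underline\sigma$-tableau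 consists of, for each subgroup $U\le G$, the Young diagram of $\underline\sigma(U)$ with boxes filled by pairs $(c,i)$, $c\in G/U$ a coset of $U$, $i\in[n]$, such that all the integers $i$ used are pairwise distinct. Tableaux are row-equivalent if corresponding rows contain the same entries; a $\underline\sigma$-tabloid is an equivalence class. $W$ acts on tabloids entrywise via $(g,\pi)\cdot(c,i)=(c+g_{\pi(i)},\pi(i))$. A subset is $\underline\sigma$-transitive if it is transitive on the set of $\underline\sigma$-tabloids. A double partition $(\sigma,\rho)$ of size $n$ is a pair of partitions with $|\sigma|+|\rho|=n$; if $|G|>1$ it corresponds to $\underline\sigma$ with $\underline\sigma(\{0\})=\sigma$, $\underline\sigma(G)=\rho$ and $\underline\sigma(U)=\emptyset$ for all other subgroups $U$; if $|G|=1$ only double partitions $(\sigma,\emptyset)$ occur and correspond to $\underline\sigma(G)=\sigma$. "$(\sigma,\rho)$-transitive" means $\underline\sigma$-transitive for this $\underline\sigma$. The double partition $(\sigma,k)$ means $(\sigma,(k))$, read as $(\sigma,\emptyset)$ when $k=0$. *)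

theory Defs
  imports "HOL-Algebra.Algebra"
begin

section \<open>Partitions\<close>

text \<open>
  A partition is a function \<open>nat \<Rightarrow> nat\<close>, rows being numbered from 0. For a sequence of
  natural numbers, having a finite sum means having finite support.
\<close>

definition is_partition :: "(nat \<Rightarrow> nat) \<Rightarrow> bool"
  where "is_partition \<alpha> \<longleftrightarrow> decseq \<alpha> \<and> finite {i. \<alpha> i \<noteq> 0}"

definition psize :: "(nat \<Rightarrow> nat) \<Rightarrow> nat"
  where "psize \<alpha> = (\<Sum>i | \<alpha> i \<noteq> 0. \<alpha> i)"

definition empty_partition :: "nat \<Rightarrow> nat"
  where "empty_partition = (\<lambda>_. 0)"

definition one_row :: "nat \<Rightarrow> nat \<Rightarrow> nat"
  where "one_row k = (\<lambda>i. if i = 0 then k else 0)"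

definition parts :: "(nat \<Rightarrow> nat) \<Rightarrow> nat multiset"
  where "parts \<alpha> = image_mset \<alpha> (mset_set {i. \<alpha> i \<noteq> 0})"

definition partition_of_parts :: "nat multiset \<Rightarrow> nat \<Rightarrow> nat"
  where "partition_of_parts M i =
    (let xs = rev (sorted_list_of_multiset M) in if i < length xs then xs ! i else 0)"

definition partition_union :: "(nat \<Rightarrow> nat) \<Rightarrow> (nat \<Rightarrow> nat) \<Rightarrow> nat \<Rightarrow> nat"
  where "partition_union \<alpha> \<beta> = partition_of_parts (parts \<alpha> + parts \<beta>)"

definition dominated :: "(nat \<Rightarrow> nat) \<Rightarrow> (nat \<Rightarrow> nat) \<Rightarrow> bool"
  where "dominated \<alpha> \<beta> \<longleftrightarrow> (\<forall>m. (\<Sum>i<m. \<alpha> i) \<le> (\<Sum>i<m. \<beta> i))"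


section \<open>The wreath product\<close>

text \<open>The abelian group \<open>G\<close> is written multiplicatively throughout, as is usual in HOL-Algebra.\<close>

type_synonym 'a wreath = "(nat \<Rightarrow> 'a) \<times> (nat \<Rightarrow> nat)"

definition wreath_product :: "('a, 'b) monoid_scheme \<Rightarrow> nat \<Rightarrow> 'a wreath monoid"
  where "wreath_product G n =
    \<lparr> carrier = ({1..n} \<rightarrow>\<^sub>E carrier G) \<times> carrier (sym_group n),
      monoid.mult = (\<lambda>(f, \<pi>) (g, \<sigma>). (\<lambda>i\<in>{1..n}. f i \<otimes>\<^bsub>G\<^esub> g (inv' \<pi> i), \<pi> \<circ> \<sigma>)),
      one = (\<lambda>i\<in>{1..n}. \<one>\<^bsub>G\<^esub>, id) \<rparr>"


section \<open>Transitive subsets\<close>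

definition transitive_subset :: "('w \<Rightarrow> 'e \<Rightarrow> 'e) \<Rightarrow> 'e set \<Rightarrow> 'w set \<Rightarrow> bool"
  where "transitive_subset \<phi> E Y \<longleftrightarrow>
    Y \<noteq> {} \<and> (\<exists>c>0. \<forall>a\<in>E. \<forall>b\<in>E. card {y \<in> Y. \<phi> y a = b} = c)"


section \<open>Tableaux and tabloids\<close>

definition subgroup_partition :: "('a, 'b) monoid_scheme \<Rightarrow> nat \<Rightarrow> ('a set \<Rightarrow> nat \<Rightarrow> nat) \<Rightarrow> bool"
  where "subgroup_partition G n s \<longleftrightarrow>
    (\<forall>U. subgroup U G \<longrightarrow> is_partition (s U)) \<and> (\<Sum>U | subgroup U G. psize (s U)) = n"

text \<open>A box is a triple (subgroup, row, column).\<close>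

type_synonym 'a box = "'a set \<times> nat \<times> nat"

text \<open>An entry \<open>(c, i)\<close> consists of a coset and an integer.\<close>

type_synonym 'a entry = "'a set \<times> nat"

type_synonym 'a tableau = "'a box \<Rightarrow> 'a entry"

definition boxes :: "('a, 'b) monoid_scheme \<Rightarrow> ('a set \<Rightarrow> nat \<Rightarrow> nat) \<Rightarrow> 'a box set"
  where "boxes G s = {(U, r, j). subgroup U G \<and> j < s U r}"

definition tableaux ::
    "('a, 'b) monoid_scheme \<Rightarrow> nat \<Rightarrow> ('a set \<Rightarrow> nat \<Rightarrow> nat) \<Rightarrow> 'a tableau set"
  where "tableaux G n s =
    {T \<in> \<Pi>\<^sub>E (U, r, j) \<in> boxes G s. (rcosets\<^bsub>G\<^esub> U) \<times> {1..n}. inj_on (snd \<circ> T) (boxes G s)}"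

definition row_entries ::
    "('a set \<Rightarrow> nat \<Rightarrow> nat) \<Rightarrow> 'a tableau \<Rightarrow> 'a set \<Rightarrow> nat \<Rightarrow> 'a entry set"
  where "row_entries s T U r = (\<lambda>j. T (U, r, j)) ` {..<s U r}"

definition row_equiv ::
    "('a, 'b) monoid_scheme \<Rightarrow> nat \<Rightarrow> ('a set \<Rightarrow> nat \<Rightarrow> nat) \<Rightarrow> ('a tableau \<times> 'a tableau) set"
  where "row_equiv G n s =
    {(T, T'). T \<in> tableaux G n s \<and> T' \<in> tableaux G n s \<and>
      (\<forall>U r. subgroup U G \<longrightarrow> row_entries s T U r = row_entries s T' U r)}"

definition tabloids ::
    "('a, 'b) monoid_scheme \<Rightarrow> nat \<Rightarrow> ('a set \<Rightarrow> nat \<Rightarrow> nat) \<Rightarrow> 'a tableau set set"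
  where "tabloids G n s = tableaux G n s // row_equiv G n s"

definition entry_action :: "('a, 'b) monoid_scheme \<Rightarrow> 'a wreath \<Rightarrow> 'a entry \<Rightarrow> 'a entry"
  where "entry_action G = (\<lambda>(g, \<pi>) (c, i). (c #>\<^bsub>G\<^esub> g (\<pi> i), \<pi> i))"

definition tableau_action ::
    "('a, 'b) monoid_scheme \<Rightarrow> ('a set \<Rightarrow> nat \<Rightarrow> nat) \<Rightarrow> 'a wreath \<Rightarrow> 'a tableau \<Rightarrow> 'a tableau"
  where "tableau_action G s w T = (\<lambda>b\<in>boxes G s. entry_action G w (T b))"

definition tabloid_action ::
    "('a, 'b) monoid_scheme \<Rightarrow> ('a set \<Rightarrow> nat \<Rightarrow> nat) \<Rightarrow> 'a wreath \<Rightarrow> 'a tableau set \<Rightarrow> 'a tableau set"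
  where "tabloid_action G s w C = tableau_action G s w ` C"

definition tabloid_transitive ::
    "('a, 'b) monoid_scheme \<Rightarrow> nat \<Rightarrow> ('a set \<Rightarrow> nat \<Rightarrow> nat) \<Rightarrow> 'a wreath set \<Rightarrow> bool"
  where "tabloid_transitive G n s Y \<longleftrightarrow>
    transitive_subset (tabloid_action G s) (tabloids G n s) Y"


section \<open>Double partitions\<close>

text \<open>Over the trivial group, only double partitions with empty second component occur.\<close>

definition double_partition ::
    "('a, 'b) monoid_scheme \<Rightarrow> nat \<Rightarrow> (nat \<Rightarrow> nat) \<Rightarrow> (nat \<Rightarrow> nat) \<Rightarrow> bool"
  where "double_partition G n \<sigma> \<rho> \<longleftrightarrow>
    is_partition \<sigma> \<and> is_partition \<rho> \<and> psize \<sigma> + psize \<rho> = n \<and>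
    (order G = 1 \<longrightarrow> \<rho> = empty_partition)"

text \<open>
  Over the trivial group, the trivial subgroup is the whole group, so that the first case below
  places \<open>\<sigma>\<close> on it.
\<close>

definition double_map ::
    "('a, 'b) monoid_scheme \<Rightarrow> (nat \<Rightarrow> nat) \<Rightarrow> (nat \<Rightarrow> nat) \<Rightarrow> 'a set \<Rightarrow> nat \<Rightarrow> nat"
  where "double_map G \<sigma> \<rho> U =
    (if U = {\<one>\<^bsub>G\<^esub>} then \<sigma> else if U = carrier G then \<rho> else empty_partition)"

definition double_transitive ::
    "('a, 'b) monoid_scheme \<Rightarrow> nat \<Rightarrow> (nat \<Rightarrow> nat) \<Rightarrow> (nat \<Rightarrow> nat) \<Rightarrow> 'a wreath set \<Rightarrow> bool"
  where "double_transitive G n \<sigma> \<rho> Y \<longleftrightarrow> tabloid_transitive G n (double_map G \<sigma> \<rho>) Y"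


section \<open>Basic properties\<close>

lemma parts_partition_of_parts:
  assumes "0 \<notin># M"
  shows "parts (partition_of_parts M) = M"
proof -
  let ?xs = "rev (sorted_list_of_multiset M)"
  have m: "mset ?xs = M" by simp
  have nz: "?xs ! i \<noteq> 0" if "i < length ?xs" for i
  proof -
    have "?xs ! i \<in># mset ?xs" using nth_mem[OF that] by (simp only: set_mset_mset)
    then show ?thesis using assms unfolding m by metis
  qed
  have "{i. partition_of_parts M i \<noteq> 0} = {..<length ?xs}"
    using nz by (auto simp: partition_of_parts_def Let_def)
  then have "parts (partition_of_parts M) = image_mset (\<lambda>i. ?xs ! i) (mset_set {..<length ?xs})"
    unfolding parts_def by (simp only:) (rule image_mset_cong, simp add: partition_of_parts_def)
  also have "\<dots> = mset (map (\<lambda>i. ?xs ! i) [0..<length ?xs])"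
    by (simp add: lessThan_atLeast0)
  also have "\<dots> = mset ?xs" by (subst map_nth) simp
  finally show ?thesis by simp
qed

lemma is_partition_partition_of_parts: "is_partition (partition_of_parts M)"
proof -
  let ?xs = "rev (sorted_list_of_multiset M)"
  have s: "sorted_wrt (\<ge>) ?xs" by (simp add: sorted_wrt_rev)
  have "decseq (partition_of_parts M)"
    unfolding decseq_def partition_of_parts_def Let_def
    using s by (auto simp: sorted_wrt_iff_nth_less le_less)
  moreover have "{i. partition_of_parts M i \<noteq> 0} \<subseteq> {..<length ?xs}"
    by (auto simp: partition_of_parts_def Let_def split: if_splits)
  ultimately show ?thesis by (auto simp: is_partition_def intro: finite_subset)
qed

lemma is_partition_partition_union: "is_partition (partition_union \<alpha> \<beta>)"
  by (simp add: partition_union_def is_partition_partition_of_parts)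

lemma parts_partition_union:
  assumes "is_partition \<alpha>" "is_partition \<beta>"
  shows "parts (partition_union \<alpha> \<beta>) = parts \<alpha> + parts \<beta>"
  using assms unfolding partition_union_def
  by (intro parts_partition_of_parts) (auto simp: parts_def is_partition_def)

lemma subgroup_partition_double_map:
  assumes "group G" "finite (carrier G)" "double_partition G n \<sigma> \<rho>"
  shows "subgroup_partition G n (double_map G \<sigma> \<rho>)"
proof -
  interpret group G by fact
  have e: "psize empty_partition = 0" "is_partition empty_partition"
    by (auto simp: psize_def empty_partition_def is_partition_def decseq_def)
  have f: "finite {U. subgroup U G}"
    by (rule finite_subset[of _ "Pow (carrier G)"])
       (use assms(2) subgroup.subset in blast, simp add: assms(2))
  have t: "subgroup {\<one>\<^bsub>G\<^esub>} G" "subgroup (carrier G) G"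
    by (simp_all add: triv_subgroup subgroup_self)
  have "(\<Sum>U | subgroup U G. psize (double_map G \<sigma> \<rho> U)) =
        (\<Sum>U \<in> {{\<one>\<^bsub>G\<^esub>}, carrier G}. psize (double_map G \<sigma> \<rho> U))"
    by (rule sum.mono_neutral_right) (use f t e in \<open>auto simp: double_map_def\<close>)
  also have "\<dots> = n"
  proof (cases "carrier G = {\<one>\<^bsub>G\<^esub>}")
    case True
    then have "order G = 1" by (simp add: order_def)
    then have "\<rho> = empty_partition" using assms(3) by (simp add: double_partition_def)
    then have "psize \<sigma> = n" using assms(3) e by (simp add: double_partition_def)
    then show ?thesis by (simp add: True double_map_def)
  next
    case False
    then show ?thesis using assms(3) by (auto simp: double_map_def double_partition_def)
  qed
  finally show ?thesis
    using assms(3) e by (auto simp: subgroup_partition_def double_map_def double_partition_def)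
qed

lemma wreath_product_simps:
  "x \<in> carrier (wreath_product G n) \<longleftrightarrow>
    fst x \<in> {1..n} \<rightarrow>\<^sub>E carrier G \<and> snd x permutes {1..n}"
  "x \<otimes>\<^bsub>wreath_product G n\<^esub> y =
    (\<lambda>i\<in>{1..n}. fst x i \<otimes>\<^bsub>G\<^esub> fst y (inv' (snd x) i), snd x \<circ> snd y)"
  "\<one>\<^bsub>wreath_product G n\<^esub> = (\<lambda>i\<in>{1..n}. \<one>\<^bsub>G\<^esub>, id)"
  by (simp_all add: wreath_product_def sym_group_carrier mem_Times_iff case_prod_beta)

lemma group_wreath_product:
  assumes "group G"
  shows "group (wreath_product G n)"
proof -
  interpret group G by fact
  define I where "I = {1..n}"
  note W = wreath_product_simps[where G = G and n = n, folded I_def]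
  have pin: "inv' \<pi> i \<in> I \<longleftrightarrow> i \<in> I" if "\<pi> permutes I" for \<pi> i
    using permutes_in_image[OF permutes_inv[OF that]] .
  have pin': "\<pi> i \<in> I \<longleftrightarrow> i \<in> I" if "\<pi> permutes I" for \<pi> i
    using permutes_in_image[OF that] .
  have fG: "f i \<in> carrier G" if "f \<in> I \<rightarrow>\<^sub>E carrier G" "i \<in> I" for f :: "nat \<Rightarrow> 'a" and i
    using that by (rule PiE_mem)
  show ?thesis
  proof (rule groupI)
    fix x y assume "x \<in> carrier (wreath_product G n)" "y \<in> carrier (wreath_product G n)"
    then show "x \<otimes>\<^bsub>wreath_product G n\<^esub> y \<in> carrier (wreath_product G n)"
      unfolding W by (auto simp: pin fG permutes_compose)
  next
    show "\<one>\<^bsub>wreath_product G n\<^esub> \<in> carrier (wreath_product G n)"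
      unfolding W by (auto simp: permutes_id)
  next
    fix x y z
    assume a: "x \<in> carrier (wreath_product G n)" "y \<in> carrier (wreath_product G n)"
      "z \<in> carrier (wreath_product G n)"
    then have "inv' (snd x \<circ> snd y) = inv' (snd y) \<circ> inv' (snd x)"
      unfolding W by (intro o_inv_distrib) (auto intro: permutes_bij)
    then show "x \<otimes>\<^bsub>wreath_product G n\<^esub> y \<otimes>\<^bsub>wreath_product G n\<^esub> z =
        x \<otimes>\<^bsub>wreath_product G n\<^esub> (y \<otimes>\<^bsub>wreath_product G n\<^esub> z)"
      using a unfolding W
      by (intro prod_eqI) (auto simp: comp_assoc m_assoc fG pin intro!: restrict_ext)
  next
    fix x assume "x \<in> carrier (wreath_product G n)"
    then have f: "fst x \<in> I \<rightarrow>\<^sub>E carrier G" and p: "snd x permutes I" by (simp_all add: W)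
    show "\<one>\<^bsub>wreath_product G n\<^esub> \<otimes>\<^bsub>wreath_product G n\<^esub> x = x"
    proof (intro prod_eqI)
      have "restrict (fst x) I = fst x" using f by (auto simp: PiE_def extensional_restrict)
      moreover have "fst (\<one>\<^bsub>wreath_product G n\<^esub> \<otimes>\<^bsub>wreath_product G n\<^esub> x) = restrict (fst x) I"
        unfolding W by (auto simp: fG[OF f] intro!: restrict_ext)
      ultimately show "fst (\<one>\<^bsub>wreath_product G n\<^esub> \<otimes>\<^bsub>wreath_product G n\<^esub> x) = fst x" by simp
    qed (simp add: W)
    define y where "y = (\<lambda>i\<in>I. inv\<^bsub>G\<^esub> (fst x (snd x i)), inv' (snd x))"
    have "y \<in> carrier (wreath_product G n)"
      unfolding W y_def using permutes_inv[OF p] by (simp add: pin'[OF p] fG[OF f])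
    moreover have "y \<otimes>\<^bsub>wreath_product G n\<^esub> x = \<one>\<^bsub>wreath_product G n\<^esub>"
    proof (intro prod_eqI)
      show "fst (y \<otimes>\<^bsub>wreath_product G n\<^esub> x) = fst \<one>\<^bsub>wreath_product G n\<^esub>"
        unfolding W y_def fst_conv snd_conv permutes_inv_inv[OF p]
        by (rule restrict_ext) (simp add: pin'[OF p] fG[OF f])
      show "snd (y \<otimes>\<^bsub>wreath_product G n\<^esub> x) = snd \<one>\<^bsub>wreath_product G n\<^esub>"
        unfolding W y_def by (simp add: permutes_inv_o[OF p])
    qed
    ultimately show "\<exists>y\<in>carrier (wreath_product G n).
        y \<otimes>\<^bsub>wreath_product G n\<^esub> x = \<one>\<^bsub>wreath_product G n\<^esub>" by blast
  qed
qed

lemma equiv_row_equiv: "equiv (tableaux G n s) (row_equiv G n s)"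
  by (rule equivI) (auto simp: row_equiv_def refl_on_def sym_def trans_def)

lemma tableauxD:
  assumes "T \<in> tableaux G n s" "(U, r, j) \<in> boxes G s"
  obtains c i where "T (U, r, j) = (c, i)" "c \<in> rcosets\<^bsub>G\<^esub> U" "i \<in> {1..n}"
  using assms by (auto simp: tableaux_def PiE_iff)

lemma tableau_action_closed:
  assumes "comm_group G" "w \<in> carrier (wreath_product G n)" "T \<in> tableaux G n s"
  shows "tableau_action G s w T \<in> tableaux G n s"
proof -
  interpret comm_group G by fact
  obtain g \<pi> where w: "w = (g, \<pi>)" by (cases w)
  have g: "\<And>i. i \<in> {1..n} \<Longrightarrow> g i \<in> carrier G" and p: "\<pi> permutes {1..n}"
    using assms(2) by (auto simp only: w wreath_product_simps fst_conv snd_conv dest: PiE_mem)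
  have "entry_action G w (T b) \<in> (rcosets\<^bsub>G\<^esub> (fst b)) \<times> {1..n}" if b: "b \<in> boxes G s" for b
  proof -
    obtain U r j where b': "b = (U, r, j)" by (cases b)
    have U: "subgroup U G" using b by (simp add: b' boxes_def)
    obtain c i where ci: "T b = (c, i)" "c \<in> rcosets\<^bsub>G\<^esub> U" "i \<in> {1..n}"
      using tableauxD assms(3) b b' by metis
    then have i: "\<pi> i \<in> {1..n}" using permutes_in_image[OF p] by blast
    obtain a where a: "a \<in> carrier G" "c = U #>\<^bsub>G\<^esub> a" using ci by (auto simp: RCOSETS_def)
    have "c #>\<^bsub>G\<^esub> g (\<pi> i) = U #>\<^bsub>G\<^esub> (a \<otimes>\<^bsub>G\<^esub> g (\<pi> i))"
      using a U g[OF i] by (simp add: coset_mult_assoc subgroup.subset)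
    moreover have "\<dots> \<in> rcosets\<^bsub>G\<^esub> U"
      using a U g[OF i] by (simp add: rcosetsI subgroup.subset)
    ultimately show ?thesis using i ci(1)[unfolded b'] by (simp add: entry_action_def w b')
  qed
  moreover have "inj_on (snd \<circ> tableau_action G s w T) (boxes G s)"
  proof (rule inj_onI)
    fix b b' assume b: "b \<in> boxes G s" "b' \<in> boxes G s"
      and "(snd \<circ> tableau_action G s w T) b = (snd \<circ> tableau_action G s w T) b'"
    then have "\<pi> (snd (T b)) = \<pi> (snd (T b'))"
      by (simp add: tableau_action_def entry_action_def w split: prod.splits)
    then have "snd (T b) = snd (T b')" using permutes_inj[OF p] by (simp add: inj_eq)
    then show "b = b'" using assms(3) b by (auto simp: tableaux_def inj_on_def)
  qed
  ultimately show ?thesis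
    by (auto simp: tableaux_def tableau_action_def PiE_iff split: prod.splits)
qed

lemma tableau_action_one:
  assumes "group G" "T \<in> tableaux G n s"
  shows "tableau_action G s \<one>\<^bsub>wreath_product G n\<^esub> T = T"
proof
  interpret group G by fact
  fix b
  show "tableau_action G s \<one>\<^bsub>wreath_product G n\<^esub> T b = T b"
  proof (cases "b \<in> boxes G s")
    case True
    obtain U r j where b: "b = (U, r, j)" by (cases b)
    have U: "subgroup U G" using True by (simp add: b boxes_def)
    obtain c i where ci: "T b = (c, i)" "c \<in> rcosets\<^bsub>G\<^esub> U" "i \<in> {1..n}"
      using tableauxD[OF assms(2) True[unfolded b]] unfolding b by blast
    have "c \<subseteq> carrier G"
      using rcosets_part_G[OF U] ci(2) by (metis Union_upper)
    then have "c #>\<^bsub>G\<^esub> \<one>\<^bsub>G\<^esub> = c" by (rule coset_mult_one)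
    then have "entry_action G \<one>\<^bsub>wreath_product G n\<^esub> (c, i) = (c, i)"
      using ci(3) unfolding entry_action_def wreath_product_simps(3)
      by (simp only: prod.case restrict_apply' id_apply)
    then show ?thesis
      unfolding tableau_action_def by (simp only: restrict_apply' True ci(1))
  next
    case False
    have "T \<in> extensional (boxes G s)"
      using assms(2) by (simp add: tableaux_def PiE_def)
    then have "T b = undefined" using False by (rule extensional_arb)
    with False show ?thesis unfolding tableau_action_def restrict_def by (simp only: if_False)
  qed
qed

lemma tableau_action_mult:
  assumes "comm_group G" "v \<in> carrier (wreath_product G n)" "w \<in> carrier (wreath_product G n)"
    "T \<in> tableaux G n s"
  shows "tableau_action G s (v \<otimes>\<^bsub>wreath_product G n\<^esub> w) T =
    tableau_action G s v (tableau_action G s w T)"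
proof
  interpret comm_group G by fact
  fix b
  obtain f \<pi> where v: "v = (f, \<pi>)" by (cases v)
  obtain g \<sigma> where w: "w = (g, \<sigma>)" by (cases w)
  have f: "\<And>i. i \<in> {1..n} \<Longrightarrow> f i \<in> carrier G" and p: "\<pi> permutes {1..n}"
    using assms(2) by (auto simp only: v wreath_product_simps fst_conv snd_conv dest: PiE_mem)
  have g: "\<And>i. i \<in> {1..n} \<Longrightarrow> g i \<in> carrier G" and q: "\<sigma> permutes {1..n}"
    using assms(3) by (auto simp only: w wreath_product_simps fst_conv snd_conv dest: PiE_mem)
  show "tableau_action G s (v \<otimes>\<^bsub>wreath_product G n\<^esub> w) T b =
    tableau_action G s v (tableau_action G s w T) b"
  proof (cases "b \<in> boxes G s")
    case True
    obtain U r j where b: "b = (U, r, j)" by (cases b)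
    have U: "subgroup U G" using True by (simp add: b boxes_def)
    obtain c i where ci: "T b = (c, i)" "c \<in> rcosets\<^bsub>G\<^esub> U" "i \<in> {1..n}"
      using tableauxD assms(4) True b by metis
    have c: "c \<subseteq> carrier G"
      using ci(2) U by (auto simp: RCOSETS_def r_coset_def dest: subgroup.mem_carrier)
    have i: "\<sigma> i \<in> {1..n}" "\<pi> (\<sigma> i) \<in> {1..n}"
      using ci(3) permutes_in_image[OF p] permutes_in_image[OF q] by blast+
    have "c #>\<^bsub>G\<^esub> (f (\<pi> (\<sigma> i)) \<otimes>\<^bsub>G\<^esub> g (\<sigma> i)) = c #>\<^bsub>G\<^esub> g (\<sigma> i) #>\<^bsub>G\<^esub> f (\<pi> (\<sigma> i))"
      using c f[OF i(2)] g[OF i(1)] by (simp add: coset_mult_assoc m_comm)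
    then show ?thesis
      using True ci(1) i permutes_inverses(2)[OF p]
      by (simp add: tableau_action_def entry_action_def wreath_product_simps v w)
  qed (simp add: tableau_action_def)
qed

lemma tabloid_action_class:
  assumes "comm_group G" "w \<in> carrier (wreath_product G n)" "T \<in> tableaux G n s"
  shows "tabloid_action G s w (row_equiv G n s `` {T}) = row_equiv G n s `` {tableau_action G s w T}"
proof -
  interpret comm_group G by fact
  let ?W = "wreath_product G n"
  interpret W: group ?W by (rule group_wreath_product) (rule is_group)
  have row: "row_entries s (tableau_action G s v T) U r = entry_action G v ` row_entries s T U r"
    if "subgroup U G" for v T U r
    using that by (auto simp: row_entries_def tableau_action_def boxes_def image_image)
  have act: "(tableau_action G s v T, tableau_action G s v T') \<in> row_equiv G n s"
    if "(T, T') \<in> row_equiv G n s" "v \<in> carrier ?W" for v T T'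
    using that by (auto simp: row_equiv_def row tableau_action_closed[OF assms(1)])
  have "T' \<in> tableau_action G s w ` (row_equiv G n s `` {T})"
    if T': "(tableau_action G s w T, T') \<in> row_equiv G n s" for T'
  proof -
    have m: "T' \<in> tableaux G n s" using T' by (simp add: row_equiv_def)
    have "(tableau_action G s (inv\<^bsub>?W\<^esub> w) (tableau_action G s w T),
        tableau_action G s (inv\<^bsub>?W\<^esub> w) T') \<in> row_equiv G n s"
      using act T' assms(2) by simp
    moreover have "tableau_action G s (inv\<^bsub>?W\<^esub> w) (tableau_action G s w T) = T"
      using tableau_action_one[OF is_group] assms(2,3)
      by (simp add: tableau_action_mult[OF assms(1), where n = n, symmetric])
    moreover have "T' = tableau_action G s w (tableau_action G s (inv\<^bsub>?W\<^esub> w) T')"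
      using tableau_action_one[OF is_group] assms(2) m
      by (simp add: tableau_action_mult[OF assms(1), where n = n, symmetric])
    ultimately show ?thesis by auto
  qed
  then show ?thesis using act[OF _ assms(2)] by (auto simp: tabloid_action_def)
qed

lemma tabloid_action_closed:
  assumes "comm_group G" "w \<in> carrier (wreath_product G n)" "C \<in> tabloids G n s"
  shows "tabloid_action G s w C \<in> tabloids G n s"
proof -
  obtain T where T: "T \<in> tableaux G n s" "C = row_equiv G n s `` {T}"
    using assms(3) unfolding tabloids_def by (rule quotientE)
  show ?thesis
    unfolding T(2) tabloid_action_class[OF assms(1,2) T(1)] tabloids_def
    by (rule quotientI[OF tableau_action_closed[OF assms(1,2) T(1)]])
qed

lemma tabloids_subset:
  assumes "C \<in> tabloids G n s"
  shows "C \<subseteq> tableaux G n s"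
  using assms by (auto simp: tabloids_def row_equiv_def elim!: quotientE)

lemma tabloid_action_one:
  assumes "group G" "C \<in> tabloids G n s"
  shows "tabloid_action G s \<one>\<^bsub>wreath_product G n\<^esub> C = C"
proof -
  have "tableau_action G s \<one>\<^bsub>wreath_product G n\<^esub> ` C = (\<lambda>T. T) ` C"
    using tabloids_subset[OF assms(2)]
    by (intro image_cong refl tableau_action_one[OF assms(1)]) (rule subsetD)
  then show ?thesis by (simp add: tabloid_action_def)
qed

lemma tabloid_action_mult:
  assumes "comm_group G" "v \<in> carrier (wreath_product G n)" "w \<in> carrier (wreath_product G n)"
    "C \<in> tabloids G n s"
  shows "tabloid_action G s (v \<otimes>\<^bsub>wreath_product G n\<^esub> w) C =
    tabloid_action G s v (tabloid_action G s w C)"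
  unfolding tabloid_action_def image_image using tabloids_subset[OF assms(4)]
  by (intro image_cong refl tableau_action_mult[OF assms(1-3)]) (rule subsetD)

end

theory Submission
  imports Defs
begin

text \<open>
  A tabloid is encoded as a configuration, which assigns to every integer in \<open>{1..n}\<close> its row and
  its coset.

  For sufficiency, one moves boxes between two rows at a time. If \<open>p \<le> m\<close> and \<open>m + p \<le> N\<close>, the
  incidence matrix of \<open>p\<close>-subsets and \<open>m\<close>-subsets of an \<open>N\<close>-set has a left inverse. It writes the
  counting function of the new configurations as a linear combination of those of the old ones, so
  transitivity is inherited. The condition \<open>k \<le> l\<close> together with dominance is equivalent to
  reachability by such moves; this is read off the excesses \<open>\<Sum>i. max (\<alpha> i - t) 0\<close>, whose
  pointwise comparison is dominance and which are additive under unions of partitions.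

  For necessity, let \<open>\<epsilon>\<close> be a homomorphism on the wreath product and \<open>L\<close> a submonoid such that
  the stabiliser in \<open>L\<close> of every configuration of the first shape is mapped onto the whole target,
  while the stabiliser of one configuration \<open>T\<close> of the second shape lies in the kernel. Exchanging
  the elements of \<open>L\<close> in a nontrivial fibre of \<open>\<epsilon>\<close> for those in the kernel preserves transitivity on
  the first shape but not on the second. If \<open>l < k\<close>, take for \<open>\<epsilon>\<close> the product of the labels and
  for \<open>L\<close> the label vectors supported off the unlabelled row of \<open>T\<close>. If dominance fails, take the
  sign and the elements preserving the columns of \<open>T\<close>.
\<close>

section \<open>Inclusion matrices of subsets\<close>

text \<open>The unlabelled row cannot be treated as one more row of \<sigma>. Boxes may enter it,
  since a coset of a smaller subgroup determines one of a larger subgroup, but no move shortens it.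
  This is why exchanging the lengths of two rows appears as a move next to transferring one box. The
  moves also destroy the order of the rows. Excess copes with this because it is symmetric in the
  parts, whereas partial sums would require sorting again and tracking the position of k. Row
  lengths stay arbitrary until a final permutation. Excess also counts the boxes beyond column t,
  which is the quantity the pigeonhole argument for necessity needs.

  Necessity names no definite counterexample. A fibre of \<epsilon> and its modification have the
  same size and are both transitive on the first shape, but contain different numbers of elements
  fixing T. Hence at least one of them fails on the second shape, and it does not matter
  which.\<close>

lemma triangular_system:
  fixes w :: "nat \<Rightarrow> nat \<Rightarrow> real" and z :: "nat \<Rightarrow> real"
  assumes "\<And>k. k \<le> p \<Longrightarrow> w k k \<noteq> 0"
  shows "\<exists>\<eta>. \<forall>k\<le>p. (\<Sum>j\<le>k. w k j * \<eta> j) = z k"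
  using assms
proof (induction p)
  case 0
  then show ?case by (intro exI[of _ "\<lambda>_. z 0 / w 0 0"]) simp
next
  case (Suc p)
  then obtain \<eta> where \<eta>: "\<forall>k\<le>p. (\<Sum>j\<le>k. w k j * \<eta> j) = z k" by auto
  define x where "x = (z (Suc p) - (\<Sum>j\<le>p. w (Suc p) j * \<eta> j)) / w (Suc p) (Suc p)"
  have *: "(\<Sum>j\<le>k. w i j * (\<eta>(Suc p := x)) j) = (\<Sum>j\<le>k. w i j * \<eta> j)" if "k \<le> p" for k i
    using that by (intro sum.cong) auto
  have "(\<Sum>j\<le>Suc p. w (Suc p) j * (\<eta>(Suc p := x)) j) = z (Suc p)"
    using Suc.prems[of "Suc p"] *[of p "Suc p"] by (simp add: x_def)
  then show ?case using \<eta> * by (intro exI[of _ "\<eta>(Suc p := x)"]) (auto simp: le_Suc_eq)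
qed

lemma sum_Pow_card:
  fixes f :: "nat \<Rightarrow> real"
  assumes "finite K"
  shows "(\<Sum>Q\<in>Pow K. f (card Q)) = (\<Sum>j\<le>card K. real (card K choose j) * f j)"
proof -
  have "(\<Sum>Q\<in>Pow K. f (card Q)) = (\<Sum>j\<le>card K. \<Sum>Q | Q \<in> Pow K \<and> card Q = j. f (card Q))"
    using assms by (intro sum.group[symmetric]) (auto intro: card_mono)
  also have "\<dots> = (\<Sum>j\<le>card K. real (card {Q. Q \<subseteq> K \<and> card Q = j}) * f j)"
    by (intro sum.cong) auto
  finally show ?thesis using assms by (simp add: n_subsets)
qed

text \<open>Symmetry under the permutations preserving A suggests coefficients depending only on the
  size of A - B. Grouping the sets B by Q = A - B, a subset of K = A - A', leaves one equation for
  each size of K, and only sizes up to that of K occur in it: a triangular system. \<eta> is fixed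
  before I, A and A' because one solution has to serve many ground sets of the same size.\<close>

lemma inclusion_left_inverse:
  assumes "p \<le> m" "m + p \<le> N"
  obtains \<eta> :: "nat \<Rightarrow> real" where
    "\<And>I A A' :: 'i set. finite I \<Longrightarrow> card I = N \<Longrightarrow> A \<subseteq> I \<Longrightarrow> A' \<subseteq> I \<Longrightarrow> card A = p \<Longrightarrow> card A' = p \<Longrightarrow>
      (\<Sum>B | B \<subseteq> I \<and> card B = m \<and> A' \<subseteq> B. \<eta> (card (A - B))) = (if A' = A then 1 else 0)"
proof -
  \<comment> \<open>With k = |A - A'| and j = |Q|, this counts the m-sets B containing A' with A - B
    = Q. The guard matters: where the subtraction is truncated, the binomial would be 1 instead of
    0.\<close>
  define v where "v k j = (if p + (k - j) \<le> m then (N - p - k) choose (m - p - (k - j)) else 0)" for k j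
  \<comment> \<open>The diagonal value is (N - p - k) choose (m - p), which is nonzero because k
    \<le> p and m + p \<le> N.\<close>
  have "real (k choose k) * real (v k k) \<noteq> 0" if "k \<le> p" for k
    using assms that by (auto simp: v_def)
  from triangular_system[of p "\<lambda>k j. real (k choose j) * real (v k j)" "\<lambda>k. if k = 0 then 1 else 0", OF this]
  obtain \<eta> :: "nat \<Rightarrow> real" where \<eta>:
    "\<And>k. k \<le> p \<Longrightarrow> (\<Sum>j\<le>k. real (k choose j) * real (v k j) * \<eta> j) = (if k = 0 then 1 else 0)" by auto
  show thesis
  proof
    fix I A A' :: "'i set"
    assume I: "finite I" "card I = N" and A: "A \<subseteq> I" "A' \<subseteq> I" "card A = p" "card A' = p"
    note fin = finite_subset[OF A(1) I(1)] finite_subset[OF A(2) I(1)]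
    define K where "K = A - A'"
    define S where "S = {B. B \<subseteq> I \<and> card B = m \<and> A' \<subseteq> B}"
    have S: "finite S" using I by (auto simp: S_def)
    \<comment> \<open>Such a B contains \<open>B0\<close> and misses Q, so only its trace on the
      remaining points \<open>Z\<close> is free.\<close>
    have fib: "card {B \<in> S. A - B = Q} = v (card K) (card Q)" if Q: "Q \<subseteq> K" for Q
    proof -
      define B0 where "B0 = A' \<union> (A - Q)"
      define Z where "Z = I - (A \<union> A')"
      have B0: "B0 = A' \<union> (K - Q)" "A' \<inter> (K - Q) = {}" using Q by (auto simp: B0_def K_def)
      have cB0: "card B0 = p + (card K - card Q)"
        using Q fin unfolding B0(1) by (subst card_Un_disjoint)
          (auto simp: A K_def card_Diff_subset finite_subset)
      have "card (A \<union> A') = p + card K"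
        using card_Un_disjoint[of A' K] fin A by (auto simp: K_def Un_commute)
      then have cZ: "card Z = N - p - card K"
        using A I fin by (simp add: Z_def card_Diff_subset)
      have "bij_betw (\<lambda>P. B0 \<union> P) {P. P \<subseteq> Z \<and> card B0 + card P = m} {B \<in> S. A - B = Q}"
      proof (rule bij_betw_byWitness[where f' = "\<lambda>B. B \<inter> Z"])
        have d: "B0 \<inter> Z = {}" "B0 \<subseteq> I" using A by (auto simp: B0_def Z_def)
        have fB: "finite B0" using fin by (auto simp: B0_def)
        show "\<forall>P\<in>{P. P \<subseteq> Z \<and> card B0 + card P = m}. (B0 \<union> P) \<inter> Z = P" using d by auto
        have u: "B0 \<union> (B \<inter> Z) = B" if "B \<in> S" "A - B = Q" for B
          using that A by (auto simp: S_def B0_def Z_def)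
        then show "\<forall>B\<in>{B \<in> S. A - B = Q}. B0 \<union> B \<inter> Z = B" by auto
        have c: "card (B0 \<union> P) = card B0 + card P" if "P \<subseteq> Z" for P
          using that d fB I by (intro card_Un_disjoint) (auto intro: finite_subset simp: Z_def)
        show "(\<union>) B0 ` {P. P \<subseteq> Z \<and> card B0 + card P = m} \<subseteq> {B \<in> S. A - B = Q}"
          using d Q by (auto simp: S_def c) (auto simp: B0_def Z_def K_def)
        show "(\<lambda>B. B \<inter> Z) ` {B \<in> S. A - B = Q} \<subseteq> {P. P \<subseteq> Z \<and> card B0 + card P = m}"
        proof (intro subsetI, elim imageE, clarify)
          fix B assume B: "B \<in> S" "Q = A - B"
          then have "card B = card B0 + card (B \<inter> Z)" using c[of "B \<inter> Z"] u[of B] by simp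
          then show "B \<inter> Z \<subseteq> Z \<and> card B0 + card (B \<inter> Z) = m" using B by (simp add: S_def)
        qed
      qed
      then have "card {B \<in> S. A - B = Q} = card {P. P \<subseteq> Z \<and> card B0 + card P = m}"
        by (simp add: bij_betw_same_card)
      also have "\<dots> = v (card K) (card Q)"
      proof (cases "card B0 \<le> m")
        case True
        then have "{P. P \<subseteq> Z \<and> card B0 + card P = m} = {P. P \<subseteq> Z \<and> card P = m - card B0}" by auto
        then show ?thesis using True I by (simp add: n_subsets Z_def[symmetric] cZ v_def cB0) (simp add: n_subsets Z_def cZ[unfolded Z_def])
      next
        case False
        then have "{P. P \<subseteq> Z \<and> card B0 + card P = m} = {}" by auto
        then show ?thesis using False by (simp add: v_def cB0)
      qed
      finally show ?thesis .
    qed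
    have "(\<Sum>B\<in>S. \<eta> (card (A - B))) = (\<Sum>Q\<in>Pow K. \<Sum>B | B \<in> S \<and> A - B = Q. \<eta> (card (A - B)))"
      using S fin by (intro sum.group[symmetric]) (auto simp: K_def S_def)
    also have "\<dots> = (\<Sum>Q\<in>Pow K. real (v (card K) (card Q)) * \<eta> (card Q))"
      by (intro sum.cong) (auto simp: fib)
    also have "\<dots> = (\<Sum>j\<le>card K. real (card K choose j) * (real (v (card K) j) * \<eta> j))"
      using fin by (intro sum_Pow_card) (auto simp: K_def)
    also have "\<dots> = (if card K = 0 then 1 else 0)"
      using \<eta>[of "card K"] card_mono[of A K] A fin by (simp add: K_def mult.assoc)
    also have "card K = 0 \<longleftrightarrow> A' = A"
      using card_subset_eq[of A' A] fin A by (auto simp: K_def)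
    finally show "(\<Sum>B | B \<subseteq> I \<and> card B = m \<and> A' \<subseteq> B. \<eta> (card (A - B))) = (if A' = A then 1 else 0)"
      by (simp add: S_def)
  qed
qed

section \<open>Excess and dominance\<close>

text \<open>The number of boxes outside the first t columns of the diagram with row lengths
  \<alpha>.\<close>

definition excess :: "(nat \<Rightarrow> nat) \<Rightarrow> nat \<Rightarrow> nat"
  where "excess \<alpha> t = (\<Sum>i | t < \<alpha> i. \<alpha> i - t)"

lemma finite_above:
  assumes "finite {i. \<alpha> i \<noteq> (0::nat)}"
  shows "finite {i. t < \<alpha> i}"
  by (rule finite_subset[OF _ assms]) auto

lemma excess_eq_sum:
  assumes "finite S" "{i. t < \<alpha> i} \<subseteq> S"
  shows "excess \<alpha> t = (\<Sum>i\<in>S. \<alpha> i - t)"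
  unfolding excess_def using assms by (intro sum.mono_neutral_left) auto

lemma sum_le_excess:
  assumes "finite {i. \<alpha> i \<noteq> 0}" "finite S"
  shows "(\<Sum>i\<in>S. \<alpha> i - t) \<le> excess \<alpha> t"
proof -
  have "excess \<alpha> t = (\<Sum>i\<in>S \<union> {i. t < \<alpha> i}. \<alpha> i - t)"
    using assms finite_above[OF assms(1)] by (intro excess_eq_sum) auto
  then show ?thesis using assms finite_above[OF assms(1)] by (simp add: sum_mono2)
qed

lemma excess_parts: "excess \<alpha> t = (\<Sum>x\<in>#parts \<alpha>. x - t)" if "finite {i. \<alpha> i \<noteq> 0}"
proof -
  have "excess \<alpha> t = (\<Sum>i | \<alpha> i \<noteq> 0. \<alpha> i - t)"
    using that by (intro excess_eq_sum) auto
  then show ?thesis by (simp add: parts_def image_mset.compositionality comp_def sum_unfold_sum_mset)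
qed

lemma excess_zero: "excess \<alpha> 0 = psize \<alpha>"
  by (simp add: excess_def psize_def)

lemma is_partition_one_row: "is_partition (one_row k)"
  by (auto simp: is_partition_def one_row_def decseq_def intro: finite_subset[of _ "{0}"])

lemma excess_one_row: "excess (one_row k) t = k - t"
  by (subst excess_eq_sum[of "{0}"]) (auto simp: one_row_def split: if_splits)

lemma excess_partition_union:
  assumes "is_partition \<alpha>" "is_partition \<beta>"
  shows "excess (partition_union \<alpha> \<beta>) t = excess \<alpha> t + excess \<beta> t"
  using assms is_partition_partition_union[of \<alpha> \<beta>]
  by (simp add: excess_parts parts_partition_union is_partition_def)

text \<open>The sum of the first m rows is at most the excess at t plus m * t, for all m and t. For
  a decreasing sequence equality holds if the first m rows are those longer than t, and also if t is
  the length of row m. Each direction uses equality on one side and the bound on the other.\<close>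

lemma dominated_iff_excess:
  assumes "is_partition \<alpha>" "is_partition \<beta>"
  shows "dominated \<alpha> \<beta> \<longleftrightarrow> (\<forall>t. excess \<alpha> t \<le> excess \<beta> t)"
proof (intro iffI allI)
  fix t assume d: "dominated \<alpha> \<beta>"
  have fin: "finite {i. \<alpha> i \<noteq> 0}" "finite {i. \<beta> i \<noteq> 0}" and dec: "decseq \<alpha>"
    using assms by (auto simp: is_partition_def)
  have "\<exists>m. {i. t < \<alpha> i} = {..<m}"
  proof -
    obtain i where "\<alpha> i = 0" using ex_new_if_finite[OF infinite_UNIV_nat fin(1)] by auto
    then have ex: "\<exists>i. \<alpha> i \<le> t" by (metis le0)
    define m0 where "m0 = (LEAST i. \<alpha> i \<le> t)"
    have "\<alpha> m0 \<le> t" unfolding m0_def using ex by (rule LeastI_ex)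
    then have "i < m0" if "t < \<alpha> i" for i
      using decseqD[OF dec, of m0 i] that by (meson le_trans not_less)
    moreover have "t < \<alpha> i" if "i < m0" for i
      using not_less_Least[of i "\<lambda>i. \<alpha> i \<le> t"] that unfolding m0_def by (simp add: not_le)
    ultimately have "{i. t < \<alpha> i} = {..<m0}" by auto
    then show ?thesis by blast
  qed
  then obtain m where m: "{i. t < \<alpha> i} = {..<m}" by blast
  have "excess \<alpha> t + m * t = (\<Sum>i<m. (\<alpha> i - t) + t)"
    unfolding excess_def m by (simp add: sum.distrib)
  also have "\<dots> = (\<Sum>i<m. \<alpha> i)"
  proof (rule sum.cong[OF refl])
    fix i assume "i \<in> {..<m}"
    then have "t < \<alpha> i" unfolding m[symmetric] by simp
    then show "\<alpha> i - t + t = \<alpha> i" by simp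
  qed
  also have "\<dots> \<le> (\<Sum>i<m. \<beta> i)" using d by (simp add: dominated_def)
  also have "\<dots> \<le> (\<Sum>i<m. (\<beta> i - t) + t)" by (rule sum_mono) simp
  also have "\<dots> \<le> excess \<beta> t + m * t" using sum_le_excess[OF fin(2), of "{..<m}" t] by (simp add: sum.distrib)
  finally show "excess \<alpha> t \<le> excess \<beta> t" by simp
next
  assume e: "\<forall>t. excess \<alpha> t \<le> excess \<beta> t"
  have fin: "finite {i. \<alpha> i \<noteq> 0}" and dec: "decseq \<beta>"
    using assms by (auto simp: is_partition_def)
  show "dominated \<alpha> \<beta>"
    unfolding dominated_def
  proof
    fix m
    let ?t = "\<beta> m"
    have ge: "?t \<le> \<beta> i" if "i < m" for i using decseqD[OF dec, of i m] that by simp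
    have "i < m" if "?t < \<beta> i" for i
      using decseqD[OF dec, of m i] that by (meson leD not_less)
    then have sub: "{i. ?t < \<beta> i} \<subseteq> {..<m}" by auto
    have "(\<Sum>i<m. \<alpha> i) \<le> (\<Sum>i<m. (\<alpha> i - ?t) + ?t)" by (rule sum_mono) simp
    also have "\<dots> \<le> excess \<alpha> ?t + m * ?t" using sum_le_excess[OF fin, of "{..<m}" ?t] by (simp add: sum.distrib)
    also have "\<dots> \<le> excess \<beta> ?t + m * ?t" using e by simp
    also have "\<dots> = (\<Sum>i<m. (\<beta> i - ?t) + ?t)"
      by (subst excess_eq_sum[OF _ sub]) (simp_all add: sum.distrib)
    also have "\<dots> = (\<Sum>i<m. \<beta> i)" using ge by (intro sum.cong) auto
    finally show "(\<Sum>i<m. \<alpha> i) \<le> (\<Sum>i<m. \<beta> i)" .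
  qed
qed

section \<open>Reaching a dominating shape by elementary moves\<close>

lemma finite_support_upd:
  assumes "finite {i. \<sigma> i \<noteq> (0::nat)}"
  shows "finite {i. (\<sigma>(r := a)) i \<noteq> 0}"
  by (rule finite_subset[of _ "insert r {i. \<sigma> i \<noteq> 0}"]) (use assms in auto)

lemma excess_upd:
  assumes "finite {i. \<sigma> i \<noteq> 0}"
  shows "excess (\<sigma>(r := a)) t + (\<sigma> r - t) = excess \<sigma> t + (a - t)"
proof -
  let ?S = "insert r {i. \<sigma> i \<noteq> 0}"
  have "excess (\<sigma>(r := a)) t = (\<Sum>i\<in>?S. (\<sigma>(r := a)) i - t)"
    using assms by (intro excess_eq_sum) auto
  also have "\<dots> = (a - t) + (\<Sum>i\<in>?S - {r}. \<sigma> i - t)"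
    using assms by (subst sum.remove[of _ r]) (auto intro!: sum.cong)
  finally have 1: "excess (\<sigma>(r := a)) t = (a - t) + (\<Sum>i\<in>?S - {r}. \<sigma> i - t)" .
  have "excess \<sigma> t = (\<Sum>i\<in>?S. \<sigma> i - t)"
    using assms by (intro excess_eq_sum) auto
  also have "\<dots> = (\<sigma> r - t) + (\<Sum>i\<in>?S - {r}. \<sigma> i - t)"
    using assms by (subst sum.remove[of _ r]) auto
  finally show ?thesis using 1 by simp
qed

text \<open>Turns comparisons of excesses at neighbouring thresholds into comparisons of numbers of
  long rows.\<close>

lemma excess_Suc:
  assumes "finite {i. \<sigma> i \<noteq> 0}"
  shows "excess \<sigma> t = excess \<sigma> (Suc t) + card {i. t < \<sigma> i}"
proof -
  have "excess \<sigma> (Suc t) = (\<Sum>i | t < \<sigma> i. \<sigma> i - Suc t)"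
    using finite_above[OF assms] by (intro excess_eq_sum) auto
  then have "excess \<sigma> (Suc t) + card {i. t < \<sigma> i} = (\<Sum>i | t < \<sigma> i. (\<sigma> i - Suc t) + 1)"
    by (simp only: sum.distrib card_eq_sum)
  also have "\<dots> = excess \<sigma> t" unfolding excess_def by (intro sum.cong) auto
  finally show ?thesis by simp
qed

lemma le_excess_zero:
  assumes "finite {i. \<sigma> i \<noteq> 0}"
  shows "\<sigma> r \<le> excess \<sigma> 0"
  using sum_le_excess[OF assms, of "{r}" 0] by simp

lemma card_above_split:
  assumes "finite {i. \<sigma> i \<noteq> (0::nat)}" "w < z"
  shows "card {i. w < \<sigma> i} = card {i. w < \<sigma> i \<and> \<sigma> i < z} + card {i. z - 1 < \<sigma> i}"
proof -
  let ?A = "{i. w < \<sigma> i \<and> \<sigma> i < z}" and ?B = "{i. z - 1 < \<sigma> i}"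
  have "finite ?A" by (rule finite_subset[OF _ finite_above[OF assms(1), of w]]) auto
  moreover have "?A \<inter> ?B = {}" using assms(2) by auto
  ultimately have "card (?A \<union> ?B) = card ?A + card ?B"
    using finite_above[OF assms(1), of "z - 1"] by (intro card_Un_disjoint)
  moreover have "?A \<union> ?B = {i. w < \<sigma> i}" using assms(2) by auto
  ultimately show ?thesis by simp
qed

text \<open>The functions meet at 0, and also at T, where b and hence a vanish. So there is a last
  meeting point before \<open>t0\<close> and a first one after it.\<close>

lemma strict_gap:
  fixes a b :: "nat \<Rightarrow> nat"
  assumes le: "\<And>t. a t \<le> b t" and "a 0 = b 0" "b T = 0" "T \<ge> t0" and t0: "a t0 \<noteq> b t0"
  obtains w z where "Suc w < z" "a w = b w" "a z = b z" "\<And>t. w < t \<Longrightarrow> t < z \<Longrightarrow> a t < b t"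
proof -
  define w where "w = (GREATEST t. t \<le> t0 \<and> a t = b t)"
  define z where "z = (LEAST t. t0 \<le> t \<and> a t = b t)"
  have w: "w \<le> t0 \<and> a w = b w" unfolding w_def
    by (rule GreatestI_nat[where b = t0 and k = 0]) (use assms in auto)
  have w': "t \<le> w" if "t \<le> t0" "a t = b t" for t unfolding w_def
    by (rule Greatest_le_nat[where b = t0]) (use that in auto)
  have "a T = b T" using le[of T] assms(3) by simp
  then have z: "t0 \<le> z \<and> a z = b z" 
    unfolding z_def using LeastI[of "\<lambda>t. t0 \<le> t \<and> a t = b t" T] assms(4) by simp
  have z': "z \<le> t" if "t0 \<le> t" "a t = b t" for t unfolding z_def by (rule Least_le) (use that in auto)
  show ?thesis
  proof
    show "Suc w < z" using w z t0 
      by (cases "w = t0"; cases "z = t0") auto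
    show "a w = b w" "a z = b z" using w z by auto
    show "a t < b t" if "w < t" "t < z" for t
      using w'[of t] z'[of t] le[of t] that by (cases "t \<le> t0") (auto simp: less_le)
  qed
qed

lemma sum_diff_le:
  fixes a a' b :: "nat \<Rightarrow> nat"
  assumes "\<And>t. a t \<le> a' t"
  shows "(\<Sum>t\<le>T. b t - a' t) \<le> (\<Sum>t\<le>T. b t - a t)"
  using assms by (intro sum_mono diff_le_mono2)

lemma sum_diff_less:
  fixes a a' b :: "nat \<Rightarrow> nat"
  assumes "\<And>t. a t \<le> a' t" "t0 \<le> T" "a t0 < a' t0" "a t0 < b t0"
  shows "(\<Sum>t\<le>T. b t - a' t) < (\<Sum>t\<le>T. b t - a t)"
  using assms by (intro sum_strict_mono_ex1) (auto intro!: bexI[of _ t0] diff_le_mono2)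

lemma count_image_mset_set:
  "finite A \<Longrightarrow> count (image_mset f (mset_set A)) v = card {i \<in> A. f i = v}"
  by (simp add: count_image_mset' Int_def) (rule arg_cong[of _ _ card], auto)

text \<open>Differences of the excess count the parts above each threshold and so determine the
  multiplicity of every positive value. Zero rows are counted only below a common bound M, which
  makes the two multisets of rows finite and equal; beyond M the permutation is the
  identity.\<close>

lemma excess_eqD:
  assumes "finite {i. \<sigma> i \<noteq> 0}" "finite {i. \<tau> i \<noteq> 0}" "\<And>t. excess \<sigma> t = excess \<tau> t"
  obtains p where "bij p" "\<tau> = \<sigma> \<circ> p"
proof -
  obtain M where M: "{i. \<sigma> i \<noteq> 0} \<union> {i. \<tau> i \<noteq> 0} \<subseteq> {..<M}"
    using finite_nat_bounded[of "{i. \<sigma> i \<noteq> 0} \<union> {i. \<tau> i \<noteq> 0}"] assms by auto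
  have cnt: "card {i \<in> {..<M}. \<alpha> i = v} = (if v = 0 then M - card {i. 0 < \<alpha> i} else card {i. v - 1 < \<alpha> i} - card {i. v < \<alpha> i})"
    if \<alpha>: "{i. \<alpha> i \<noteq> 0} \<subseteq> {..<M}" for \<alpha> :: "nat \<Rightarrow> nat" and v
  proof (cases "v = 0")
    case True
    have "{i \<in> {..<M}. \<alpha> i = 0} = {..<M} - {i. 0 < \<alpha> i}" by auto
    moreover have "{i. 0 < \<alpha> i} \<subseteq> {..<M}" using \<alpha> by auto
    ultimately show ?thesis using True by (simp add: card_Diff_subset finite_subset)
  next
    case False
    have "{i \<in> {..<M}. \<alpha> i = v} = {i. v - 1 < \<alpha> i \<and> \<alpha> i < Suc v}"
      using \<alpha> False by (auto simp: subset_iff)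
    then show ?thesis using False card_above_split[of \<alpha> "v - 1" "Suc v"] finite_subset[OF \<alpha>] by simp
  qed
  have "card {i. t < \<sigma> i} = card {i. t < \<tau> i}" for t
    using excess_Suc[OF assms(1), of t] excess_Suc[OF assms(2), of t] assms(3) by simp
  then have "count (image_mset \<tau> (mset_set {..<M})) v = count (image_mset \<sigma> (mset_set {..<M})) v" for v
    using cnt[of \<sigma> v] cnt[of \<tau> v] M
    by (simp add: count_image_mset_set)
  then have "image_mset \<tau> (mset_set {..<M}) = image_mset \<sigma> (mset_set {..<M})" by (rule multiset_eqI)
  from image_mset_eq_implies_permutes[OF _ this]
  obtain p where p: "p permutes {..<M}" "\<forall>x\<in>{..<M}. \<tau> x = \<sigma> (p x)" by auto
  have "\<tau> x = \<sigma> (p x)" for x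
  proof (cases "x < M")
    case False
    then have "p x = x" using p(1) by (simp add: permutes_not_in)
    moreover have "\<sigma> x = 0" "\<tau> x = 0" using M False by auto
    ultimately show ?thesis by simp
  qed (use p in auto)
  then show ?thesis using that[of p] permutes_bij[OF p(1)] by (simp add: fun_eq_iff)
qed

text \<open>Moving one box from a row of length y to a row of length x raises the excess by one
  precisely at the thresholds from y to x.\<close>

lemma transfer_diff:
  fixes x y t :: nat
  assumes "0 < y" "y \<le> x"
  shows "(Suc x - t) + (y - 1 - t) = (x - t) + (y - t) + (if y \<le> t \<and> t \<le> x then 1 else 0)"
  using assms by auto

text \<open>Compare the excess a of \<sigma> with k and the excess b of \<tau> with l. If they
  agree, the two multisets of parts agree: either k = l and a permutation finishes, or l is a row of
  \<sigma> and is exchanged with k. Otherwise take a maximal interval on which a < b; it contains at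
  least two parts of \<sigma> with k, and moving a box between these keeps a \<le> b.\<close>

lemma dominance_chain:
  fixes P :: "(nat \<Rightarrow> nat) \<Rightarrow> nat \<Rightarrow> bool"
  assumes raise: "\<And>\<sigma> k r s. P \<sigma> k \<Longrightarrow> r \<noteq> s \<Longrightarrow> 0 < \<sigma> s \<Longrightarrow> \<sigma> s \<le> \<sigma> r \<Longrightarrow>
      P (\<sigma>(r := Suc (\<sigma> r), s := \<sigma> s - 1)) k"
    and swap: "\<And>\<sigma> k r. P \<sigma> k \<Longrightarrow> k < \<sigma> r \<Longrightarrow> \<sigma> r \<le> l \<Longrightarrow> P (\<sigma>(r := k)) (\<sigma> r)"
    and unit: "\<And>\<sigma> k r. P \<sigma> k \<Longrightarrow> 0 < \<sigma> r \<Longrightarrow> \<sigma> r \<le> k \<Longrightarrow> k < l \<Longrightarrow> P (\<sigma>(r := \<sigma> r - 1)) (Suc k)"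
    and perm: "\<And>\<sigma> k p. P \<sigma> k \<Longrightarrow> bij p \<Longrightarrow> P (\<sigma> \<circ> p) k"
    and \<tau>: "finite {i. \<tau> i \<noteq> 0}"
    and P: "P \<sigma> k" and \<sigma>: "finite {i. \<sigma> i \<noteq> 0}" and "k \<le> l"
    and "\<And>t. excess \<sigma> t + (k - t) \<le> excess \<tau> t + (l - t)"
    and "excess \<sigma> 0 + k = excess \<tau> 0 + l"
  shows "P \<tau> l"
proof -
  define b where "b t = excess \<tau> t + (l - t)" for t
  \<comment> \<open>The total number of boxes; no part is larger, so no deficit occurs beyond this
    threshold.\<close>
  define T where "T = excess \<tau> 0 + l"
  have bT: "b T = 0"
  proof -
    have "{i. T < \<tau> i} = {}" using le_excess_zero[OF \<tau>] by (auto simp: T_def not_less intro: trans_le_add1)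
    then show ?thesis by (simp add: b_def excess_def T_def)
  qed
  \<comment> \<open>The measure is the total deficit b - a plus l - k. A move inside \<sigma> lowers
    the deficit and keeps k; a move into the unlabelled row does not raise the deficit and brings k
    closer to l.\<close>
  show ?thesis using P \<sigma> assms(8-10)
  proof (induction "(\<Sum>t\<le>T. b t - (excess \<sigma> t + (k - t))) + (l - k)" arbitrary: \<sigma> k rule: less_induct)
    case less
    note \<sigma> = less.prems(2)
    define a where "a t = excess \<sigma> t + (k - t)" for t
    have ab: "a t \<le> b t" for t using less.prems by (simp add: a_def b_def)
    have ab0: "a 0 = b 0" "a 0 = T" using less.prems by (simp_all add: a_def b_def T_def)
    have aS: "a t = a (Suc t) + card {i. t < \<sigma> i} + (if t < k then 1 else 0)" for t
      using excess_Suc[OF \<sigma>, of t] by (auto simp: a_def)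
    have bS: "b t = b (Suc t) + card {i. t < \<tau> i} + (if t < l then 1 else 0)" for t
      using excess_Suc[OF \<tau>, of t] by (auto simp: b_def)
    \<comment> \<open>An exchange leaves the multiset of parts alone, so only l - k
      decreases.\<close>
    have swap': "P \<tau> l" if r: "k < \<sigma> r" "\<sigma> r \<le> l" for r
    proof -
      have e: "excess (\<sigma>(r := k)) t + (\<sigma> r - t) = a t" for t
        using excess_upd[OF \<sigma>, of r k t] by (simp add: a_def)
      show ?thesis
      proof (rule less.hyps[of "\<sigma>(r := k)" "\<sigma> r"])
        show "(\<Sum>t\<le>T. b t - (excess (\<sigma>(r := k)) t + (\<sigma> r - t))) + (l - \<sigma> r)
            < (\<Sum>t\<le>T. b t - (excess \<sigma> t + (k - t))) + (l - k)"
          using r by (simp add: e a_def[symmetric])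
        show "P (\<sigma>(r := k)) (\<sigma> r)" using swap[OF less.prems(1) r] .
        show "excess (\<sigma>(r := k)) t + (\<sigma> r - t) \<le> excess \<tau> t + (l - t)" for t
          unfolding e using ab[of t] by (simp add: b_def)
        show "excess (\<sigma>(r := k)) 0 + \<sigma> r = excess \<tau> 0 + l" using e[of 0] ab0 by (simp add: b_def)
      qed (use r finite_support_upd[OF \<sigma>] in auto)
    qed
    show ?case
    proof (cases "\<forall>t. a t = b t")
      case True
      show ?thesis
      proof (cases "k = l")
        case eq: True
        then have "excess \<sigma> t = excess \<tau> t" for t using True by (simp add: a_def b_def)
        then obtain p where "bij p" "\<tau> = \<sigma> \<circ> p" using excess_eqD[OF \<sigma> \<tau>] by metis
        then show ?thesis using perm less.prems(1) eq by simp
      next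
        case False
        \<comment> \<open>Equal excesses give equal multisets of parts. As k differs from l, the
          part l must be a row of \<sigma>; it is found by counting the rows above l - 1 and above
          l.\<close>
        then have kl: "k < l" using less.prems by simp
        then have "\<not> l - 1 < k" "l - 1 < l" "Suc (l - 1) = l" by simp_all
        then have "card {i. l - 1 < \<sigma> i} = card {i. l - 1 < \<tau> i} + 1"
          using aS[of "l - 1"] bS[of "l - 1"] True by simp
        moreover have "card {i. l < \<sigma> i} = card {i. l < \<tau> i}"
          using aS[of l] bS[of l] True kl by simp
        moreover have "card {i. l < \<tau> i} \<le> card {i. l - 1 < \<tau> i}"
          by (rule card_mono[OF finite_above[OF \<tau>, of "l - 1"]]) auto
        ultimately have gt: "card {i. l - 1 < \<sigma> i} > card {i. l < \<sigma> i}" by linarith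
        have "\<not> {i. l - 1 < \<sigma> i} \<subseteq> {i. l < \<sigma> i}"
        proof
          assume "{i. l - 1 < \<sigma> i} \<subseteq> {i. l < \<sigma> i}"
          from card_mono[OF finite_above[OF \<sigma>, of l] this] gt show False by linarith
        qed
        then obtain r where "l - 1 < \<sigma> r" "\<not> l < \<sigma> r" by blast
        then have "\<sigma> r = l" by simp
        then show ?thesis using swap' kl by auto
      qed
    next
      case False
      then obtain t0 where t0: "a t0 \<noteq> b t0" by blast
      have "t0 \<le> T"
      proof (rule ccontr)
        assume "\<not> t0 \<le> T"
        moreover have "b t \<le> b T" if "T \<le> t" for t
          using that
        proof (induction rule: dec_induct)
          case (step m)
          then show ?case using bS[of m] by simp
        qed simp
        ultimately have "b t0 = 0" using bT by (metis le_zero_eq nat_le_linear)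
        then show False using t0 ab[of t0] by simp
      qed
      from strict_gap[OF ab ab0(1) bT this t0] obtain w z where
        wz: "Suc w < z" "a w = b w" "a z = b z" and gap: "\<And>t. w < t \<Longrightarrow> t < z \<Longrightarrow> a t < b t" by blast
      define c where "c = card {i. w < \<sigma> i \<and> \<sigma> i < z}"
      have zz: "Suc (z - 1) = z" using wz by simp
      have ind: "(if w < x then 1 else 0) = (if w < x \<and> x < z then 1 else 0) + (if z - 1 < x then 1 else 0 :: nat)" for x
        using wz(1) by auto
      define c' where "c' = card {i. w < \<tau> i \<and> \<tau> i < z}"
      \<comment> \<open>At w the functions separate, so \<sigma> with k has more parts above w than
        \<tau> with l. At z they meet again, so it has fewer parts of size at least z. Subtracting,
        it has at least two more parts strictly between w and z.\<close>
      have "card {i. w < \<tau> i} + (if w < l then 1 else 0) < card {i. w < \<sigma> i} + (if w < k then 1 else 0)"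
        using aS[of w] bS[of w] wz gap[of "Suc w"] by simp
      moreover have "card {i. z - 1 < \<sigma> i} + (if z - 1 < k then 1 else 0)
          < card {i. z - 1 < \<tau> i} + (if z - 1 < l then 1 else 0)"
        using aS[of "z - 1"] bS[of "z - 1"] wz gap[of "z - 1"] unfolding zz by simp
      moreover have "card {i. w < \<sigma> i} = c + card {i. z - 1 < \<sigma> i}"
        "card {i. w < \<tau> i} = c' + card {i. z - 1 < \<tau> i}"
        using card_above_split[OF \<sigma>, of w z] card_above_split[OF \<tau>, of w z] wz
        by (simp_all add: c_def c'_def)
      ultimately have "c + (if w < k \<and> k < z then 1 else 0) \<ge> 2 + (if w < l \<and> l < z then 1 else 0)"
        using ind[of k] ind[of l] by linarith
      \<comment> \<open>If only one row of \<sigma> lies in the gap, then k is the second part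
        there, and no surplus is left for l to lie there too.\<close>
      then consider "2 \<le> c" | "c = 1" "w < k" "k < z" "\<not> (w < l \<and> l < z)"
        by (cases "2 \<le> c") (auto split: if_splits)
      then show ?thesis
      proof cases
        case 1
        have "finite {i. w < \<sigma> i \<and> \<sigma> i < z}"
          by (rule finite_subset[OF _ finite_above[OF \<sigma>, of w]]) auto
        then obtain r0 s0 where "r0 \<noteq> s0" "w < \<sigma> s0" "w < \<sigma> r0" "\<sigma> s0 < z" "\<sigma> r0 < z"
          using card_le_Suc0_iff_eq[of "{i. w < \<sigma> i \<and> \<sigma> i < z}"] 1 unfolding c_def by auto
        then obtain r s where rs: "r \<noteq> s" "w < \<sigma> s" "\<sigma> s \<le> \<sigma> r" "\<sigma> r < z"
          by (cases "\<sigma> s0 \<le> \<sigma> r0") (meson, metis nat_le_linear)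
        \<comment> \<open>The excess grows by one between the two lengths only. Both are strictly
          inside the gap, where the deficit is at least one, so the result is still bounded by
          b.\<close>
        define \<sigma>' where "\<sigma>' = \<sigma>(r := Suc (\<sigma> r), s := \<sigma> s - 1)"
        have \<sigma>s: "(\<sigma>(r := Suc (\<sigma> r))) s = \<sigma> s" using rs(1) by simp
        have v: "excess \<sigma>' t + (\<sigma> r - t) + (\<sigma> s - t) = excess \<sigma> t + (Suc (\<sigma> r) - t) + (\<sigma> s - 1 - t)" for t
          using excess_upd[OF \<sigma>, of r "Suc (\<sigma> r)" t]
            excess_upd[OF finite_support_upd[OF \<sigma>, of r "Suc (\<sigma> r)"], of s "\<sigma> s - 1" t]
          unfolding \<sigma>'_def \<sigma>s by linarith
        have e': "excess \<sigma>' t = excess \<sigma> t + (if \<sigma> s \<le> t \<and> t \<le> \<sigma> r then 1 else 0)" for t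
          using transfer_diff[of "\<sigma> s" "\<sigma> r" t] v[of t] rs by simp
        show ?thesis
        proof (rule less.hyps[of \<sigma>' k])
          show "(\<Sum>t\<le>T. b t - (excess \<sigma>' t + (k - t))) + (l - k) < (\<Sum>t\<le>T. b t - (excess \<sigma> t + (k - t))) + (l - k)"
            using rs gap[of "\<sigma> s"] le_excess_zero[OF \<sigma>, of s] ab0(2)
            by (intro add_strict_right_mono sum_diff_less[of _ _ "\<sigma> s"]) (auto simp: e' a_def)
          show "P \<sigma>' k" unfolding \<sigma>'_def using rs by (intro raise less.prems) auto
          show "finite {i. \<sigma>' i \<noteq> 0}" unfolding \<sigma>'_def by (intro finite_support_upd \<sigma>)
          show "excess \<sigma>' t + (k - t) \<le> excess \<tau> t + (l - t)" for t
          proof (cases "\<sigma> s \<le> t \<and> t \<le> \<sigma> r")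
            case True
            then show ?thesis using gap[of t] rs unfolding e' a_def b_def by simp
          next
            case False
            then have "excess \<sigma>' t = excess \<sigma> t" unfolding e' by simp
            then show ?thesis using ab[of t] unfolding a_def b_def by simp
          qed
          show "excess \<sigma>' 0 + k = excess \<tau> 0 + l" using less.prems rs by (simp add: e')
        qed (use less.prems in simp)
      next
        case 2
        \<comment> \<open>Since k \<le> l while l is outside the gap, even z \<le> l. So the
          unlabelled row may take a box from row r, or the whole length of row r, without exceeding
          l.\<close>
        then have kl: "k < l" using less.prems by auto
        obtain r where r: "w < \<sigma> r" "\<sigma> r < z"
          using 2(1) by (auto simp: c_def card_1_singleton_iff)
        show ?thesis
        proof (cases "\<sigma> r \<le> k")
          case True
          define \<sigma>' where "\<sigma>' = \<sigma>(r := \<sigma> r - 1)"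
          have u: "excess \<sigma>' t + (\<sigma> r - t) = excess \<sigma> t + (\<sigma> r - 1 - t)" for t
            using excess_upd[OF \<sigma>, of r "\<sigma> r - 1" t] by (simp add: \<sigma>'_def)
          have e': "excess \<sigma>' t + (Suc k - t) = a t + (if \<sigma> r \<le> t \<and> t \<le> k then 1 else 0)" for t
            using transfer_diff[of "\<sigma> r" k t] u[of t] r True by (simp add: a_def)
          show ?thesis
          proof (rule less.hyps[of \<sigma>' "Suc k"])
            show "(\<Sum>t\<le>T. b t - (excess \<sigma>' t + (Suc k - t))) + (l - Suc k) < (\<Sum>t\<le>T. b t - (excess \<sigma> t + (k - t))) + (l - k)"
              unfolding e' a_def[symmetric]
              using sum_diff_le[of a "\<lambda>t. a t + (if \<sigma> r \<le> t \<and> t \<le> k then 1 else 0)" b T] kl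
              by (intro add_le_less_mono) auto
            show "P \<sigma>' (Suc k)" unfolding \<sigma>'_def using r True kl by (intro unit less.prems) auto
            show "finite {i. \<sigma>' i \<noteq> 0}" unfolding \<sigma>'_def by (intro finite_support_upd \<sigma>)
            show "excess \<sigma>' t + (Suc k - t) \<le> excess \<tau> t + (l - t)" for t
              unfolding e' using gap[of t] r 2 ab[of t] by (auto simp: b_def)
            show "excess \<sigma>' 0 + Suc k = excess \<tau> 0 + l" using e'[of 0] ab0 r by (simp add: b_def)
          qed (use kl in simp)
        next
          case False
          moreover have "\<sigma> r \<le> l" using 2 r kl by linarith
          ultimately show ?thesis using swap'[of r] by simp
        qed
      qed
    qed
  qed
qed

section \<open>Transfer of transitivity\<close>

lemma card_fibres:
  assumes "finite Y" "finite E" "\<And>y. y \<in> Y \<Longrightarrow> f y \<in> E"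
  shows "(\<Sum>b\<in>E. card {y \<in> Y. f y = b}) = card Y"
  using sum.group[of Y E f "\<lambda>_. 1::nat"] assms by auto

text \<open>
  The hypotheses on \<open>inc\<close> and \<open>x\<close> say that \<open>x\<close> is a left inverse of the incidence matrix \<open>inc\<close>.
  It expresses the number of \<open>y\<close> with \<open>\<psi> y a = b\<close> as a product of a function of \<open>a\<close> and a function
  of \<open>b\<close>; summing over \<open>a\<close> and over \<open>b\<close> shows that both are constant.
\<close>
lemma transitive_subset_left_inverse:
  fixes x :: "'f \<Rightarrow> 'e \<Rightarrow> real"
  assumes tr: "transitive_subset \<phi> E Y" and fin: "finite Y" "finite E" "finite F"
    and \<phi>: "\<And>y. y \<in> Y \<Longrightarrow> bij_betw (\<phi> y) E E"
    and \<psi>: "\<And>y. y \<in> Y \<Longrightarrow> bij_betw (\<psi> y) F F"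
    and inc: "\<And>y d b. y \<in> Y \<Longrightarrow> d \<in> F \<Longrightarrow> b \<in> E \<Longrightarrow> inc (\<psi> y d) (\<phi> y b) \<longleftrightarrow> inc d b"
    and x: "\<And>a d. a \<in> F \<Longrightarrow> d \<in> F \<Longrightarrow> (\<Sum>b | b \<in> E \<and> inc d b. x a b) = (if d = a then 1 else 0)"
  shows "transitive_subset \<psi> F Y"
proof -
  obtain c where Y: "Y \<noteq> {}" and c: "\<And>a b. a \<in> E \<Longrightarrow> b \<in> E \<Longrightarrow> card {y \<in> Y. \<phi> y a = b} = c"
    using tr by (auto simp: transitive_subset_def)
  define h where "h a = real (card {b \<in> E. inc a b})" for a
  define S where "S b = real c * (\<Sum>e\<in>E. x b e)" for b
  have \<psi>F: "\<psi> y a \<in> F" if "y \<in> Y" "a \<in> F" for y a using \<psi>[OF that(1)] that(2) by (auto simp: bij_betw_def)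
  have \<phi>E: "\<phi> y a \<in> E" if "y \<in> Y" "a \<in> E" for y a using \<phi>[OF that(1)] that(2) by (auto simp: bij_betw_def)
  \<comment> \<open>The left inverse replaces the indicator of \<psi> y a = b by a sum over the e
    incident to \<psi> y a. Equivariance moves y from a to e, and the sum over y can then be done
    first.\<close>
  have count: "real (card {y \<in> Y. \<psi> y a = b}) = h a * S b" if ab: "a \<in> F" "b \<in> F" for a b
  proof -
    have shift: "(\<Sum>e | e \<in> E \<and> inc (\<psi> y a) e. x b e) = (\<Sum>e | e \<in> E \<and> inc a e. x b (\<phi> y e))"
      if y: "y \<in> Y" for y
    proof (rule sum.reindex_bij_betw[symmetric])
      show "bij_betw (\<phi> y) {e \<in> E. inc a e} {e \<in> E. inc (\<psi> y a) e}"
        using \<phi>[OF y] inc[OF y ab(1)] unfolding bij_betw_def inj_on_def by (auto simp: image_iff) (metis imageE)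
    qed
    \<comment> \<open>By transitivity on E, the images \<phi> y e cover E uniformly, whatever e is;
      this is what separates a from b.\<close>
    have avg: "(\<Sum>y\<in>Y. x b (\<phi> y e)) = S b" if e: "e \<in> E" for e
    proof -
      have "(\<Sum>y\<in>Y. x b (\<phi> y e)) = (\<Sum>e'\<in>E. \<Sum>y | y \<in> Y \<and> \<phi> y e = e'. x b (\<phi> y e))"
        using fin \<phi>E[OF _ e] by (intro sum.group[symmetric]) auto
      also have "\<dots> = (\<Sum>e'\<in>E. real c * x b e')"
        using c[OF e] by (intro sum.cong) auto
      finally show ?thesis by (simp add: S_def sum_distrib_left)
    qed
    have "real (card {y \<in> Y. \<psi> y a = b}) = (\<Sum>y\<in>Y. if \<psi> y a = b then 1 else 0)"
      using fin by (simp add: sum.If_cases Int_def)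
    also have "\<dots> = (\<Sum>y\<in>Y. \<Sum>e | e \<in> E \<and> inc a e. x b (\<phi> y e))"
      using x[OF ab(2)] ab \<psi>F shift by (intro sum.cong) auto
    also have "\<dots> = (\<Sum>e | e \<in> E \<and> inc a e. \<Sum>y\<in>Y. x b (\<phi> y e))"
      by (rule sum.swap)
    also have "\<dots> = h a * S b" by (simp add: avg h_def)
    finally show ?thesis .
  qed
  have Y0: "real (card Y) > 0" using Y fin by (simp add: card_gt_0_iff)
  have rows: "h a * (\<Sum>b\<in>F. S b) = card Y" if "a \<in> F" for a
  proof -
    have "h a * (\<Sum>b\<in>F. S b) = real (\<Sum>b\<in>F. card {y \<in> Y. \<psi> y a = b})"
      using count that by (simp add: sum_distrib_left)
    also have "\<dots> = card Y" using fin \<psi>F that by (subst card_fibres) auto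
    finally show ?thesis .
  qed
  \<comment> \<open>As \<psi> y is a bijection, each y has exactly one a with \<psi> y a = b, so a
    column also sums to the size of Y.\<close>
  have cols: "(\<Sum>a\<in>F. h a) * S b = card Y" if b: "b \<in> F" for b
  proof -
    define g where "g y = inv_into F (\<psi> y) b" for y
    have g: "\<psi> y a = b \<longleftrightarrow> g y = a" if "y \<in> Y" "a \<in> F" for y a
      using \<psi>[OF that(1)] that(2) b by (auto simp: g_def bij_betw_def f_inv_into_f)
    have "(\<Sum>a\<in>F. h a) * S b = real (\<Sum>a\<in>F. card {y \<in> Y. \<psi> y a = b})"
      using count b by (simp add: sum_distrib_right)
    also have "(\<Sum>a\<in>F. card {y \<in> Y. \<psi> y a = b}) = (\<Sum>a\<in>F. card {y \<in> Y. g y = a})"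
      using g by (intro sum.cong arg_cong[where f = card]) auto
    also have "\<dots> = card Y"
      using fin \<psi> b by (intro card_fibres) (auto simp: g_def bij_betw_def intro!: inv_into_into)
    finally show ?thesis by simp
  qed
  show ?thesis
  proof (cases "F = {}")
    case True
    then show ?thesis using Y by (auto simp: transitive_subset_def)
  next
    case False
    then obtain a0 where a0: "a0 \<in> F" by blast
    define c' where "c' = card {y \<in> Y. \<psi> y a0 = a0}"
    have "card {y \<in> Y. \<psi> y a = b} = c'" if "a \<in> F" "b \<in> F" for a b
    proof -
      have "h a = h a0" using rows[OF that(1)] rows[OF a0] Y0
        by (metis mult_cancel_right mult_zero_right order_less_irrefl)
      moreover have "S b = S a0" using cols[OF that(2)] cols[OF a0] Y0
        by (metis mult_cancel_left mult_zero_left order_less_irrefl)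
      ultimately have "real (card {y \<in> Y. \<psi> y a = b}) = real c'"
        using count that a0 unfolding c'_def by simp
      then show ?thesis by simp
    qed
    moreover have "c' > 0"
      using count[OF a0 a0] rows[OF a0] cols[OF a0] Y0 by (auto simp: c'_def intro!: Nat.gr0I)
    ultimately show ?thesis using Y by (auto simp: transitive_subset_def)
  qed
qed

lemma transitive_subset_bij:
  assumes bij: "bij_betw \<Phi> E F"
    and cl: "\<And>y a. y \<in> Y \<Longrightarrow> a \<in> E \<Longrightarrow> \<phi> y a \<in> E"
    and eq: "\<And>y a. y \<in> Y \<Longrightarrow> a \<in> E \<Longrightarrow> \<psi> y (\<Phi> a) = \<Phi> (\<phi> y a)"
  shows "transitive_subset \<psi> F Y \<longleftrightarrow> transitive_subset \<phi> E Y"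
proof -
  have F: "F = \<Phi> ` E" and inj: "inj_on \<Phi> E" using bij by (auto simp: bij_betw_def)
  have "{y \<in> Y. \<psi> y (\<Phi> a) = \<Phi> b} = {y \<in> Y. \<phi> y a = b}" if "a \<in> E" "b \<in> E" for a b
    using that eq cl inj by (auto simp: inj_on_eq_iff)
  then show ?thesis by (simp add: transitive_subset_def F)
qed

section \<open>Configurations\<close>

text \<open>Forgetting the columns is exactly row equivalence. Row lengths enter only as
  cardinalities and need not be decreasing, so the unsorted shapes met between two partitions are
  covered as well.\<close>

definition configs ::
    "('a, 'b) monoid_scheme \<Rightarrow> nat \<Rightarrow> ('a set \<Rightarrow> nat \<Rightarrow> nat) \<Rightarrow> (nat \<Rightarrow> ('a set \<times> nat) \<times> 'a set) set"
  where "configs G n s =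
    {h \<in> {1..n} \<rightarrow>\<^sub>E {((U, r), c). subgroup U G \<and> c \<in> rcosets\<^bsub>G\<^esub> U}.
      \<forall>U r. subgroup U G \<longrightarrow> card {i \<in> {1..n}. fst (h i) = (U, r)} = s U r}"

text \<open>An entry (c, i) moves to position \<pi>(i) and is shifted by the label at \<pi>(i);
  hence the value at j is read off at the preimage of j.\<close>

definition config_action ::
    "('a, 'b) monoid_scheme \<Rightarrow> nat \<Rightarrow> 'a wreath \<Rightarrow>
      (nat \<Rightarrow> ('a set \<times> nat) \<times> 'a set) \<Rightarrow> nat \<Rightarrow> ('a set \<times> nat) \<times> 'a set"
  where "config_action G n w h = (\<lambda>j\<in>{1..n}.
    (fst (h (inv' (snd w) j)), snd (h (inv' (snd w) j)) #>\<^bsub>G\<^esub> fst w j))"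

lemma wreathD:
  assumes "w \<in> carrier (wreath_product G n)"
  shows "snd w permutes {1..n}" "i \<in> {1..n} \<Longrightarrow> fst w i \<in> carrier G"
    "i \<in> {1..n} \<Longrightarrow> snd w i \<in> {1..n}" "i \<in> {1..n} \<Longrightarrow> inv' (snd w) i \<in> {1..n}"
proof -
  show p: "snd w permutes {1..n}" using assms by (simp only: wreath_product_simps)
  show "i \<in> {1..n} \<Longrightarrow> fst w i \<in> carrier G" using assms by (auto simp only: wreath_product_simps dest: PiE_mem)
  show "i \<in> {1..n} \<Longrightarrow> snd w i \<in> {1..n}" using permutes_in_image[OF p] by blast
  show "i \<in> {1..n} \<Longrightarrow> inv' (snd w) i \<in> {1..n}" using permutes_in_image[OF permutes_inv[OF p]] by blast
qed

lemma config_action_perm: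
  assumes "snd w permutes {1..n}" "i \<in> {1..n}"
  shows "config_action G n w h (snd w i) = (fst (h i), snd (h i) #>\<^bsub>G\<^esub> fst w (snd w i))"
  using assms permutes_in_image[OF assms(1)] by (simp add: config_action_def permutes_inverses)

text \<open>Lets equalities be tested at \<pi>(i), where the action has the explicit form of
  \<open>config_action_perm\<close>.\<close>

lemma extensional_eq_on_permuted:
  assumes "p permutes A" "f \<in> extensional A" "g \<in> extensional A" "\<And>i. i \<in> A \<Longrightarrow> f (p i) = g (p i)"
  shows "f = g"
proof (rule extensionalityI[OF assms(2,3)])
  fix x assume "x \<in> A"
  then show "f x = g x"
    using assms(4)[of "inv' p x"] permutes_in_image[OF permutes_inv[OF assms(1)]]
    by (simp add: permutes_inverses[OF assms(1)])
qed

lemma config_action_extensional: "config_action G n w h \<in> extensional {1..n}"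
  by (simp add: config_action_def)

lemma configsD:
  assumes "h \<in> configs G n s"
  shows "h \<in> extensional {1..n}"
    "i \<in> {1..n} \<Longrightarrow> subgroup (fst (fst (h i))) G"
    "i \<in> {1..n} \<Longrightarrow> snd (h i) \<in> rcosets\<^bsub>G\<^esub> (fst (fst (h i)))"
    "subgroup U G \<Longrightarrow> card {i \<in> {1..n}. fst (h i) = (U, r)} = s U r"
proof -
  show "h \<in> extensional {1..n}" "subgroup U G \<Longrightarrow> card {i \<in> {1..n}. fst (h i) = (U, r)} = s U r"
    using assms by (auto simp: configs_def PiE_def)
  show "i \<in> {1..n} \<Longrightarrow> subgroup (fst (fst (h i))) G"
    "i \<in> {1..n} \<Longrightarrow> snd (h i) \<in> rcosets\<^bsub>G\<^esub> (fst (fst (h i)))"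
    using assms by (auto simp: configs_def case_prod_beta dest: PiE_mem)
qed

lemma configsI:
  assumes "h \<in> extensional {1..n}"
    "\<And>i. i \<in> {1..n} \<Longrightarrow> subgroup (fst (fst (h i))) G"
    "\<And>i. i \<in> {1..n} \<Longrightarrow> snd (h i) \<in> rcosets\<^bsub>G\<^esub> (fst (fst (h i)))"
    "\<And>U r. subgroup U G \<Longrightarrow> card {i \<in> {1..n}. fst (h i) = (U, r)} = s U r"
  shows "h \<in> configs G n s"
  using assms by (simp add: configs_def PiE_iff case_prod_beta)

lemma configs_row_nonempty:
  assumes h: "h \<in> configs G n s" and i: "i \<in> {1..n}" and Ur: "fst (h i) = (U, r)"
  shows "s U r \<noteq> 0"
proof -
  have "i \<in> {i \<in> {1..n}. fst (h i) = (U, r)}" using i Ur by simp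
  then have "card {i \<in> {1..n}. fst (h i) = (U, r)} \<noteq> 0" by (subst card_0_eq) auto
  moreover have "subgroup U G" using configsD(2)[OF h i] Ur by simp
  ultimately show ?thesis using configsD(4)[OF h, of U r] by metis
qed

section \<open>The wreath product acting on configurations\<close>

context comm_group
begin

lemma rcoset_subset:
  assumes "subgroup U G" "c \<in> rcosets U"
  shows "c \<subseteq> carrier G"
  using assms by (auto simp: RCOSETS_def r_coset_def dest: subgroup.mem_carrier)

lemma rcoset_shift:
  assumes "subgroup U G" "c \<in> rcosets U" "g \<in> carrier G"
  shows "c #> g \<in> rcosets U"
  using assms subgroup.subset[OF assms(1)] by (auto simp: RCOSETS_def coset_mult_assoc)

lemma shift_inj:
  assumes "c \<subseteq> carrier G" "d \<subseteq> carrier G" "g \<in> carrier G"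
  shows "c #> g = d #> g \<longleftrightarrow> c = d"
proof
  assume "c #> g = d #> g"
  then have "c #> g #> inv g = d #> g #> inv g" by simp
  then show "c = d" using assms by (simp add: coset_mult_assoc)
qed simp

lemma config_action_closed:
  assumes w: "w \<in> carrier (wreath_product G n)" and h: "h \<in> configs G n s"
  shows "config_action G n w h \<in> configs G n s"
proof (rule configsI)
  note W = wreathD[OF w]
  show "config_action G n w h \<in> extensional {1..n}" by (rule config_action_extensional)
  show "subgroup (fst (fst (config_action G n w h i))) G"
    "snd (config_action G n w h i) \<in> rcosets (fst (fst (config_action G n w h i)))" if "i \<in> {1..n}" for i
    using configsD(2,3)[OF h W(4)[OF that]] that W(2)[OF that]
    by (simp_all add: config_action_def rcoset_shift)
  fix U r assume U: "subgroup U G"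
  have "{i \<in> {1..n}. fst (config_action G n w h i) = (U, r)} = snd w ` {i \<in> {1..n}. fst (h i) = (U, r)}"
  proof (intro Set.set_eqI iffI)
    fix j assume "j \<in> {i \<in> {1..n}. fst (config_action G n w h i) = (U, r)}"
    then show "j \<in> snd w ` {i \<in> {1..n}. fst (h i) = (U, r)}"
      using W(4)[of j] by (intro image_eqI[of _ _ "inv' (snd w) j"])
        (auto simp: config_action_def permutes_inverses[OF W(1)])
  next
    fix j assume "j \<in> snd w ` {i \<in> {1..n}. fst (h i) = (U, r)}"
    then obtain i where i: "i \<in> {1..n}" "fst (h i) = (U, r)" "j = snd w i" by blast
    then show "j \<in> {i \<in> {1..n}. fst (config_action G n w h i) = (U, r)}"
      using W(3)[OF i(1)] config_action_perm[OF W(1) i(1), of G h] by simp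
  qed
  then show "card {i \<in> {1..n}. fst (config_action G n w h i) = (U, r)} = s U r"
    using configsD(4)[OF h U] by (simp add: card_image inj_on_subset[OF permutes_inj[OF W(1)]])
qed

lemma config_action_one:
  assumes h: "h \<in> configs G n s"
  shows "config_action G n \<one>\<^bsub>wreath_product G n\<^esub> h = h"
proof (rule extensionalityI[OF config_action_extensional configsD(1)[OF h]])
  fix i assume "i \<in> {1..n}"
  then show "config_action G n \<one>\<^bsub>wreath_product G n\<^esub> h i = h i"
    using configsD(2,3)[OF h, of i] rcoset_subset
    by (simp add: config_action_def wreath_product_simps coset_mult_one)
qed

lemma config_action_mult:
  assumes v: "v \<in> carrier (wreath_product G n)" and w: "w \<in> carrier (wreath_product G n)"
    and h: "h \<in> configs G n s"
  shows "config_action G n (v \<otimes>\<^bsub>wreath_product G n\<^esub> w) h = config_action G n v (config_action G n w h)"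
proof (rule extensionalityI[OF config_action_extensional config_action_extensional])
  note V = wreathD[OF v] and W = wreathD[OF w]
  fix j assume j: "j \<in> {1..n}"
  define i where "i = inv' (snd v) j"
  define k where "k = inv' (snd w) i"
  have i: "i \<in> {1..n}" using V(4)[OF j] by (simp add: i_def)
  have k: "k \<in> {1..n}" using W(4)[OF i] by (simp add: k_def)
  have "inv' (snd v \<circ> snd w) j = k"
    using o_inv_distrib[OF permutes_bij[OF V(1)] permutes_bij[OF W(1)]] by (simp add: i_def k_def)
  \<comment> \<open>Right translation applies the label of w first, whereas the product lists the
    label of v first; commutativity reconciles them.\<close>
  moreover have "snd (h k) #> (fst v j \<otimes> fst w i) = snd (h k) #> fst w i #> fst v j"
    using rcoset_subset[OF configsD(2,3)[OF h k]] V(2)[OF j] W(2)[OF i]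
    by (simp add: coset_mult_assoc m_comm)
  ultimately show "config_action G n (v \<otimes>\<^bsub>wreath_product G n\<^esub> w) h j = config_action G n v (config_action G n w h) j"
    using i j by (simp add: config_action_def wreath_product_simps i_def[symmetric] k_def[symmetric])
qed

lemma bij_betw_config_action:
  assumes w: "w \<in> carrier (wreath_product G n)"
  shows "bij_betw (config_action G n w) (configs G n s) (configs G n s)"
proof -
  interpret W: group "wreath_product G n" by (rule group_wreath_product) (rule is_group)
  have wi: "inv\<^bsub>wreath_product G n\<^esub> w \<in> carrier (wreath_product G n)" using w by simp
  show ?thesis
    by (rule bij_betw_byWitness[where f' = "config_action G n (inv\<^bsub>wreath_product G n\<^esub> w)"])
      (use w wi in \<open>auto simp: config_action_mult[OF wi w, symmetric] config_action_mult[OF w wi, symmetric]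
          config_action_one config_action_closed\<close>)
qed

lemma finite_configs:
  assumes "finite (carrier G)" "finite {(U, r). subgroup U G \<and> s U r \<noteq> 0}"
  shows "finite (configs G n s)"
proof -
  have "configs G n s \<subseteq> {1..n} \<rightarrow>\<^sub>E ({(U, r). subgroup U G \<and> s U r \<noteq> 0} \<times> Pow (carrier G))"
  proof (intro subsetI PiE_I)
    fix h i assume h: "h \<in> configs G n s" and i: "i \<in> {1..n}"
    obtain U r c where hi: "h i = ((U, r), c)" by (metis prod.exhaust)
    have U: "subgroup U G" "c \<in> rcosets U" using configsD(2,3)[OF h i] hi by simp_all
    have "s U r \<noteq> 0" using configs_row_nonempty[OF h i] hi by simp
    then show "h i \<in> {(U, r). subgroup U G \<and> s U r \<noteq> 0} \<times> Pow (carrier G)"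
      using U hi rcoset_subset[OF U] by auto
  qed (meson configsD(1) extensional_arb)
  moreover have "finite \<dots>" using assms by (intro finite_PiE finite_cartesian_product) simp_all
  ultimately show ?thesis by (rule finite_subset)
qed

text \<open>Equal row lengths mean that the multisets of occupied rows coincide.\<close>

lemma config_fibres_perm:
  assumes a: "a \<in> configs G n s" and b: "b \<in> configs G n s"
  obtains \<pi> where "\<pi> permutes {1..n}" "\<And>i. i \<in> {1..n} \<Longrightarrow> fst (b (\<pi> i)) = fst (a i)"
proof -
  have "image_mset (\<lambda>i. fst (a i)) (mset_set {1..n}) = image_mset (\<lambda>i. fst (b i)) (mset_set {1..n})"
  proof (rule multiset_eqI)
    fix R :: "'a set \<times> nat"
    obtain U r where R: "R = (U, r)" by (cases R)
    show "count (image_mset (\<lambda>i. fst (a i)) (mset_set {1..n})) R =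
        count (image_mset (\<lambda>i. fst (b i)) (mset_set {1..n})) R"
    proof (cases "subgroup U G")
      case True
      then show ?thesis using configsD(4)[OF a] configsD(4)[OF b] by (simp add: count_image_mset_set R)
    next
      case False
      then have e: "{i \<in> {1..n}. fst (h i) = R} = {}" if "h \<in> configs G n s" for h
        using configsD(2)[OF that] R by force
      show ?thesis using e[OF a] e[OF b] by (simp only: count_image_mset_set finite_atLeastAtMost)
    qed
  qed
  from image_mset_eq_implies_permutes[OF finite_atLeastAtMost this]
  obtain p where "p permutes {1..n}" "\<forall>i\<in>{1..n}. fst (a i) = fst (b (p i))" by blast
  then show ?thesis using that[of p] by metis
qed

text \<open>Translations by G are transitive on the cosets of each subgroup, and the label at each
  position can be chosen independently. Since \<pi> is prescribed, this also yields stabilising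
  elements over a given permutation within rows.\<close>

lemma config_transporter:
  assumes a: "a \<in> configs G n s" and b: "b \<in> configs G n s"
    and \<pi>: "\<pi> permutes {1..n}" "\<And>i. i \<in> {1..n} \<Longrightarrow> fst (b (\<pi> i)) = fst (a i)"
  obtains g where "(g, \<pi>) \<in> carrier (wreath_product G n)" "config_action G n (g, \<pi>) a = b"
proof -
  have "\<exists>x\<in>carrier G. snd (a i) #> x = snd (b (\<pi> i))" if i: "i \<in> {1..n}" for i
  proof -
    have pi: "\<pi> i \<in> {1..n}" using permutes_in_image[OF \<pi>(1)] i by blast
    define U where "U = fst (fst (a i))"
    have U: "subgroup U G" using configsD(2)[OF a i] by (simp add: U_def)
    obtain x where x: "x \<in> carrier G" "snd (a i) = U #> x"
      using configsD(3)[OF a i] by (auto simp: RCOSETS_def U_def)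
    obtain y where y: "y \<in> carrier G" "snd (b (\<pi> i)) = U #> y"
      using configsD(3)[OF b pi] \<pi>(2)[OF i] by (auto simp: RCOSETS_def U_def)
    have "snd (a i) #> (inv x \<otimes> y) = snd (b (\<pi> i))"
      using x y subgroup.subset[OF U] by (simp add: coset_mult_assoc m_assoc[symmetric])
    then show ?thesis using x y by blast
  qed
  then obtain f where f: "\<And>i. i \<in> {1..n} \<Longrightarrow> f i \<in> carrier G"
    "\<And>i. i \<in> {1..n} \<Longrightarrow> snd (a i) #> f i = snd (b (\<pi> i))" by metis
  define g where "g = (\<lambda>j\<in>{1..n}. f (inv' \<pi> j))"
  have inv: "inv' \<pi> j \<in> {1..n}" if "j \<in> {1..n}" for j
    using permutes_in_image[OF permutes_inv[OF \<pi>(1)]] that by blast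
  show thesis
  proof
    show "(g, \<pi>) \<in> carrier (wreath_product G n)"
      using \<pi>(1) f(1) inv by (simp add: wreath_product_simps g_def)
    show "config_action G n (g, \<pi>) a = b"
    proof (rule extensional_eq_on_permuted[OF \<pi>(1) config_action_extensional configsD(1)[OF b]])
      fix i assume i: "i \<in> {1..n}"
      then show "config_action G n (g, \<pi>) a (\<pi> i) = b (\<pi> i)"
        using config_action_perm[of "(g, \<pi>)" n i G a] \<pi> f(2)[OF i] permutes_in_image[OF \<pi>(1), of i]
        by (simp add: g_def permutes_inverses[OF \<pi>(1)] prod_eq_iff)
    qed
  qed
qed

end

section \<open>Configurations and tabloids\<close>

definition config_of ::
    "('a, 'b) monoid_scheme \<Rightarrow> nat \<Rightarrow> ('a set \<Rightarrow> nat \<Rightarrow> nat) \<Rightarrow> 'a tableau \<Rightarrow>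
      nat \<Rightarrow> ('a set \<times> nat) \<times> 'a set"
  where "config_of G n s T = (\<lambda>i\<in>{1..n}.
    let b = inv_into (boxes G s) (snd \<circ> T) i in ((fst b, fst (snd b)), fst (T b)))"

text \<open>The n boxes carry distinct integers from a set of n elements, so none is missed.\<close>

lemma tableaux_bij:
  assumes "T \<in> tableaux G n s" "finite (boxes G s)" "card (boxes G s) = n"
  shows "bij_betw (snd \<circ> T) (boxes G s) {1..n}"
proof -
  have inj: "inj_on (snd \<circ> T) (boxes G s)" using assms(1) by (simp add: tableaux_def)
  have "(snd \<circ> T) ` boxes G s \<subseteq> {1..n}"
  proof (intro image_subsetI)
    fix b assume "b \<in> boxes G s"
    moreover obtain U r j where "b = (U, r, j)" by (metis prod.exhaust)
    ultimately show "(snd \<circ> T) b \<in> {1..n}" using tableauxD[OF assms(1), of U r j] by (metis comp_apply snd_conv)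
  qed
  moreover have "card ((snd \<circ> T) ` boxes G s) = card {1..n}"
    using card_image[OF inj] assms by simp
  ultimately have "(snd \<circ> T) ` boxes G s = {1..n}" by (intro card_subset_eq) auto
  then show ?thesis using inj by (simp add: bij_betw_def)
qed

lemma tableaux_box:
  assumes "T \<in> tableaux G n s" "finite (boxes G s)" "card (boxes G s) = n" "i \<in> {1..n}"
  obtains U r j where "(U, r, j) \<in> boxes G s" "snd (T (U, r, j)) = i"
proof -
  have "i \<in> (snd \<circ> T) ` boxes G s" using tableaux_bij[OF assms(1-3)] assms(4) by (simp add: bij_betw_def)
  then obtain x where "x \<in> boxes G s" "snd (T x) = i" by auto
  then show ?thesis using that by (metis prod.exhaust)
qed

lemma config_of_box:
  assumes "T \<in> tableaux G n s" "finite (boxes G s)" "card (boxes G s) = n" "(U, r, j) \<in> boxes G s"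
  shows "config_of G n s T (snd (T (U, r, j))) = ((U, r), fst (T (U, r, j)))"
proof -
  note b = tableaux_bij[OF assms(1-3)]
  have "snd (T (U, r, j)) \<in> {1..n}" using bij_betwE[OF b] assms(4) by fastforce
  moreover have "inv_into (boxes G s) (snd \<circ> T) (snd (T (U, r, j))) = (U, r, j)"
    using bij_betw_inv_into_left[OF b assms(4)] by simp
  ultimately show ?thesis by (simp add: config_of_def)
qed

text \<open>The configuration determines the entries of every row, which is one half of its
  equivalence with the tabloid.\<close>

lemma row_entries_config_of:
  assumes "T \<in> tableaux G n s" "finite (boxes G s)" "card (boxes G s) = n" "subgroup U G"
  shows "row_entries s T U r = (\<lambda>i. (snd (config_of G n s T i), i)) ` {i \<in> {1..n}. fst (config_of G n s T i) = (U, r)}"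
    (is "_ = ?f ` ?A")
proof (intro Set.set_eqI iffI)
  note b = tableaux_bij[OF assms(1-3)]
  fix e assume "e \<in> row_entries s T U r"
  then obtain j where j: "j < s U r" "e = T (U, r, j)" by (auto simp: row_entries_def)
  then have B: "(U, r, j) \<in> boxes G s" using assms(4) by (simp add: boxes_def)
  then have "snd e \<in> {1..n}" using bij_betwE[OF b] j by fastforce
  then show "e \<in> ?f ` ?A" using config_of_box[OF assms(1-3) B] j
    by (intro image_eqI[of _ _ "snd e"]) auto
next
  fix e assume "e \<in> ?f ` ?A"
  then obtain i where i: "i \<in> {1..n}" "fst (config_of G n s T i) = (U, r)" "e = ?f i" by blast
  obtain U' r' j where x: "(U', r', j) \<in> boxes G s" "snd (T (U', r', j)) = i"
    using tableaux_box[OF assms(1-3) i(1)] .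
  have "config_of G n s T i = ((U', r'), fst (T (U', r', j)))" using config_of_box[OF assms(1-3) x(1)] x(2) by simp
  then have "U' = U" "r' = r" "e = T (U', r', j)" using i x by (auto simp: prod_eq_iff)
  then show "e \<in> row_entries s T U r" using x(1) by (auto simp: row_entries_def boxes_def)
qed

lemma config_of_configs:
  assumes "T \<in> tableaux G n s" "finite (boxes G s)" "card (boxes G s) = n"
  shows "config_of G n s T \<in> configs G n s"
proof (rule configsI)
  note b = tableaux_bij[OF assms]
  show "config_of G n s T \<in> extensional {1..n}" by (simp add: config_of_def)
  have "subgroup (fst (fst (config_of G n s T i))) G \<and>
      snd (config_of G n s T i) \<in> rcosets\<^bsub>G\<^esub> (fst (fst (config_of G n s T i)))" if i: "i \<in> {1..n}" for i
  proof -
    obtain U r j where x: "(U, r, j) \<in> boxes G s" "snd (T (U, r, j)) = i"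
      using tableaux_box[OF assms i] .
    have "config_of G n s T i = ((U, r), fst (T (U, r, j)))" using config_of_box[OF assms x(1)] x(2) by simp
    moreover have "subgroup U G" using x by (simp add: boxes_def)
    moreover have "fst (T (U, r, j)) \<in> rcosets\<^bsub>G\<^esub> U"
      using tableauxD[OF assms(1) x(1)] by (metis fst_conv)
    ultimately show ?thesis by simp
  qed
  then show "subgroup (fst (fst (config_of G n s T i))) G"
    "snd (config_of G n s T i) \<in> rcosets\<^bsub>G\<^esub> (fst (fst (config_of G n s T i)))" if "i \<in> {1..n}" for i
    using that by auto
  fix U r assume U: "subgroup U G"
  have "inj_on (\<lambda>i. (snd (config_of G n s T i), i)) A" for A by (rule inj_onI) simp
  then have "card {i \<in> {1..n}. fst (config_of G n s T i) = (U, r)} = card (row_entries s T U r)"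
    unfolding row_entries_config_of[OF assms U] by (simp add: card_image)
  also have "inj_on (\<lambda>j. T (U, r, j)) {..<s U r}"
  proof (rule inj_onI)
    fix j j' assume "j \<in> {..<s U r}" "j' \<in> {..<s U r}" "T (U, r, j) = T (U, r, j')"
    then show "j = j'"
      using bij_betw_imp_inj_on[OF b] U inj_onD[of "snd \<circ> T" "boxes G s" "(U, r, j)" "(U, r, j')"]
      by (auto simp: boxes_def)
  qed
  then have "card (row_entries s T U r) = s U r"
    by (simp add: row_entries_def card_image)
  finally show "card {i \<in> {1..n}. fst (config_of G n s T i) = (U, r)} = s U r" .
qed

lemma row_equiv_iff_config_of:
  assumes T: "T \<in> tableaux G n s" "T' \<in> tableaux G n s" and "finite (boxes G s)" "card (boxes G s) = n"
  shows "(T, T') \<in> row_equiv G n s \<longleftrightarrow> config_of G n s T = config_of G n s T'"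
proof
  assume "config_of G n s T = config_of G n s T'"
  then show "(T, T') \<in> row_equiv G n s"
    using assms by (simp add: row_equiv_def row_entries_config_of)
next
  assume e: "(T, T') \<in> row_equiv G n s"
  show "config_of G n s T = config_of G n s T'"
  proof (rule extensionalityI[of _ "{1..n}"])
    fix i assume i: "i \<in> {1..n}"
    obtain U r c where c: "config_of G n s T i = ((U, r), c)" by (metis prod.exhaust)
    have U: "subgroup U G" using configsD(2)[OF config_of_configs[OF T(1) assms(3,4)] i] c by simp
    have "(c, i) \<in> row_entries s T U r"
      unfolding row_entries_config_of[OF T(1) assms(3,4) U] using i c by force
    then have "(c, i) \<in> row_entries s T' U r" using e U by (simp add: row_equiv_def)
    then show "config_of G n s T i = config_of G n s T' i"
      unfolding row_entries_config_of[OF T(2) assms(3,4) U] using c by (auto simp: prod_eq_iff)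
  qed (simp_all add: config_of_def)
qed

text \<open>A row receives as many integers from h as it has boxes, so any enumeration of them fills
  it.\<close>

lemma config_of_surj:
  assumes h: "h \<in> configs G n s"
    and "finite (boxes G s)" "card (boxes G s) = n"
  obtains T where "T \<in> tableaux G n s" "config_of G n s T = h"
proof -
  have "\<exists>f. bij_betw f {..<s U r} {i \<in> {1..n}. fst (h i) = (U, r)}" if "subgroup U G" for U r
    using ex_bij_betw_nat_finite[of "{i \<in> {1..n}. fst (h i) = (U, r)}"] configsD(4)[OF h that]
    by (simp add: lessThan_atLeast0)
  then obtain f where f: "\<And>U r. subgroup U G \<Longrightarrow> bij_betw (f U r) {..<s U r} {i \<in> {1..n}. fst (h i) = (U, r)}"
    by metis
  define T where "T = (\<lambda>(U, r, j)\<in>boxes G s. (snd (h (f U r j)), f U r j))"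
  have T: "T (U, r, j) = (snd (h (f U r j)), f U r j)" "f U r j \<in> {1..n}" "fst (h (f U r j)) = (U, r)"
    if "(U, r, j) \<in> boxes G s" for U r j
    using that bij_betwE[OF f[of U r]] by (auto simp: T_def boxes_def)
  have tab: "T \<in> tableaux G n s"
    unfolding tableaux_def
  proof (intro CollectI conjI PiE_I inj_onI)
    fix b assume b: "b \<in> boxes G s"
    obtain U r j where b': "b = (U, r, j)" by (metis prod.exhaust)
    show "T b \<in> (case b of (U, r, j) \<Rightarrow> (rcosets\<^bsub>G\<^esub> U) \<times> {1..n})"
      using T[OF b[unfolded b']] configsD(3)[OF h, of "f U r j"] by (simp add: b')
  next
    fix b assume "b \<notin> boxes G s"
    then show "T b = undefined" by (simp add: T_def)
  next
    fix b b' assume b: "b \<in> boxes G s" "b' \<in> boxes G s" and e: "(snd \<circ> T) b = (snd \<circ> T) b'"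
    obtain U r j U' r' j' where b': "b = (U, r, j)" "b' = (U', r', j')" by (metis prod.exhaust)
    have ff: "f U r j = f U' r' j'" using e T(1)[OF b(1)[unfolded b']] T(1)[OF b(2)[unfolded b']] b' by simp
    then have "(U, r) = (U', r')" using T(3)[OF b(1)[unfolded b']] T(3)[OF b(2)[unfolded b']] by metis
    moreover from this have "j = j'"
      using ff b bij_betw_imp_inj_on[OF f[of U r]] by (auto simp: b' boxes_def inj_on_def)
    ultimately show "b = b'" by (simp add: b')
  qed
  have "config_of G n s T = h"
  proof (rule extensionalityI[of _ "{1..n}"])
    fix i assume i: "i \<in> {1..n}"
    obtain U r where Ur: "fst (h i) = (U, r)" by (metis prod.exhaust)
    have U: "subgroup U G" using configsD(2)[OF h i] Ur by simp
    have "i \<in> f U r ` {..<s U r}" using f[OF U, of r] i Ur by (simp add: bij_betw_def)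
    then obtain j where j: "j < s U r" "i = f U r j" by auto
    then have B: "(U, r, j) \<in> boxes G s" using U by (simp add: boxes_def)
    show "config_of G n s T i = h i"
      using config_of_box[OF tab assms(2,3) B] T(1)[OF B] j Ur by (simp add: prod_eq_iff)
  qed (use configsD(1)[OF h] in \<open>simp_all add: config_of_def\<close>)
  then show ?thesis using tab that by blast
qed

lemma config_of_action:
  assumes "comm_group G" and w: "w \<in> carrier (wreath_product G n)" and T: "T \<in> tableaux G n s"
    and B: "finite (boxes G s)" "card (boxes G s) = n"
  shows "config_of G n s (tableau_action G s w T) = config_action G n w (config_of G n s T)"
proof (rule extensional_eq_on_permuted[OF wreathD(1)[OF w]])
  show "config_of G n s (tableau_action G s w T) \<in> extensional {1..n}" by (simp add: config_of_def)
  show "config_action G n w (config_of G n s T) \<in> extensional {1..n}" by (rule config_action_extensional)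
  fix i assume i: "i \<in> {1..n}"
  obtain U r j where x: "(U, r, j) \<in> boxes G s" "snd (T (U, r, j)) = i" using tableaux_box[OF T B i] .
  have a: "tableau_action G s w T (U, r, j) = (fst (T (U, r, j)) #>\<^bsub>G\<^esub> fst w (snd w i), snd w i)"
    using x by (simp add: tableau_action_def entry_action_def case_prod_beta)
  show "config_of G n s (tableau_action G s w T) (snd w i) = config_action G n w (config_of G n s T) (snd w i)"
    using config_of_box[OF tableau_action_closed[OF assms(1) w T] B x(1)]
      config_of_box[OF T B x(1)] a config_action_perm[OF wreathD(1)[OF w] i, of G "config_of G n s T"]
      x(2) by simp
qed

lemma tabloid_transitive_iff_configs:
  assumes G: "comm_group G" and B: "finite (boxes G s)" "card (boxes G s) = n"
    and Y: "Y \<subseteq> carrier (wreath_product G n)"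
  shows "tabloid_transitive G n s Y \<longleftrightarrow> transitive_subset (config_action G n) (configs G n s) Y"
proof -
  interpret comm_group G by fact
  define \<Psi> where "\<Psi> h = {T \<in> tableaux G n s. config_of G n s T = h}" for h
  have cl: "\<Psi> (config_of G n s T) = row_equiv G n s `` {T}" if "T \<in> tableaux G n s" for T
  proof (rule Set.set_eqI)
    fix T' show "T' \<in> \<Psi> (config_of G n s T) \<longleftrightarrow> T' \<in> row_equiv G n s `` {T}"
    proof (cases "T' \<in> tableaux G n s")
      case True
      then show ?thesis using row_equiv_iff_config_of[OF that True B] by (simp add: \<Psi>_def eq_commute)
    qed (simp add: \<Psi>_def row_equiv_def)
  qed
  have bij: "bij_betw \<Psi> (configs G n s) (tabloids G n s)"
    unfolding bij_betw_def
  proof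
    show "inj_on \<Psi> (configs G n s)"
    proof (rule inj_onI)
      fix h h' assume h: "h \<in> configs G n s" and e: "\<Psi> h = \<Psi> h'"
      obtain T where "T \<in> tableaux G n s" "config_of G n s T = h" using config_of_surj[OF h B] by metis
      then have "T \<in> \<Psi> h" by (simp add: \<Psi>_def)
      then show "h = h'" unfolding e by (auto simp: \<Psi>_def e[symmetric]) (simp_all add: \<open>config_of G n s T = h\<close>)
    qed
    show "\<Psi> ` configs G n s = tabloids G n s"
    proof
      show "\<Psi> ` configs G n s \<subseteq> tabloids G n s"
        using config_of_surj[OF _ B] cl by (metis (no_types, lifting) image_subsetI quotientI tabloids_def)
      show "tabloids G n s \<subseteq> \<Psi> ` configs G n s"
        unfolding tabloids_def using cl config_of_configs[OF _ B] by (auto simp: quotient_def)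
    qed
  qed
  show ?thesis
    unfolding tabloid_transitive_def
  proof (rule transitive_subset_bij[OF bij])
    fix y h assume y: "y \<in> Y" and h: "h \<in> configs G n s"
    have w: "y \<in> carrier (wreath_product G n)" using y Y by blast
    show "config_action G n y h \<in> configs G n s" by (rule config_action_closed[OF w h])
    obtain T where T: "T \<in> tableaux G n s" "config_of G n s T = h" using config_of_surj[OF h B] by metis
    then show "tabloid_action G s y (\<Psi> h) = \<Psi> (config_action G n y h)"
      using cl tabloid_action_class[OF G w T(1)] config_of_action[OF G w T(1) B]
        tableau_action_closed[OF G w T(1)] by metis
  qed
qed

section \<open>Moving boxes\<close>

lemma finite_wreath_product:
  assumes "finite (carrier G)"
  shows "finite (carrier (wreath_product G n))"
proof -
  have "finite ({1..n} \<rightarrow>\<^sub>E carrier G)" using assms by (intro finite_PiE) simp_all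
  moreover have "finite (carrier (sym_group n))" by (simp add: sym_group_def finite_permutations)
  ultimately show ?thesis by (simp add: wreath_product_def)
qed

context comm_group
begin

text \<open>V <#> c is the coset of V containing the coset c of U: the coarser label that an entry
  gets when its box moves from a row of U to a row of V.\<close>

lemma saturate_rcoset:
  assumes "subgroup U G" "subgroup V G" "U \<subseteq> V" "x \<in> carrier G"
  shows "V <#> (U #> x) = V #> x"
proof -
  have "V <#> U = V"
  proof
    show "V <#> U \<subseteq> V"
      using assms subgroup.m_closed[OF assms(2)] by (auto simp: set_mult_def)
    show "V \<subseteq> V <#> U"
    proof
      fix v assume v: "v \<in> V"
      then have "v \<otimes> \<one> \<in> V <#> U" using subgroup.one_closed[OF assms(1)] by (auto simp: set_mult_def)
      then show "v \<in> V <#> U" using v subgroup.mem_carrier[OF assms(2)] by simp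
    qed
  qed
  then show ?thesis
    using setmult_rcos_assoc[OF subgroup.subset[OF assms(2)] subgroup.subset[OF assms(1)] assms(4)] by simp
qed

lemma saturate_closed:
  assumes "subgroup U G" "subgroup V G" "U \<subseteq> V" "c \<in> rcosets U"
  shows "V <#> c \<in> rcosets V"
proof -
  obtain x where "x \<in> carrier G" "c = U #> x" using assms(4) by (auto simp: RCOSETS_def)
  then show ?thesis using saturate_rcoset[OF assms(1-3)] rcosetsI[OF subgroup.subset[OF assms(2)]] by simp
qed

lemma saturate_surj:
  assumes "subgroup U G" "subgroup V G" "U \<subseteq> V" "d \<in> rcosets V"
  shows "\<exists>c. c \<in> rcosets U \<and> V <#> c = d"
proof -
  obtain x where "x \<in> carrier G" "d = V #> x" using assms(4) by (auto simp: RCOSETS_def)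
  then show ?thesis using saturate_rcoset[OF assms(1-3)] rcosetsI[OF subgroup.subset[OF assms(1)]] by blast
qed

text \<open>
  The incidence relation \<open>inc d b\<close> says that \<open>d\<close> arises from \<open>b\<close> by moving boxes from row \<open>R\<close> to
  row \<open>S\<close>. Once the cosets of the entries in row \<open>S\<close> of a configuration are lifted, only the
  choice of the integers in row \<open>R\<close> matters, and \<open>inc\<close> becomes the inclusion of sets.
\<close>
lemma transitive_move_boxes:
  assumes fin: "finite (carrier G)" "finite {(V, q). subgroup V G \<and> s V q \<noteq> 0}"
    and U: "subgroup U G" "subgroup U' G" "U \<subseteq> U'" and RS: "(U, r) \<noteq> (U', r')"
    and size: "s' U r \<le> s U r" "s U r \<le> s' U' r'" "s U r + s U' r' = s' U r + s' U' r'"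
    and other: "\<And>V q. (V, q) \<noteq> (U, r) \<Longrightarrow> (V, q) \<noteq> (U', r') \<Longrightarrow> s' V q = s V q"
    and Y: "Y \<subseteq> carrier (wreath_product G n)"
    and tr: "transitive_subset (config_action G n) (configs G n s) Y"
  shows "transitive_subset (config_action G n) (configs G n s') Y"
proof -
  define R where "R = (U, r)"
  define S where "S = (U', r')"
  have RS': "R \<noteq> S" using RS by (simp add: R_def S_def)
  define \<theta> where "\<theta> c = U' <#> c" for c
  define p where "p = s' U r"
  define m where "m = s U r"
  define I where "I a = {i \<in> {1..n}. fst (a i) = R \<or> fst (a i) = S}" for a :: "nat \<Rightarrow> ('a set \<times> nat) \<times> 'a set"
  define A where "A a = {i \<in> {1..n}. fst (a i) = R}" for a :: "nat \<Rightarrow> ('a set \<times> nat) \<times> 'a set"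
  \<comment> \<open>Entries already in row S know only a coset of U'. An arbitrary coset of U inside
    it is chosen; a left inverse just has to exist, so the choice is harmless.\<close>
  define lift where "lift a i = (if fst (a i) = R then snd (a i) else SOME c. c \<in> rcosets U \<and> \<theta> c = snd (a i))"
    for a :: "nat \<Rightarrow> ('a set \<times> nat) \<times> 'a set" and i
  \<comment> \<open>These configurations agree with the lift of a up to which integers of the two
    rows are placed in row R; on them a configuration is the same as a set of integers.\<close>
  define comp where "comp a d \<longleftrightarrow> (\<forall>i\<in>{1..n}. if i \<in> I a then d i = (R, lift a i) \<or> d i = (S, \<theta> (lift a i)) else d i = a i)"
    for a d
  define inc where "inc d b \<longleftrightarrow> (\<forall>i\<in>{1..n}. d i = b i \<or> (fst (b i) = R \<and> d i = (S, \<theta> (snd (b i)))))"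
    for d b :: "nat \<Rightarrow> ('a set \<times> nat) \<times> 'a set"
  define conf where "conf a B = (\<lambda>i\<in>{1..n}. if i \<in> I a then (if i \<in> B then (R, lift a i) else (S, \<theta> (lift a i))) else a i)"
    for a B
  \<comment> \<open>The assumption that the old row R is at most the new row S says equivalently
    that the new row R is at most the old row S.\<close>
  have mp: "p \<le> m" "m + p \<le> m + s U' r'" using size by (simp_all add: p_def m_def)
  obtain \<eta> :: "nat \<Rightarrow> real" where \<eta>:
    "\<And>J A A' :: nat set. finite J \<Longrightarrow> card J = m + s U' r' \<Longrightarrow> A \<subseteq> J \<Longrightarrow> A' \<subseteq> J \<Longrightarrow> card A = p \<Longrightarrow> card A' = p \<Longrightarrow>
      (\<Sum>B | B \<subseteq> J \<and> card B = m \<and> A' \<subseteq> B. \<eta> (card (A - B))) = (if A' = A then 1 else 0)"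
    using inclusion_left_inverse[OF mp, where 'i = nat] by blast
  define x where "x a b = (if comp a b then \<eta> (card (A a - A b)) else 0)" for a b
  have \<theta>: "\<theta> c \<in> rcosets U'" if "c \<in> rcosets U" for c
    using saturate_closed[OF U that] by (simp add: \<theta>_def)
  have AI: "A a \<subseteq> I a" "I a \<subseteq> {1..n}" "finite (I a)" for a by (auto simp: A_def I_def)
  have cA: "card (A b) = m" if "b \<in> configs G n s" for b
    using configsD(4)[OF that U(1), of r] by (simp only: A_def R_def m_def)
  have cA': "card (A b) = p" if "b \<in> configs G n s'" for b
    using configsD(4)[OF that U(1), of r] by (simp only: A_def R_def p_def)
  have cI: "card (I a) = m + s U' r'" if "a \<in> configs G n s'" for a
  proof -
    have "card {i \<in> {1..n}. fst (a i) = S} = s' U' r'"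
      using configsD(4)[OF that U(2), of r'] by (simp only: S_def)
    moreover have "I a = A a \<union> {i \<in> {1..n}. fst (a i) = S}" "A a \<inter> {i \<in> {1..n}. fst (a i) = S} = {}"
      using RS' by (auto simp: I_def A_def)
    ultimately show ?thesis using cA'[OF that] size card_Un_disjoint[of "A a" "{i \<in> {1..n}. fst (a i) = S}"]
      by (simp add: A_def m_def p_def)
  qed
  have lift: "lift a i \<in> rcosets U" "fst (a i) = R \<Longrightarrow> lift a i = snd (a i)" "fst (a i) = S \<Longrightarrow> \<theta> (lift a i) = snd (a i)"
    if a: "a \<in> configs G n s'" and i: "i \<in> I a" for a i
  proof -
    have i': "i \<in> {1..n}" "fst (a i) = R \<or> fst (a i) = S" using i by (auto simp: I_def)
    have "lift a i \<in> rcosets U \<and> \<theta> (lift a i) = snd (a i)" if "fst (a i) = S"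
    proof -
      have "snd (a i) \<in> rcosets U'" using configsD(3)[OF a i'(1)] that by (simp add: S_def)
      from someI_ex[OF saturate_surj[OF U this]] show ?thesis
        using that RS' by (simp add: lift_def \<theta>_def)
    qed
    moreover have "lift a i \<in> rcosets U \<and> lift a i = snd (a i)" if "fst (a i) = R"
      using configsD(3)[OF a i'(1)] that by (simp add: lift_def R_def)
    ultimately show "lift a i \<in> rcosets U" "fst (a i) = R \<Longrightarrow> lift a i = snd (a i)" "fst (a i) = S \<Longrightarrow> \<theta> (lift a i) = snd (a i)"
      using i'(2) by auto
  qed
  have compI: "A d \<subseteq> I a" if "comp a d" for a d
  proof
    fix i assume i: "i \<in> A d"
    show "i \<in> I a"
    proof (rule ccontr)
      assume "i \<notin> I a"
      moreover from this that i have "d i = a i" by (auto simp: comp_def A_def)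
      ultimately show False using i by (auto simp: A_def I_def)
    qed
  qed
  have comp_conf: "conf a (A d) = d" if "comp a d" "d \<in> extensional {1..n}" for a d
  proof (rule extensionalityI[OF _ that(2)])
    show "conf a (A d) \<in> extensional {1..n}" by (simp add: conf_def)
    fix i assume i: "i \<in> {1..n}"
    then have "if i \<in> I a then d i = (R, lift a i) \<or> d i = (S, \<theta> (lift a i)) else d i = a i"
      using that(1) unfolding comp_def by blast
    moreover have "i \<in> A d \<longleftrightarrow> fst (d i) = R" using i by (simp add: A_def)
    ultimately show "conf a (A d) i = d i" using i RS' unfolding conf_def by (auto split: if_splits)
  qed
  have comp_refl: "comp a a" if "a \<in> configs G n s'" for a
    unfolding comp_def
  proof
    fix i assume i: "i \<in> {1..n}"
    show "if i \<in> I a then a i = (R, lift a i) \<or> a i = (S, \<theta> (lift a i)) else a i = a i"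
      using lift(2,3)[OF that, of i] by (auto simp: prod_eq_iff) (auto simp: I_def)
  qed
  have A_conf: "A (conf a B) = B" if "B \<subseteq> I a" for a B
  proof -
    have "i \<in> A (conf a B) \<longleftrightarrow> i \<in> B" for i
    proof (cases "i \<in> I a")
      case True
      then have "i \<in> {1..n}" using AI(2) by blast
      then show ?thesis using True RS' unfolding A_def conf_def by simp
    next
      case False
      then have "i \<notin> A (conf a B)" unfolding A_def I_def conf_def by simp
      then show ?thesis using False that by blast
    qed
    then show ?thesis by blast
  qed
  have conf: "conf a B \<in> configs G n s" if a: "a \<in> configs G n s'" and B: "B \<subseteq> I a" "card B = m" for a B
  proof (rule configsI)
    show "conf a B \<in> extensional {1..n}" by (simp add: conf_def)
    show "subgroup (fst (fst (conf a B i))) G" "snd (conf a B i) \<in> rcosets (fst (fst (conf a B i)))" if i: "i \<in> {1..n}" for i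
      using configsD(2,3)[OF a i] lift(1)[OF a, of i] \<theta>[OF lift(1)[OF a, of i]] i U
      by (simp_all add: conf_def R_def S_def)
    fix V q assume V: "subgroup V G"
    consider "(V, q) = R" | "(V, q) = S" | "(V, q) \<noteq> R" "(V, q) \<noteq> S" by blast
    then show "card {i \<in> {1..n}. fst (conf a B i) = (V, q)} = s V q"
    proof cases
      case 1
      then have "{i \<in> {1..n}. fst (conf a B i) = (V, q)} = B" using A_conf[OF B(1)] by (simp add: A_def)
      then show ?thesis using B(2) 1 by (simp add: m_def R_def)
    next
      case 2
      have "{i \<in> {1..n}. fst (conf a B i) = S} = I a - B"
      proof (intro Set.set_eqI iffI)
        fix i assume i: "i \<in> {i \<in> {1..n}. fst (conf a B i) = S}"
        show "i \<in> I a - B"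
        proof (cases "i \<in> I a")
          case True then show ?thesis using i RS' by (simp add: conf_def split: if_splits)
        next
          case False
          then have "fst (conf a B i) = fst (a i)" "fst (a i) \<noteq> S" using i by (auto simp: conf_def I_def)
          then show ?thesis using i by simp
        qed
      next
        fix i assume i: "i \<in> I a - B"
        then have "i \<in> {1..n}" using AI(2) by blast
        then show "i \<in> {i \<in> {1..n}. fst (conf a B i) = S}" using i by (simp add: conf_def)
      qed
      moreover have "card (I a - B) = s U' r'"
        using B AI(3) cI[OF a] by (simp add: card_Diff_subset finite_subset)
      ultimately show ?thesis using 2 by (simp add: S_def)
    next
      case 3
      have "fst (conf a B i) = (V, q) \<longleftrightarrow> fst (a i) = (V, q)" if "i \<in> {1..n}" for i
        using that 3 by (auto simp: conf_def I_def)
      then have "{i \<in> {1..n}. fst (conf a B i) = (V, q)} = {i \<in> {1..n}. fst (a i) = (V, q)}" by blast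
      then show ?thesis using configsD(4)[OF a V, of q] other[of V q] 3 by (simp add: R_def S_def)
    qed
  qed
  have comp_conf': "comp a (conf a B)" for a B by (simp add: comp_def conf_def)
  have inc_conf: "inc d (conf a B) \<longleftrightarrow> comp a d \<and> A d \<subseteq> B" if B: "B \<subseteq> I a" for a d B
  proof
    assume inc: "inc d (conf a B)"
    have *: "(if i \<in> I a then d i = (R, lift a i) \<or> d i = (S, \<theta> (lift a i)) else d i = a i) \<and> (i \<in> A d \<longrightarrow> i \<in> B)"
      if i: "i \<in> {1..n}" for i
    proof -
      have di: "d i = conf a B i \<or> (fst (conf a B i) = R \<and> d i = (S, \<theta> (snd (conf a B i))))"
        using inc i by (simp add: inc_def)
      show ?thesis
      proof (cases "i \<in> I a")
        case True
        then show ?thesis using di i RS' by (auto simp: conf_def A_def split: if_splits)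
      next
        case False
        then have "fst (a i) \<noteq> R" "fst (a i) \<noteq> S" using i by (auto simp: I_def)
        then show ?thesis using di i False by (auto simp: conf_def A_def)
      qed
    qed
    then show "comp a d \<and> A d \<subseteq> B" unfolding comp_def by (auto simp: A_def)
  next
    assume c: "comp a d \<and> A d \<subseteq> B"
    show "inc d (conf a B)"
      unfolding inc_def
    proof
      fix i assume i: "i \<in> {1..n}"
      then have "i \<in> A d \<longleftrightarrow> fst (d i) = R" by (simp add: A_def)
      moreover have "if i \<in> I a then d i = (R, lift a i) \<or> d i = (S, \<theta> (lift a i)) else d i = a i"
        using c i unfolding comp_def by blast
      ultimately show "d i = conf a B i \<or> (fst (conf a B i) = R \<and> d i = (S, \<theta> (snd (conf a B i))))"
        using c i unfolding conf_def by (auto split: if_splits)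
    qed
  qed
  show ?thesis
  proof (rule transitive_subset_left_inverse[where x = x and inc = inc, OF tr])
    note bij = bij_betw_config_action[OF subsetD[OF Y]]
    show "finite Y" using Y finite_subset[OF _ finite_wreath_product[OF fin(1)]] by blast
    show "finite (configs G n s)" by (rule finite_configs[OF fin])
    have "{(V, q). subgroup V G \<and> s' V q \<noteq> 0} \<subseteq> insert (U, r) (insert (U', r') {(V, q). subgroup V G \<and> s V q \<noteq> 0})"
    proof (intro subsetI, elim CollectE case_prodE conjE)
      fix e V q assume "e = (V, q)" "subgroup V G" "s' V q \<noteq> 0"
      then show "e \<in> insert (U, r) (insert (U', r') {(V, q). subgroup V G \<and> s V q \<noteq> 0})"
        using other[of V q] by (cases "e = (U, r)"; cases "e = (U', r')") simp_all
    qed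
    then have "finite {(V, q). subgroup V G \<and> s' V q \<noteq> 0}" by (rule finite_subset) (intro finite.insertI fin(2))
    then show "finite (configs G n s')" by (rule finite_configs[OF fin(1)])
    show "bij_betw (config_action G n y) (configs G n s) (configs G n s)"
      "bij_betw (config_action G n y) (configs G n s') (configs G n s')" if "y \<in> Y" for y
      using bij[OF that] by auto
    show "inc (config_action G n y d) (config_action G n y b) \<longleftrightarrow> inc d b"
      if y: "y \<in> Y" and d: "d \<in> configs G n s'" and b: "b \<in> configs G n s" for y d b
    proof -
      note W = wreathD[OF subsetD[OF Y y]]
      let ?P = "\<lambda>d b i. d i = b i \<or> (fst (b i) = R \<and> d i = (S, \<theta> (snd (b i))))"
      have "?P (config_action G n y d) (config_action G n y b) (snd y i) \<longleftrightarrow> ?P d b i" if i: "i \<in> {1..n}" for i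
      proof -
        define g where "g = fst y (snd y i)"
        have g: "g \<in> carrier G" using W(2,3) i by (simp add: g_def)
        have sub: "snd (d i) \<subseteq> carrier G" "snd (b i) \<subseteq> carrier G"
          using rcoset_subset configsD(2,3)[OF d i] configsD(2,3)[OF b i] by blast+
        have sub': "\<theta> (snd (b i)) \<subseteq> carrier G"
          using set_mult_closed[OF subgroup.subset[OF U(2)] sub(2)] by (simp add: \<theta>_def)
        \<comment> \<open>Coarsening commutes with translation, and translation is injective; this
          makes incidence invariant under the action.\<close>
        have "\<theta> (snd (b i) #> g) = \<theta> (snd (b i)) #> g"
          using setmult_rcos_assoc[OF subgroup.subset[OF U(2)] sub(2) g] by (simp add: \<theta>_def)
        then show ?thesis
          using shift_inj[OF sub g] shift_inj[OF sub(1) sub' g]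
          by (simp add: config_action_perm[OF W(1) i] g_def[symmetric] prod_eq_iff)
      qed
      then have shift: "(\<forall>i\<in>{1..n}. ?P (config_action G n y d) (config_action G n y b) (snd y i)) \<longleftrightarrow> inc d b"
        by (simp add: inc_def)
      have perm: "(\<forall>i\<in>{1..n}. Q (snd y i)) \<longleftrightarrow> (\<forall>i\<in>{1..n}. Q i)" for Q
        by (metis W(3,4) permutes_inverses(1)[OF W(1)])
      have "inc (config_action G n y d) (config_action G n y b) \<longleftrightarrow>
          (\<forall>i\<in>{1..n}. ?P (config_action G n y d) (config_action G n y b) i)"
        by (simp only: inc_def)
      also have "\<dots> \<longleftrightarrow> (\<forall>i\<in>{1..n}. ?P (config_action G n y d) (config_action G n y b) (snd y i))"
        by (rule perm[symmetric])
      finally show ?thesis using shift by simp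
    qed
    show "(\<Sum>b | b \<in> configs G n s \<and> inc d b. x a b) = (if d = a then 1 else 0)"
      if a: "a \<in> configs G n s'" and d: "d \<in> configs G n s'" for a d
    proof -
      \<comment> \<open>Only b compatible with a contribute. For such b, incidence with d means that
        d is compatible with a and that \<open>A d\<close> is contained in \<open>A b\<close>. So
        the sum is an inclusion sum, or is empty when d is incompatible with a, in particular
        different from a.\<close>
      have "(\<Sum>b | b \<in> configs G n s \<and> inc d b. x a b) =
          (\<Sum>b | b \<in> configs G n s \<and> comp a b \<and> inc d b. \<eta> (card (A a - A b)))"
        using finite_configs[OF fin, of n] by (intro sum.mono_neutral_cong_right) (auto simp: x_def)
      also have "\<dots> = (\<Sum>B | B \<subseteq> I a \<and> card B = m \<and> comp a d \<and> A d \<subseteq> B. \<eta> (card (A a - B)))"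
      proof (rule sum.reindex_bij_witness[where i = "conf a" and j = A])
        fix b assume b: "b \<in> {b. b \<in> configs G n s \<and> comp a b \<and> inc d b}"
        then show c: "conf a (A b) = b" using comp_conf configsD(1) by blast
        show "A b \<in> {B. B \<subseteq> I a \<and> card B = m \<and> comp a d \<and> A d \<subseteq> B}"
          using b cA[of b] compI[of a b] inc_conf[OF compI[of a b], of d] c by simp
      next
        fix B assume B: "B \<in> {B. B \<subseteq> I a \<and> card B = m \<and> comp a d \<and> A d \<subseteq> B}"
        then show "A (conf a B) = B" using A_conf by blast
        show "conf a B \<in> {b. b \<in> configs G n s \<and> comp a b \<and> inc d b}"
          using B conf[OF a] comp_conf' inc_conf by simp
      qed simp
      also have "\<dots> = (if d = a then 1 else 0)"
      proof (cases "comp a d")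
        case True
        have "A d = A a \<longleftrightarrow> d = a"
          using comp_conf[OF True configsD(1)[OF d]] comp_conf[OF comp_refl[OF a] configsD(1)[OF a]] by metis
        then show ?thesis
          using \<eta>[OF AI(3) cI[OF a] AI(1) compI[OF True] cA'[OF a] cA'[OF d]] True by simp
      next
        case False
        then show ?thesis using comp_refl[OF a] by auto
      qed
      finally show ?thesis .
    qed
  qed
qed

text \<open>Renaming the rows commutes with the action, which never changes the row of an entry.
  This undoes the loss of order caused by the moves.\<close>

lemma transitive_relabel:
  assumes q: "\<And>U. bij (q U)" and Y: "Y \<subseteq> carrier (wreath_product G n)"
    and tr: "transitive_subset (config_action G n) (configs G n s) Y"
  shows "transitive_subset (config_action G n) (configs G n (\<lambda>U r. s U (q U r))) Y"
proof -
  \<comment> \<open>The new row r is the old row \<open>q U r\<close>, so an entry changes its row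
    index by the inverse of \<open>q U\<close>.\<close>
  define \<Phi> where "\<Phi> h = (\<lambda>i\<in>{1..n}. ((fst (fst (h i)), inv' (q (fst (fst (h i)))) (snd (fst (h i)))), snd (h i)))"
    for h :: "nat \<Rightarrow> ('a set \<times> nat) \<times> 'a set"
  define \<Phi>' where "\<Phi>' h = (\<lambda>i\<in>{1..n}. ((fst (fst (h i)), q (fst (fst (h i))) (snd (fst (h i)))), snd (h i)))"
    for h :: "nat \<Rightarrow> ('a set \<times> nat) \<times> 'a set"
  have inv: "inv' (q U) (q U r) = r" "q U (inv' (q U) r) = r" for U r
    using q[of U] by (simp_all add: bij_is_inj bij_is_surj surj_f_inv_f)
  have "bij_betw \<Phi> (configs G n s) (configs G n (\<lambda>U r. s U (q U r)))"
  proof (rule bij_betw_byWitness[where f' = \<Phi>'])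
    show "\<forall>h\<in>configs G n s. \<Phi>' (\<Phi> h) = h"
    proof
      fix h assume h: "h \<in> configs G n s"
      show "\<Phi>' (\<Phi> h) = h"
        by (rule extensionalityI[OF _ configsD(1)[OF h]]) (simp_all add: \<Phi>_def \<Phi>'_def inv)
    qed
    show "\<forall>h\<in>configs G n (\<lambda>U r. s U (q U r)). \<Phi> (\<Phi>' h) = h"
    proof
      fix h assume h: "h \<in> configs G n (\<lambda>U r. s U (q U r))"
      show "\<Phi> (\<Phi>' h) = h"
        by (rule extensionalityI[OF _ configsD(1)[OF h]]) (simp_all add: \<Phi>_def \<Phi>'_def inv)
    qed
    show "\<Phi> ` configs G n s \<subseteq> configs G n (\<lambda>U r. s U (q U r))"
    proof (intro image_subsetI configsI)
      fix h assume h: "h \<in> configs G n s"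
      show "\<Phi> h \<in> extensional {1..n}" by (simp add: \<Phi>_def)
      show "subgroup (fst (fst (\<Phi> h i))) G" "snd (\<Phi> h i) \<in> rcosets (fst (fst (\<Phi> h i)))" if "i \<in> {1..n}" for i
        using configsD(2,3)[OF h that] that by (simp_all add: \<Phi>_def)
      fix U r assume U: "subgroup U G"
      have "fst (\<Phi> h i) = (U, r) \<longleftrightarrow> fst (h i) = (U, q U r)" if "i \<in> {1..n}" for i
        using that inv by (auto simp: \<Phi>_def prod_eq_iff)
      then have "{i \<in> {1..n}. fst (\<Phi> h i) = (U, r)} = {i \<in> {1..n}. fst (h i) = (U, q U r)}" by blast
      then show "card {i \<in> {1..n}. fst (\<Phi> h i) = (U, r)} = s U (q U r)" using configsD(4)[OF h U] by simp
    qed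
    show "\<Phi>' ` configs G n (\<lambda>U r. s U (q U r)) \<subseteq> configs G n s"
    proof (intro image_subsetI configsI)
      fix h assume h: "h \<in> configs G n (\<lambda>U r. s U (q U r))"
      show "\<Phi>' h \<in> extensional {1..n}" by (simp add: \<Phi>'_def)
      show "subgroup (fst (fst (\<Phi>' h i))) G" "snd (\<Phi>' h i) \<in> rcosets (fst (fst (\<Phi>' h i)))" if "i \<in> {1..n}" for i
        using configsD(2,3)[OF h that] that by (simp_all add: \<Phi>'_def)
      fix U r assume U: "subgroup U G"
      have "fst (\<Phi>' h i) = (U, r) \<longleftrightarrow> fst (h i) = (U, inv' (q U) r)" if "i \<in> {1..n}" for i
        using that inv by (auto simp: \<Phi>'_def prod_eq_iff)
      then have "{i \<in> {1..n}. fst (\<Phi>' h i) = (U, r)} = {i \<in> {1..n}. fst (h i) = (U, inv' (q U) r)}" by blast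
      then show "card {i \<in> {1..n}. fst (\<Phi>' h i) = (U, r)} = s U r" using configsD(4)[OF h U] inv by simp
    qed
  qed
  then show ?thesis
  proof (rule transitive_subset_bij[THEN iffD2, OF _ _ _ tr])
    fix y h assume y: "y \<in> Y" and h: "h \<in> configs G n s"
    note W = wreathD[OF subsetD[OF Y y]]
    show "config_action G n y h \<in> configs G n s" using config_action_closed h y Y by blast
    show "config_action G n y (\<Phi> h) = \<Phi> (config_action G n y h)"
    proof (rule extensional_eq_on_permuted[OF W(1) config_action_extensional])
      show "\<Phi> (config_action G n y h) \<in> extensional {1..n}" by (simp add: \<Phi>_def)
      fix i assume i: "i \<in> {1..n}"
      show "config_action G n y (\<Phi> h) (snd y i) = \<Phi> (config_action G n y h) (snd y i)"
        using W(3)[OF i] i by (simp add: config_action_perm[OF W(1) i] \<Phi>_def)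
    qed
  qed
qed

end

section \<open>Separating subsets\<close>

lemma card_le_if_inj:
  assumes "finite B" "\<And>y. y \<in> A \<Longrightarrow> f y \<in> B" "inj_on f A"
  shows "card A \<le> card B"
  using assms by (intro card_inj_on_le[of f]) auto

text \<open>
  The elements of \<open>L\<close> in the fibre of \<open>\<epsilon>\<close> over some \<open>\<eta> \<noteq> \<one>\<close> are exchanged for the
  elements of \<open>L\<close> in the kernel of \<open>\<epsilon>\<close>. This turns the fibre \<open>Y1\<close> of \<open>\<epsilon>\<close> into a set \<open>Y2\<close>.
  Both sets are transitive on \<open>E\<close>, but they count the elements fixing \<open>T\<close> differently.
\<close>
lemma exists_separating_subset:
  fixes W :: "('w, 'm) monoid_scheme" and H :: "('h, 'n) monoid_scheme"
    and \<phi> :: "'w \<Rightarrow> 'e \<Rightarrow> 'e" and \<psi> :: "'w \<Rightarrow> 'f \<Rightarrow> 'f"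
  assumes W: "group W" "finite (carrier W)"
    and \<phi>: "\<And>w a. w \<in> carrier W \<Longrightarrow> a \<in> E \<Longrightarrow> \<phi> w a \<in> E"
      "\<And>v w a. v \<in> carrier W \<Longrightarrow> w \<in> carrier W \<Longrightarrow> a \<in> E \<Longrightarrow> \<phi> (v \<otimes>\<^bsub>W\<^esub> w) a = \<phi> v (\<phi> w a)"
    and trans: "E \<noteq> {}" "\<And>a b. a \<in> E \<Longrightarrow> b \<in> E \<Longrightarrow> \<exists>w\<in>carrier W. \<phi> w a = b"
    and \<psi>: "\<And>w a. w \<in> carrier W \<Longrightarrow> a \<in> F \<Longrightarrow> \<psi> w a \<in> F" "finite F"
    and H: "group H" "\<epsilon> \<in> hom W H" "\<eta> \<in> carrier H" "\<eta> \<noteq> \<one>\<^bsub>H\<^esub>"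
    and L: "L \<subseteq> carrier W" "\<one>\<^bsub>W\<^esub> \<in> L" "\<And>v w. v \<in> L \<Longrightarrow> w \<in> L \<Longrightarrow> v \<otimes>\<^bsub>W\<^esub> w \<in> L"
    and stab: "\<And>a h. a \<in> E \<Longrightarrow> h \<in> carrier H \<Longrightarrow> \<exists>z\<in>L. \<phi> z a = a \<and> \<epsilon> z = h"
    and T: "T \<in> F" "\<psi> \<one>\<^bsub>W\<^esub> T = T" "\<And>z. z \<in> L \<Longrightarrow> \<psi> z T = T \<Longrightarrow> \<epsilon> z = \<one>\<^bsub>H\<^esub>"
  shows "\<exists>Y\<subseteq>carrier W. Y \<noteq> {} \<and> transitive_subset \<phi> E Y \<and> \<not> transitive_subset \<psi> F Y"
proof -
  interpret W: group W by fact
  interpret H: group H by fact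
  have \<epsilon>: "\<epsilon> w \<in> carrier H" "\<epsilon> (v \<otimes>\<^bsub>W\<^esub> w) = \<epsilon> v \<otimes>\<^bsub>H\<^esub> \<epsilon> w"
    if "v \<in> carrier W" "w \<in> carrier W" for v w
    using H(2) that by (auto simp: hom_def)
  have \<epsilon>1: "\<epsilon> \<one>\<^bsub>W\<^esub> = \<one>\<^bsub>H\<^esub>" using H.is_group W.is_group H(2) by (intro hom_one)
  define A where "A = {w \<in> L. \<epsilon> w = \<one>\<^bsub>H\<^esub>}"
  define B where "B = {w \<in> L. \<epsilon> w = \<eta>}"
  define Y1 where "Y1 = {w \<in> carrier W. \<epsilon> w = \<eta>}"
  define Y2 where "Y2 = (Y1 - B) \<union> A"
  have fL: "finite L" using finite_subset[OF L(1) W(2)] .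
  have fin: "finite A" "finite B" "finite Y1"
    using W(2) fL by (auto simp: A_def B_def Y1_def)
  have BY: "B \<subseteq> Y1" "A \<inter> Y1 = {}" using L(1) H(4) by (auto simp: A_def B_def Y1_def)
  \<comment> \<open>Right multiplication by a stabilising z in L of value h^-1 h' injects one fibre
    within L into another without changing the image of a. Used in both directions, it shows that A
    and B send a to b equally often.\<close>
  have move: "card {y \<in> {w \<in> L. \<epsilon> w = h}. P y} \<le> card {y \<in> {w \<in> L. \<epsilon> w = h'}. P y}"
    if h: "h \<in> carrier H" "h' \<in> carrier H" and a: "a \<in> E" and P: "\<And>y z. y \<in> L \<Longrightarrow> z \<in> L \<Longrightarrow> \<phi> z a = a \<Longrightarrow> P y \<Longrightarrow> P (y \<otimes>\<^bsub>W\<^esub> z)"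
    for h h' a and P :: "'w \<Rightarrow> bool"
  proof -
    obtain z where z: "z \<in> L" "\<phi> z a = a" "\<epsilon> z = inv\<^bsub>H\<^esub> h \<otimes>\<^bsub>H\<^esub> h'"
      using stab[OF a, of "inv\<^bsub>H\<^esub> h \<otimes>\<^bsub>H\<^esub> h'"] h by auto
    show ?thesis
    proof (rule card_le_if_inj[where f = "\<lambda>y. y \<otimes>\<^bsub>W\<^esub> z"])
      show "finite {y \<in> {w \<in> L. \<epsilon> w = h'}. P y}" using fL by simp
      show "inj_on (\<lambda>y. y \<otimes>\<^bsub>W\<^esub> z) {y \<in> {w \<in> L. \<epsilon> w = h}. P y}"
        using L(1) z(1) by (intro inj_onI) (metis (no_types, lifting) W.right_cancel mem_Collect_eq subsetD)
      fix y assume y: "y \<in> {y \<in> {w \<in> L. \<epsilon> w = h}. P y}"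
      then have "\<epsilon> (y \<otimes>\<^bsub>W\<^esub> z) = h'"
        using \<epsilon>(2)[of y z] L(1) z h by (auto simp: H.m_assoc[symmetric])
      then show "y \<otimes>\<^bsub>W\<^esub> z \<in> {y \<in> {w \<in> L. \<epsilon> w = h'}. P y}" using y z P L(3) by auto
    qed
  qed
  have AB: "card {y \<in> A. \<phi> y a = b} = card {y \<in> B. \<phi> y a = b}" if a: "a \<in> E" for a b
  proof -
    have P: "\<phi> (y \<otimes>\<^bsub>W\<^esub> z) a = b" if "y \<in> L" "z \<in> L" "\<phi> z a = a" "\<phi> y a = b" for y z
      using \<phi>(2)[of y z a] that L(1) a by auto
    show ?thesis
      unfolding A_def B_def using move[OF H.one_closed H(3) a, of "\<lambda>y. \<phi> y a = b"]
        move[OF H(3) H.one_closed a, of "\<lambda>y. \<phi> y a = b"] P by (intro antisym) blast+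
  qed
  obtain a0 where a0: "a0 \<in> E" using trans(1) by blast
  have cAB: "card A = card B"
    unfolding A_def B_def using move[OF H.one_closed H(3) a0, of "\<lambda>y. True"]
      move[OF H(3) H.one_closed a0, of "\<lambda>y. True"] by simp
  \<comment> \<open>A transporter is corrected by a stabilising element of inverse value, so the
    kernel of \<epsilon> is itself transitive on E. Multiplying by kernel elements on both sides
    then shows that \<open>Y1\<close> is transitive.\<close>
  have ker: "\<exists>u\<in>carrier W. \<phi> u a = b \<and> \<epsilon> u = \<one>\<^bsub>H\<^esub>" if ab: "a \<in> E" "b \<in> E" for a b
  proof -
    obtain w where w: "w \<in> carrier W" "\<phi> w a = b" using trans(2)[OF ab] by blast
    obtain z where z: "z \<in> L" "\<phi> z a = a" "\<epsilon> z = inv\<^bsub>H\<^esub> (\<epsilon> w)"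
      using stab[OF ab(1), of "inv\<^bsub>H\<^esub> (\<epsilon> w)"] \<epsilon>(1) w by blast
    have "z \<in> carrier W" using z L(1) by blast
    then show ?thesis using w z \<phi>(2)[of w z a] ab \<epsilon>(1)[of w w] \<epsilon>(2)[of w z]
      by (intro bexI[of _ "w \<otimes>\<^bsub>W\<^esub> z"]) auto
  qed
  have le: "card {y \<in> Y1. \<phi> y a = b} \<le> card {y \<in> Y1. \<phi> y a' = b'}"
    if E: "a \<in> E" "b \<in> E" "a' \<in> E" "b' \<in> E" for a b a' b'
  proof -
    obtain u where u: "u \<in> carrier W" "\<phi> u a' = a" "\<epsilon> u = \<one>\<^bsub>H\<^esub>" using ker E by blast
    obtain v where v: "v \<in> carrier W" "\<phi> v b = b'" "\<epsilon> v = \<one>\<^bsub>H\<^esub>" using ker E by blast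
    show ?thesis
    proof (rule card_le_if_inj[where f = "\<lambda>y. v \<otimes>\<^bsub>W\<^esub> y \<otimes>\<^bsub>W\<^esub> u"])
      show "finite {y \<in> Y1. \<phi> y a' = b'}" using fin by simp
      show "inj_on (\<lambda>y. v \<otimes>\<^bsub>W\<^esub> y \<otimes>\<^bsub>W\<^esub> u) {y \<in> Y1. \<phi> y a = b}"
        using u(1) v(1) by (intro inj_onI) (auto simp: Y1_def)
      fix y assume "y \<in> {y \<in> Y1. \<phi> y a = b}"
      then have y: "y \<in> carrier W" "\<epsilon> y = \<eta>" "\<phi> y a = b" by (auto simp: Y1_def)
      have "\<epsilon> (v \<otimes>\<^bsub>W\<^esub> y \<otimes>\<^bsub>W\<^esub> u) = \<eta>"
        using \<epsilon>(2)[of "v \<otimes>\<^bsub>W\<^esub> y" u] \<epsilon>(2)[of v y] y u v H(3) by simp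
      moreover have "\<phi> (v \<otimes>\<^bsub>W\<^esub> y \<otimes>\<^bsub>W\<^esub> u) a' = b'"
        using \<phi>(2)[of "v \<otimes>\<^bsub>W\<^esub> y" u a'] \<phi>(2)[of v y a] y u v E by simp
      ultimately show "v \<otimes>\<^bsub>W\<^esub> y \<otimes>\<^bsub>W\<^esub> u \<in> {y \<in> Y1. \<phi> y a' = b'}"
        using y u v by (simp add: Y1_def)
    qed
  qed
  define c where "c = card {y \<in> Y1. \<phi> y a0 = a0}"
  have c: "card {y \<in> Y1. \<phi> y a = b} = c" if "a \<in> E" "b \<in> E" for a b
    unfolding c_def by (intro antisym le that a0)
  obtain z0 where "z0 \<in> L" "\<phi> z0 a0 = a0" "\<epsilon> z0 = \<eta>" using stab[OF a0 H(3)] by blast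
  then have z0: "z0 \<in> {y \<in> Y1. \<phi> y a0 = a0}" using L(1) by (auto simp: Y1_def)
  then have "c > 0" unfolding c_def using fin by (auto simp: card_gt_0_iff)
  have count2: "card {y \<in> Y2. P y} + card {y \<in> B. P y} = card {y \<in> Y1. P y} + card {y \<in> A. P y}" for P
  proof -
    have "{y \<in> Y2. P y} \<union> {y \<in> B. P y} = {y \<in> Y1. P y} \<union> {y \<in> A. P y}"
      "{y \<in> Y2. P y} \<inter> {y \<in> B. P y} = {}" "{y \<in> Y1. P y} \<inter> {y \<in> A. P y} = {}"
      using BY by (auto simp: Y2_def)
    then show ?thesis
      using fin card_Un_disjoint[of "{y \<in> Y2. P y}" "{y \<in> B. P y}"] card_Un_disjoint[of "{y \<in> Y1. P y}" "{y \<in> A. P y}"]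
      by (simp add: Y2_def)
  qed
  have "Y1 \<noteq> {}" "Y1 \<subseteq> carrier W" using z0 by (auto simp: Y1_def)
  have tr1: "transitive_subset \<phi> E Y1"
    using c \<open>c > 0\<close> \<open>Y1 \<noteq> {}\<close> by (auto simp: transitive_subset_def)
  have "Y2 \<noteq> {}" using L(2) \<epsilon>1 by (auto simp: Y2_def A_def)
  moreover have "card {y \<in> Y2. \<phi> y a = b} = c" if "a \<in> E" "b \<in> E" for a b
    using count2[of "\<lambda>y. \<phi> y a = b"] AB[OF that(1), of b] c[OF that] by simp
  ultimately have tr2: "transitive_subset \<phi> E Y2"
    using \<open>c > 0\<close> by (auto simp: transitive_subset_def)
  have Y2: "Y2 \<subseteq> carrier W" using L(1) by (auto simp: Y2_def Y1_def A_def)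
  \<comment> \<open>The sizes agree, so the two constants on F would agree. But no element of B
    fixes T while the identity lies in A, so the exchange strictly increases the number of elements
    fixing T.\<close>
  have "\<not> (transitive_subset \<psi> F Y1 \<and> transitive_subset \<psi> F Y2)"
  proof
    assume "transitive_subset \<psi> F Y1 \<and> transitive_subset \<psi> F Y2"
    then obtain c1 c2 where "\<forall>a\<in>F. \<forall>b\<in>F. card {y \<in> Y1. \<psi> y a = b} = c1"
      "\<forall>a\<in>F. \<forall>b\<in>F. card {y \<in> Y2. \<psi> y a = b} = c2"
      unfolding transitive_subset_def by blast
    then have c1: "card {y \<in> Y1. \<psi> y T = b} = c1" and c2: "card {y \<in> Y2. \<psi> y T = b} = c2" if "b \<in> F" for b
      using T(1) that by blast+
    have "card F * c1 = card Y1"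
      using card_fibres[of Y1 F "\<lambda>y. \<psi> y T"] c1 fin \<psi> T(1) by (simp add: Y1_def)
    moreover have "card F * c2 = card Y2"
    proof -
      have "finite Y2" using finite_subset[OF Y2 W(2)] .
      moreover have "\<psi> y T \<in> F" if "y \<in> Y2" for y using \<psi>(1) T(1) Y2 that by blast
      ultimately show ?thesis using card_fibres[of Y2 F "\<lambda>y. \<psi> y T"] c2 \<psi>(2) by simp
    qed
    moreover have "card Y2 = card Y1" using count2[of "\<lambda>_. True"] cAB by simp
    moreover have "card F > 0" using T(1) \<psi>(2) by (auto simp: card_gt_0_iff)
    ultimately have "c1 = c2" by (metis mult_cancel1 less_numeral_extra(3))
    moreover have "card {y \<in> B. \<psi> y T = T} = 0"
    proof -
      have "{y \<in> B. \<psi> y T = T} = {}" using T(3) H(4) by (auto simp: B_def)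
      then show ?thesis by (simp only: card.empty)
    qed
    moreover have "card {y \<in> A. \<psi> y T = T} > 0"
    proof -
      have "\<one>\<^bsub>W\<^esub> \<in> {y \<in> A. \<psi> y T = T}" using T(2) L(2) \<epsilon>1 by (simp add: A_def)
      then show ?thesis using fin(1) by (auto simp: card_gt_0_iff)
    qed
    ultimately show False using count2[of "\<lambda>y. \<psi> y T = T"] c1[OF T(1)] c2[OF T(1)] by linarith
  qed
  then show ?thesis using tr1 tr2 \<open>Y1 \<noteq> {}\<close> \<open>Y2 \<noteq> {}\<close> \<open>Y1 \<subseteq> carrier W\<close> Y2 by blast
qed

section \<open>Double partitions\<close>

context comm_group
begin

lemma order_eq_one_iff: "order G = 1 \<longleftrightarrow> carrier G = {\<one>}"
proof
  assume "order G = 1"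
  then obtain x where "carrier G = {x}" unfolding order_def by (auto simp: card_1_singleton_iff)
  then show "carrier G = {\<one>}" using one_closed by auto
qed (simp add: order_def)

text \<open>A finite set of rows large enough to contain every nonempty one, given a bound M on the
  support of \<sigma>.\<close>

definition double_rows :: "nat \<Rightarrow> ('a set \<times> nat) set"
  where "double_rows M = Pair {\<one>} ` {..<M} \<union> {(carrier G, 0)}"

lemma finite_double_rows: "finite (double_rows M)"
  by (simp add: double_rows_def)

lemma subgroup_double_rows: "(V, q) \<in> double_rows M \<Longrightarrow> subgroup V G"
  by (auto simp: double_rows_def triv_subgroup subgroup_self)

context
  fixes \<sigma> :: "nat \<Rightarrow> nat" and k M :: nat
  assumes M: "{i. \<sigma> i \<noteq> 0} \<subseteq> {..<M}" and k: "order G = 1 \<longrightarrow> k = 0"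
begin

lemma above_less: "t < \<sigma> i \<Longrightarrow> i < M"
  using M by (metis (mono_tags, lifting) lessThan_iff less_nat_zero_code mem_Collect_eq subsetD)

lemma double_map_support:
  "double_map G \<sigma> (one_row k) V q \<noteq> 0 \<Longrightarrow> (V, q) \<in> double_rows M"
  using above_less[of 0 q] by (auto simp: double_map_def double_rows_def one_row_def empty_partition_def split: if_splits)

lemma finite_double_map_support:
  "finite {(V, q). subgroup V G \<and> double_map G \<sigma> (one_row k) V q \<noteq> 0}"
proof (rule finite_subset[OF _ finite_double_rows[of M]])
  show "{(V, q). subgroup V G \<and> double_map G \<sigma> (one_row k) V q \<noteq> 0} \<subseteq> double_rows M"
    using double_map_support by blast
qed

text \<open>This is the excess of \<sigma> with the extra part k. Over the trivial group the two
  subgroups coincide, but then k = 0 and the extra row is row 0 of \<sigma>, which the set of rows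
  counts once.\<close>

lemma sum_double_rows:
  "(\<Sum>(V, q)\<in>double_rows M. double_map G \<sigma> (one_row k) V q - t) = excess \<sigma> t + (k - t)"
proof (cases "carrier G = {\<one>}")
  case True
  have "double_rows M = Pair {\<one>} ` insert 0 {..<M}" using True by (auto simp: double_rows_def)
  then have "(\<Sum>(V, q)\<in>double_rows M. double_map G \<sigma> (one_row k) V q - t) = (\<Sum>q\<in>insert 0 {..<M}. \<sigma> q - t)"
    by (simp only:) (subst sum.reindex, auto simp: inj_on_def double_map_def)
  also have "\<dots> = excess \<sigma> t" using above_less by (intro excess_eq_sum[symmetric]) auto
  moreover have "k = 0" using k True order_eq_one_iff by blast
  ultimately show ?thesis by simp
next
  case False
  have "(\<Sum>(V, q)\<in>double_rows M. double_map G \<sigma> (one_row k) V q - t) =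
      (\<Sum>(V, q)\<in>Pair {\<one>} ` {..<M}. double_map G \<sigma> (one_row k) V q - t) + (k - t)"
    unfolding double_rows_def using False by (subst sum.union_disjoint) (auto simp: double_map_def one_row_def)
  also have "(\<Sum>(V, q)\<in>Pair {\<one>} ` {..<M}. double_map G \<sigma> (one_row k) V q - t) = (\<Sum>q<M. \<sigma> q - t)"
    by (subst sum.reindex) (auto simp: inj_on_def double_map_def)
  also have "\<dots> = excess \<sigma> t" using above_less by (intro excess_eq_sum[symmetric]) auto
  finally show ?thesis .
qed

lemma boxes_double_map:
  "finite (boxes G (double_map G \<sigma> (one_row k)))"
  "card (boxes G (double_map G \<sigma> (one_row k))) = psize \<sigma> + k"
proof -
  let ?s = "double_map G \<sigma> (one_row k)"
  let ?S = "SIGMA R:double_rows M. {..<?s (fst R) (snd R)}"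
  let ?f = "\<lambda>(R, j). (fst R, snd R, j) :: 'a box"
  have "boxes G ?s = ?f ` ?S"
  proof (intro Set.set_eqI iffI)
    fix b assume b: "b \<in> boxes G ?s"
    obtain V q j where b': "b = (V, q, j)" by (metis prod.exhaust)
    then have "j < ?s V q" using b by (simp add: boxes_def)
    moreover from this have "(V, q) \<in> double_rows M" by (intro double_map_support) simp
    ultimately show "b \<in> ?f ` ?S" unfolding b' by (intro image_eqI[of _ _ "((V, q), j)"]) simp_all
  next
    fix b assume "b \<in> ?f ` ?S"
    then obtain V q j where "(V, q) \<in> double_rows M" "j < ?s V q" "b = (V, q, j)" by auto
    then show "b \<in> boxes G ?s" using subgroup_double_rows by (simp add: boxes_def)
  qed
  moreover have "inj_on ?f ?S" by (auto simp: inj_on_def prod_eq_iff)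
  moreover have "finite ?S" using finite_double_rows by (intro finite_SigmaI) auto
  moreover have "card ?S = psize \<sigma> + k"
    using sum_double_rows[of 0] finite_double_rows by (simp add: case_prod_beta excess_zero)
  ultimately show "finite (boxes G ?s)" "card (boxes G ?s) = psize \<sigma> + k" by (simp_all add: card_image)
qed

end

section \<open>Sufficiency\<close>

lemma transitive_dominance:
  fixes \<sigma> \<tau> :: "nat \<Rightarrow> nat"
  assumes fin: "finite (carrier G)" and Y: "Y \<subseteq> carrier (wreath_product G n)"
    and l: "order G = 1 \<longrightarrow> l = 0"
    and \<sigma>: "finite {i. \<sigma> i \<noteq> 0}" and \<tau>: "finite {i. \<tau> i \<noteq> 0}" and kl: "k \<le> l"
    and le: "\<And>t. excess \<sigma> t + (k - t) \<le> excess \<tau> t + (l - t)" and size: "excess \<sigma> 0 + k = excess \<tau> 0 + l"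
    and tr: "transitive_subset (config_action G n) (configs G n (double_map G \<sigma> (one_row k))) Y"
  shows "transitive_subset (config_action G n) (configs G n (double_map G \<tau> (one_row l))) Y"
proof -
  \<comment> \<open>The bound k \<le> l belongs to the invariant because it forces k = 0 over the
    trivial group.\<close>
  define P where "P \<sigma> k \<longleftrightarrow> finite {i. \<sigma> i \<noteq> 0} \<and> k \<le> l \<and>
    transitive_subset (config_action G n) (configs G n (double_map G \<sigma> (one_row k))) Y" for \<sigma> k
  have supp: "finite {(V, q). subgroup V G \<and> double_map G \<sigma> (one_row k) V q \<noteq> 0}" if \<sigma>: "P \<sigma> k" for \<sigma> k
  proof -
    obtain M where "{i. \<sigma> i \<noteq> 0} \<subseteq> {..<M}" using \<sigma> finite_nat_bounded unfolding P_def by blast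
    moreover have "order G = 1 \<longrightarrow> k = 0" using l \<sigma> unfolding P_def by auto
    ultimately show ?thesis by (rule finite_double_map_support)
  qed
  \<comment> \<open>One statement for both moves into the unlabelled row: the exchange takes b = k
    and k' = \<sigma> r, the single box b = \<sigma> r - 1 and k' = k + 1. A positive k' \<le> l
    excludes the trivial group, so the rows are distinct.\<close>
  have to_row: "P (\<sigma>(r := b)) k'"
    if \<sigma>: "P \<sigma> k" and b: "b \<le> \<sigma> r" "\<sigma> r \<le> k'" "\<sigma> r + k = b + k'" "k' \<le> l" "0 < k'" for \<sigma> k r b k'
  proof -
    have G1: "carrier G \<noteq> {\<one>}" using b(4,5) l order_eq_one_iff by (metis le_zero_eq not_less_zero)
    have "transitive_subset (config_action G n) (configs G n (double_map G (\<sigma>(r := b)) (one_row k'))) Y"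
    proof (rule transitive_move_boxes[OF fin supp[OF \<sigma>] triv_subgroup subgroup_self _ _ _ _ _ _ Y])
      show "transitive_subset (config_action G n) (configs G n (double_map G \<sigma> (one_row k))) Y"
        using \<sigma> by (simp add: P_def)
      show "({\<one>}, r) \<noteq> (carrier G, 0)" using G1 by auto
      show "double_map G (\<sigma>(r := b)) (one_row k') V q = double_map G \<sigma> (one_row k) V q"
        if "(V, q) \<noteq> ({\<one>}, r)" "(V, q) \<noteq> (carrier G, 0)" for V q
        using that by (auto simp: double_map_def one_row_def)
    qed (use b G1 in \<open>simp_all add: double_map_def one_row_def\<close>)
    then show ?thesis using \<sigma> b(4) unfolding P_def by (intro conjI finite_support_upd) simp_all
  qed
  have "P \<tau> l"
  proof (rule dominance_chain[of P])
    fix \<sigma> k r s assume \<sigma>: "P \<sigma> k" and rs: "r \<noteq> s" "0 < \<sigma> s" "\<sigma> s \<le> \<sigma> r"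
    have "transitive_subset (config_action G n)
        (configs G n (double_map G (\<sigma>(r := Suc (\<sigma> r), s := \<sigma> s - 1)) (one_row k))) Y"
    proof (rule transitive_move_boxes[OF fin supp[OF \<sigma>] triv_subgroup triv_subgroup subset_refl, where r = s and r' = r])
      show "transitive_subset (config_action G n) (configs G n (double_map G \<sigma> (one_row k))) Y"
        using \<sigma> by (simp add: P_def)
      show "double_map G (\<sigma>(r := Suc (\<sigma> r), s := \<sigma> s - 1)) (one_row k) V q = double_map G \<sigma> (one_row k) V q"
        if "(V, q) \<noteq> ({\<one>}, s)" "(V, q) \<noteq> ({\<one>}, r)" for V q
        using that by (auto simp: double_map_def)
    qed (use rs Y in \<open>auto simp: double_map_def\<close>)
    moreover have "finite {i. (\<sigma>(r := Suc (\<sigma> r), s := \<sigma> s - 1)) i \<noteq> 0}"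
      using \<sigma> by (intro finite_support_upd) (simp add: P_def)
    ultimately show "P (\<sigma>(r := Suc (\<sigma> r), s := \<sigma> s - 1)) k" using \<sigma> unfolding P_def by blast
  next
    fix \<sigma> k r assume "P \<sigma> k" "k < \<sigma> r" "\<sigma> r \<le> l"
    then show "P (\<sigma>(r := k)) (\<sigma> r)" by (intro to_row[of \<sigma> k]) simp_all
  next
    fix \<sigma> k r assume "P \<sigma> k" "0 < \<sigma> r" "\<sigma> r \<le> k" "k < l"
    then show "P (\<sigma>(r := \<sigma> r - 1)) (Suc k)" by (intro to_row[of \<sigma> k]) simp_all
  next
    fix \<sigma> k and p :: "nat \<Rightarrow> nat" assume \<sigma>: "P \<sigma> k" and p: "bij p"
    define q where "q U = (if U = {\<one>} then p else id)" for U :: "'a set"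
    have q: "bij (q U)" for U using p by (simp add: q_def)
    have "transitive_subset (config_action G n) (configs G n (double_map G \<sigma> (one_row k))) Y"
      using \<sigma> by (simp add: P_def)
    from transitive_relabel[where q = q, OF q Y this]
    have "transitive_subset (config_action G n) (configs G n (\<lambda>U r. double_map G \<sigma> (one_row k) U (q U r))) Y" .
    moreover have "(\<lambda>U r. double_map G \<sigma> (one_row k) U (q U r)) = double_map G (\<sigma> \<circ> p) (one_row k)"
      by (intro ext) (simp add: double_map_def q_def)
    moreover have "finite {i. (\<sigma> \<circ> p) i \<noteq> 0}"
      using finite_vimageI[of "{i. \<sigma> i \<noteq> 0}" p] \<sigma> p by (simp add: P_def vimage_def bij_is_inj)
    ultimately show "P (\<sigma> \<circ> p) k" using \<sigma> unfolding P_def by simp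
  next
    show "P \<sigma> k" using \<sigma> kl tr by (simp add: P_def)
  qed (use assms in auto)
  then show ?thesis by (simp add: P_def)
qed

section \<open>Necessity\<close>

lemma self_rcoset:
  assumes "subgroup U G"
  shows "U \<in> rcosets U"
  using rcosetsI[OF subgroup.subset[OF assms] one_closed] coset_mult_one[OF subgroup.subset[OF assms]] by simp

text \<open>Configurations forget columns, so the columns of one actual filling are recorded in
  \<open>col\<close>.\<close>

lemma exists_standard_config:
  assumes "finite (boxes G s)" "card (boxes G s) = n"
  obtains T col where "T \<in> configs G n s"
    "\<And>i V q. i \<in> {1..n} \<Longrightarrow> fst (T i) = (V, q) \<Longrightarrow> col i < s V q"
    "inj_on (\<lambda>i. (fst (T i), col i)) {1..n}"
proof -
  obtain f where f: "bij_betw f {1..n} (boxes G s)"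
    using finite_same_card_bij[of "{1..n}" "boxes G s"] assms by auto
  define T where "T = (\<lambda>i\<in>{1..n}. ((fst (f i), fst (snd (f i))), fst (f i)))"
  define col where "col i = snd (snd (f i))" for i
  have fb: "f i \<in> boxes G s" if "i \<in> {1..n}" for i using bij_betwE[OF f] that by blast
  have fi: "subgroup (fst (f i)) G" "col i < s (fst (f i)) (fst (snd (f i)))" if "i \<in> {1..n}" for i
    using fb[OF that] by (auto simp: boxes_def col_def)
  show thesis
  proof
    show "T \<in> configs G n s"
    proof (rule configsI)
      show "T \<in> extensional {1..n}" by (simp add: T_def)
      show "subgroup (fst (fst (T i))) G" "snd (T i) \<in> rcosets (fst (fst (T i)))" if i: "i \<in> {1..n}" for i
        using fi(1)[OF i] i self_rcoset[OF fi(1)[OF i]] by (simp_all add: T_def)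
      fix V q assume V: "subgroup V G"
      have "f ` {i \<in> {1..n}. fst (T i) = (V, q)} = (\<lambda>j. (V, q, j)) ` {..<s V q}"
      proof (intro Set.set_eqI iffI)
        fix b assume "b \<in> f ` {i \<in> {1..n}. fst (T i) = (V, q)}"
        then obtain i where i: "i \<in> {1..n}" "fst (T i) = (V, q)" "b = f i" by blast
        then have "b = (V, q, col i)" "col i < s V q" using fi(2)[OF i(1)] by (auto simp: T_def col_def prod_eq_iff)
        then show "b \<in> (\<lambda>j. (V, q, j)) ` {..<s V q}" by simp
      next
        fix b assume "b \<in> (\<lambda>j. (V, q, j)) ` {..<s V q}"
        then obtain j where j: "b = (V, q, j)" "j < s V q" by blast
        then have "b \<in> boxes G s" using V by (simp add: boxes_def)
        then obtain i where "i \<in> {1..n}" "f i = b" using f by (metis bij_betw_imp_surj_on imageE)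
        then show "b \<in> f ` {i \<in> {1..n}. fst (T i) = (V, q)}"
          using j(1) by (intro image_eqI[of _ _ i]) (simp_all add: T_def)
      qed
      moreover have "inj_on f {i \<in> {1..n}. fst (T i) = (V, q)}"
        using bij_betw_imp_inj_on[OF f] by (rule inj_on_subset) blast
      ultimately show "card {i \<in> {1..n}. fst (T i) = (V, q)} = s V q"
        using card_image[of f "{i \<in> {1..n}. fst (T i) = (V, q)}"] card_image[of "\<lambda>j. (V, q, j)" "{..<s V q}"]
        by (simp add: inj_on_def)
    qed
    show "col i < s V q" if "i \<in> {1..n}" "fst (T i) = (V, q)" for i V q
      using fi(2)[OF that(1)] that by (auto simp: T_def)
    show "inj_on (\<lambda>i. (fst (T i), col i)) {1..n}"
    proof (rule inj_onI)
      fix i j assume ij: "i \<in> {1..n}" "j \<in> {1..n}" "(fst (T i), col i) = (fst (T j), col j)"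
      then have "f i = f j" by (simp add: T_def col_def prod_eq_iff)
      then show "i = j" using inj_onD[OF bij_betw_imp_inj_on[OF f]] ij by blast
    qed
  qed
qed

text \<open>Without a collision, each row of \<open>a\<close> has at most t integers in the first t
  columns of T, so at least its length minus t of them lie beyond. Summed over the rows, this
  exceeds the number of boxes of T beyond column t.\<close>

lemma exists_collision:
  fixes col :: "nat \<Rightarrow> nat"
  assumes a: "a \<in> configs G n s" and T: "T \<in> configs G n s'"
    and col: "\<And>i V q. i \<in> {1..n} \<Longrightarrow> fst (T i) = (V, q) \<Longrightarrow> col i < s' V q"
      "inj_on (\<lambda>i. (fst (T i), col i)) {1..n}"
    and R: "finite R" "\<And>V q. (V, q) \<in> R \<Longrightarrow> subgroup V G"
    and R': "finite R'" "\<And>V q. s' V q \<noteq> 0 \<Longrightarrow> (V, q) \<in> R'"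
    and less: "(\<Sum>(V, q)\<in>R'. s' V q - t) < (\<Sum>(V, q)\<in>R. s V q - t)"
  shows "\<exists>i\<in>{1..n}. \<exists>j\<in>{1..n}. i \<noteq> j \<and> fst (a i) = fst (a j) \<and> col i = col j"
proof (rule ccontr)
  assume "\<not> ?thesis"
  then have inj: "i = j" if "i \<in> {1..n}" "j \<in> {1..n}" "fst (a i) = fst (a j)" "col i = col j" for i j
    using that by blast
  define K where "K r = {i \<in> {1..n}. fst (a i) = r \<and> t \<le> col i}" for r
  have K: "s V q - t \<le> card (K (V, q))" if Vq: "(V, q) \<in> R" for V q
  proof -
    define B where "B = {i \<in> {1..n}. fst (a i) = (V, q) \<and> col i < t}"
    have "inj_on col B"
    proof (rule inj_onI)
      fix i j assume "i \<in> B" "j \<in> B" "col i = col j"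
      then show "i = j" using inj[of i j] by (simp add: B_def)
    qed
    then have "card B \<le> card {..<t}" by (intro card_inj_on_le[of col]) (auto simp: B_def)
    moreover have "card (K (V, q) \<union> B) = card (K (V, q)) + card B"
      by (intro card_Un_disjoint) (auto simp: K_def B_def)
    moreover have "{i \<in> {1..n}. fst (a i) = (V, q)} = K (V, q) \<union> B" by (auto simp: K_def B_def)
    ultimately show ?thesis using configsD(4)[OF a R(2)[OF Vq], of q] by simp
  qed
  have "(\<Sum>(V, q)\<in>R. s V q - t) \<le> (\<Sum>r\<in>R. card (K r))" using K by (intro sum_mono) auto
  also have "\<dots> = card (\<Union>r\<in>R. K r)"
    using R(1) by (intro card_UN_disjoint[symmetric]) (auto simp: K_def)
  also have "\<dots> \<le> card {i \<in> {1..n}. t \<le> col i}" by (rule card_mono) (auto simp: K_def)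
  also have "\<dots> \<le> card (SIGMA r:R'. {t..<s' (fst r) (snd r)})"
  proof (rule card_inj_on_le)
    show "inj_on (\<lambda>i. (fst (T i), col i)) {i \<in> {1..n}. t \<le> col i}"
      using col(2) by (rule inj_on_subset) blast
    show "(\<lambda>i. (fst (T i), col i)) ` {i \<in> {1..n}. t \<le> col i} \<subseteq> (SIGMA r:R'. {t..<s' (fst r) (snd r)})"
    proof (intro image_subsetI)
      fix i assume i: "i \<in> {i \<in> {1..n}. t \<le> col i}"
      obtain V q where Vq: "fst (T i) = (V, q)" by (metis prod.exhaust)
      have "s' V q \<noteq> 0" using configs_row_nonempty[OF T _ Vq] i by blast
      then show "(fst (T i), col i) \<in> (SIGMA r:R'. {t..<s' (fst r) (snd r)})"
        using R'(2) col(1)[OF _ Vq] i Vq by simp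
    qed
    show "finite (SIGMA r:R'. {t..<s' (fst r) (snd r)})" using R' by (intro finite_SigmaI) auto
  qed
  also have "\<dots> = (\<Sum>(V, q)\<in>R'. s' V q - t)" using R' by (simp add: case_prod_beta)
  finally show False using less by simp
qed

lemma separating_configs:
  assumes fin: "finite (carrier G)" "finite (configs G n s')" and ne: "configs G n s \<noteq> {}"
    and H: "group H" "\<epsilon> \<in> hom (wreath_product G n) H" "\<eta> \<in> carrier H" "\<eta> \<noteq> \<one>\<^bsub>H\<^esub>"
    and L: "L \<subseteq> carrier (wreath_product G n)" "\<one>\<^bsub>wreath_product G n\<^esub> \<in> L"
      "\<And>v w. v \<in> L \<Longrightarrow> w \<in> L \<Longrightarrow> v \<otimes>\<^bsub>wreath_product G n\<^esub> w \<in> L"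
    and stab: "\<And>a h. a \<in> configs G n s \<Longrightarrow> h \<in> carrier H \<Longrightarrow> \<exists>z\<in>L. config_action G n z a = a \<and> \<epsilon> z = h"
    and T: "T \<in> configs G n s'" "\<And>z. z \<in> L \<Longrightarrow> config_action G n z T = T \<Longrightarrow> \<epsilon> z = \<one>\<^bsub>H\<^esub>"
  shows "\<exists>Y\<subseteq>carrier (wreath_product G n). Y \<noteq> {} \<and>
    transitive_subset (config_action G n) (configs G n s) Y \<and>
    \<not> transitive_subset (config_action G n) (configs G n s') Y"
proof (rule exists_separating_subset[where \<phi> = "config_action G n" and \<psi> = "config_action G n"
      and E = "configs G n s" and F = "configs G n s'",
      OF group_wreath_product[OF is_group] finite_wreath_product[OF fin(1)] _ _ ne _ _ fin(2) H L _ T(1) config_action_one[OF T(1)]])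
  show "config_action G n w h \<in> configs G n u"
    if "w \<in> carrier (wreath_product G n)" "h \<in> configs G n u" for w h u
    using config_action_closed that .
  then show "config_action G n w h \<in> configs G n s'"
    if "w \<in> carrier (wreath_product G n)" "h \<in> configs G n s'" for w h
    using that .
  show "config_action G n (v \<otimes>\<^bsub>wreath_product G n\<^esub> w) a = config_action G n v (config_action G n w a)"
    if "v \<in> carrier (wreath_product G n)" "w \<in> carrier (wreath_product G n)" "a \<in> configs G n s" for v w a
    using config_action_mult that .
  fix a b assume ab: "a \<in> configs G n s" "b \<in> configs G n s"
  obtain \<pi> where \<pi>: "\<pi> permutes {1..n}" "\<And>i. i \<in> {1..n} \<Longrightarrow> fst (b (\<pi> i)) = fst (a i)"
    using config_fibres_perm[OF ab] by metis
  show "\<exists>w\<in>carrier (wreath_product G n). config_action G n w a = b"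
    using config_transporter[OF ab \<pi>] by blast
qed (use L stab T in auto)

text \<open>The twist by \<pi> merely reorders the factors of the second label vector, which is
  harmless in an abelian group.\<close>

lemma hom_wreath_product_finprod:
  "(\<lambda>w. finprod G (fst w) {1..n}) \<in> hom (wreath_product G n) G"
proof (rule homI)
  fix v assume v: "v \<in> carrier (wreath_product G n)"
  note V = wreathD[OF v]
  then have fv: "fst v \<in> {1..n} \<rightarrow> carrier G" by blast
  then show "finprod G (fst v) {1..n} \<in> carrier G" by (rule finprod_closed)
  fix w assume w: "w \<in> carrier (wreath_product G n)"
  note W = wreathD[OF w]
  then have fw: "fst w \<in> {1..n} \<rightarrow> carrier G" by blast
  have p: "inv' (snd v) permutes {1..n}" using permutes_inv[OF V(1)] .
  have fw': "(\<lambda>i. fst w (inv' (snd v) i)) \<in> {1..n} \<rightarrow> carrier G" using W(2) V(4) by blast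
  have "finprod G (fst (v \<otimes>\<^bsub>wreath_product G n\<^esub> w)) {1..n} =
      finprod G (\<lambda>i. fst v i \<otimes> fst w (inv' (snd v) i)) {1..n}"
    using fv fw' by (intro finprod_cong) (auto simp: wreath_product_simps simp_implies_def)
  also have "\<dots> = finprod G (fst v) {1..n} \<otimes> finprod G (\<lambda>i. fst w (inv' (snd v) i)) {1..n}"
    using fv fw' by (rule finprod_multf)
  also have "finprod G (\<lambda>i. fst w (inv' (snd v) i)) {1..n} = finprod G (fst w) (inv' (snd v) ` {1..n})"
    using fw permutes_image[OF p] permutes_inj[OF p] by (intro finprod_reindex[symmetric]) (auto intro: inj_on_subset)
  also have "inv' (snd v) ` {1..n} = {1..n}" by (rule permutes_image[OF p])
  finally show "finprod G (fst (v \<otimes>\<^bsub>wreath_product G n\<^esub> w)) {1..n} = finprod G (fst v) {1..n} \<otimes> finprod G (fst w) {1..n}" .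
qed

lemma hom_wreath_product_sign:
  "(\<lambda>w. sign (snd w)) \<in> hom (wreath_product G n) sign_img"
proof (rule homI)
  fix v assume v: "v \<in> carrier (wreath_product G n)"
  show "sign (snd v) \<in> carrier sign_img" by (simp add: sign_img_def sign_def)
  fix w assume w: "w \<in> carrier (wreath_product G n)"
  have "permutation (snd v)" "permutation (snd w)"
    using wreathD(1)[OF v] wreathD(1)[OF w] permutes_imp_permutation by blast+
  then show "sign (snd (v \<otimes>\<^bsub>wreath_product G n\<^esub> w)) = sign (snd v) \<otimes>\<^bsub>sign_img\<^esub> sign (snd w)"
    by (simp add: wreath_product_simps sign_compose sign_img_def)
qed

text \<open>Since l < k, some integer \<open>i0\<close> is in the unlabelled row of \<open>a\<close>
  but not in that of T. A label at \<open>i0\<close> is invisible to \<open>a\<close>, is allowed in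
  L and gives the product any value. An element of L fixing T has trivial labels: on labelled rows
  since G translates its points freely, elsewhere by the choice of L.\<close>

lemma exists_separating_labels:
  assumes fin: "finite (carrier G)" and M: "{i. \<sigma> i \<noteq> 0} \<subseteq> {..<M}" "{i. \<tau> i \<noteq> 0} \<subseteq> {..<M}"
    and kl: "order G = 1 \<longrightarrow> k = 0" "order G = 1 \<longrightarrow> l = 0"
    and size: "psize \<sigma> + k = n" "psize \<tau> + l = n" and less: "l < k"
  shows "\<exists>Y\<subseteq>carrier (wreath_product G n). Y \<noteq> {} \<and>
    transitive_subset (config_action G n) (configs G n (double_map G \<sigma> (one_row k))) Y \<and>
    \<not> transitive_subset (config_action G n) (configs G n (double_map G \<tau> (one_row l))) Y"
proof -
  let ?s = "double_map G \<sigma> (one_row k)" and ?s' = "double_map G \<tau> (one_row l)"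
  have G1: "carrier G \<noteq> {\<one>}" using kl(1) less order_eq_one_iff by (metis not_less_zero)
  then obtain \<eta> where \<eta>: "\<eta> \<in> carrier G" "\<eta> \<noteq> \<one>" using one_closed by blast
  obtain a0 where a0: "a0 \<in> configs G n ?s"
    using exists_standard_config[OF boxes_double_map(1)[OF M(1) kl(1)]] boxes_double_map(2)[OF M(1) kl(1)] size(1) by metis
  obtain T where T: "T \<in> configs G n ?s'"
    using exists_standard_config[OF boxes_double_map(1)[OF M(2) kl(2)]] boxes_double_map(2)[OF M(2) kl(2)] size(2) by metis
  define L where "L = {w \<in> carrier (wreath_product G n). snd w = id \<and>
    (\<forall>i\<in>{1..n}. fst (fst (T i)) \<noteq> {\<one>} \<longrightarrow> fst w i = \<one>)}"
  show ?thesis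
  proof (rule separating_configs[OF fin _ _ is_group hom_wreath_product_finprod \<eta>, where T = T and L = L])
    interpret W: group "wreath_product G n" by (rule group_wreath_product) (rule is_group)
    show "finite (configs G n ?s')" by (intro finite_configs fin finite_double_map_support[OF M(2) kl(2)])
    show "configs G n ?s \<noteq> {}" using a0 by blast
    show "L \<subseteq> carrier (wreath_product G n)" by (auto simp: L_def)
    show "\<one>\<^bsub>wreath_product G n\<^esub> \<in> L"
      using W.one_closed by (simp add: L_def wreath_product_simps(3))
    show "v \<otimes>\<^bsub>wreath_product G n\<^esub> w \<in> L" if "v \<in> L" "w \<in> L" for v w
    proof -
      have "v \<otimes>\<^bsub>wreath_product G n\<^esub> w \<in> carrier (wreath_product G n)"
        using that W.m_closed by (simp add: L_def)
      then show ?thesis using that by (simp add: L_def wreath_product_simps(2))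
    qed
    show "T \<in> configs G n ?s'" by fact
    show "finprod G (fst z) {1..n} = \<one>" if z: "z \<in> L" "config_action G n z T = T" for z
    proof (rule finprod_one_eqI)
      fix i assume i: "i \<in> {1..n}"
      have w: "z \<in> carrier (wreath_product G n)" "snd z = id" using z by (simp_all add: L_def)
      show "fst z i = \<one>"
      proof (cases "fst (fst (T i)) = {\<one>}")
        case True
        then obtain x where x: "x \<in> carrier G" "snd (T i) = {\<one>} #> x"
          using configsD(3)[OF T i] by (auto simp: RCOSETS_def)
        have "T i = (fst (T i), snd (T i) #> fst z i)"
          using config_action_perm[OF wreathD(1)[OF w(1)] i, of G T] z(2) w(2) by simp
        then have "snd (T i) = snd (T i) #> fst z i" by (metis snd_conv)
        moreover have g: "fst z i \<in> carrier G" using wreathD(2)[OF w(1) i] .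
        ultimately have "x = x \<otimes> fst z i" using x by (simp add: r_coset_def)
        then show ?thesis using x g by (metis l_cancel_one')
      next
        case False
        then show ?thesis using z(1) i by (simp add: L_def)
      qed
    qed
    show "\<exists>z\<in>L. config_action G n z a = a \<and> finprod G (fst z) {1..n} = h"
      if a: "a \<in> configs G n ?s" and h: "h \<in> carrier G" for a h
    proof -
      have lt: "card {i \<in> {1..n}. fst (T i) = (carrier G, 0)} < card {i \<in> {1..n}. fst (a i) = (carrier G, 0)}"
        using configsD(4)[OF T subgroup_self, of 0] configsD(4)[OF a subgroup_self, of 0] G1 less
        by (simp add: double_map_def one_row_def)
      have "\<not> {i \<in> {1..n}. fst (a i) = (carrier G, 0)} \<subseteq> {i \<in> {1..n}. fst (T i) = (carrier G, 0)}"
      proof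
        assume "{i \<in> {1..n}. fst (a i) = (carrier G, 0)} \<subseteq> {i \<in> {1..n}. fst (T i) = (carrier G, 0)}"
        from card_mono[OF _ this] lt show False by simp
      qed
      then obtain i0 where i0: "i0 \<in> {1..n}" "fst (a i0) = (carrier G, 0)" "fst (T i0) \<noteq> (carrier G, 0)" by blast
      obtain V q where Vq: "fst (T i0) = (V, q)" by (metis prod.exhaust)
      have "?s' V q \<noteq> 0" using configs_row_nonempty[OF T i0(1) Vq] .
      then have Ti0: "fst (fst (T i0)) = {\<one>}"
        using double_map_support[OF M(2) kl(2)] i0(3) Vq by (auto simp: double_rows_def)
      define g where "g = (\<lambda>i\<in>{1..n}. if i0 = i then h else \<one>)"
      have z: "(g, id) \<in> carrier (wreath_product G n)"
        using h by (simp add: wreath_product_simps g_def permutes_id)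
      have "config_action G n (g, id) a = a"
      proof (rule extensionalityI[OF config_action_extensional configsD(1)[OF a]])
        fix i assume i: "i \<in> {1..n}"
        have c: "snd (a i) \<subseteq> carrier G" using rcoset_subset configsD(2,3)[OF a i] by blast
        have "snd (a i) #> g i = snd (a i)"
        proof (cases "i = i0")
          case True
          then obtain x where x: "x \<in> carrier G" "snd (a i) = carrier G #> x"
            using configsD(3)[OF a i] i0(2) by (auto simp: RCOSETS_def)
          then show ?thesis
            using h i True coset_join2[OF _ subgroup_self] by (simp add: g_def)
        next
          case False
          then show ?thesis using i c by (simp add: g_def coset_mult_one)
        qed
        then show "config_action G n (g, id) a i = a i" using i by (simp add: config_action_def)
      qed
      moreover have "finprod G g {1..n} = h"
      proof -
        have "finprod G g {1..n} = finprod G (\<lambda>i. if i0 = i then h else \<one>) {1..n}"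
          using h by (intro finprod_cong) (auto simp: g_def simp_implies_def)
        also have "\<dots> = h" using finprod_singleton[OF i0(1), of "\<lambda>_. h"] h by simp
        finally show ?thesis .
      qed
      moreover have "(g, id) \<in> L" using z Ti0 by (auto simp: L_def g_def)
      ultimately show ?thesis by (intro bexI[of _ "(g, id)"]) simp_all
    qed
  qed
qed

text \<open>An element of L fixing T preserves the row and the column of every integer, so its
  permutation is trivial. For \<open>a\<close> of the first shape, failure of dominance at t gives
  two integers in one row of \<open>a\<close> and one column of T; transposing them, with corrected
  labels, fixes \<open>a\<close> and has sign -1. Columns run through both diagrams of T, as if l
  were one more row of \<tau>.\<close>

lemma exists_separating_columns:
  assumes fin: "finite (carrier G)" and M: "{i. \<sigma> i \<noteq> 0} \<subseteq> {..<M}" "{i. \<tau> i \<noteq> 0} \<subseteq> {..<M}"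
    and kl: "order G = 1 \<longrightarrow> k = 0" "order G = 1 \<longrightarrow> l = 0"
    and size: "psize \<sigma> + k = n" "psize \<tau> + l = n"
    and less: "excess \<tau> t + (l - t) < excess \<sigma> t + (k - t)"
  shows "\<exists>Y\<subseteq>carrier (wreath_product G n). Y \<noteq> {} \<and>
    transitive_subset (config_action G n) (configs G n (double_map G \<sigma> (one_row k))) Y \<and>
    \<not> transitive_subset (config_action G n) (configs G n (double_map G \<tau> (one_row l))) Y"
proof -
  let ?s = "double_map G \<sigma> (one_row k)" and ?s' = "double_map G \<tau> (one_row l)"
  obtain a0 where a0: "a0 \<in> configs G n ?s"
    using exists_standard_config[OF boxes_double_map(1)[OF M(1) kl(1)]] boxes_double_map(2)[OF M(1) kl(1)] size(1) by metis
  obtain T col where T: "T \<in> configs G n ?s'"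
    and col: "\<And>i V q. i \<in> {1..n} \<Longrightarrow> fst (T i) = (V, q) \<Longrightarrow> col i < ?s' V q"
      "inj_on (\<lambda>i. (fst (T i), col i)) {1..n}"
    using exists_standard_config[OF boxes_double_map(1)[OF M(2) kl(2)] trans[OF boxes_double_map(2)[OF M(2) kl(2)] size(2)]] by blast
  define L where "L = {w \<in> carrier (wreath_product G n). \<forall>i\<in>{1..n}. col (snd w i) = col i}"
  have \<eta>: "(-1::int) \<in> carrier sign_img" "(-1::int) \<noteq> \<one>\<^bsub>sign_img\<^esub>" by (simp_all add: sign_img_def)
  show ?thesis
  proof (rule separating_configs[OF fin _ _ sign_img_is_group hom_wreath_product_sign \<eta>, where T = T and L = L])
    interpret W: group "wreath_product G n" by (rule group_wreath_product) (rule is_group)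
    show "finite (configs G n ?s')" by (intro finite_configs fin finite_double_map_support[OF M(2) kl(2)])
    show "configs G n ?s \<noteq> {}" using a0 by blast
    show "L \<subseteq> carrier (wreath_product G n)" by (auto simp: L_def)
    show one: "\<one>\<^bsub>wreath_product G n\<^esub> \<in> L"
      using W.one_closed by (simp add: L_def wreath_product_simps(3))
    show "v \<otimes>\<^bsub>wreath_product G n\<^esub> w \<in> L" if vw: "v \<in> L" "w \<in> L" for v w
    proof -
      have c: "v \<in> carrier (wreath_product G n)" "w \<in> carrier (wreath_product G n)" using vw by (simp_all add: L_def)
      have "col (snd v (snd w i)) = col i" if i: "i \<in> {1..n}" for i
        using vw i wreathD(3)[OF c(2) i] by (simp add: L_def)
      then show ?thesis using W.m_closed[OF c] by (simp add: L_def wreath_product_simps(2))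
    qed
    show "T \<in> configs G n ?s'" by fact
    show "sign (snd z) = \<one>\<^bsub>sign_img\<^esub>" if z: "z \<in> L" "config_action G n z T = T" for z
    proof -
      have w: "z \<in> carrier (wreath_product G n)" using z by (simp add: L_def)
      have "snd z i = i" for i
      proof (cases "i \<in> {1..n}")
        case True
        have "fst (T (snd z i)) = fst (T i)"
          using config_action_perm[OF wreathD(1)[OF w] True, of G T] z(2) by simp
        moreover have "col (snd z i) = col i" using z(1) True by (simp add: L_def)
        ultimately show ?thesis using inj_onD[OF col(2), of "snd z i" i] wreathD(3)[OF w True] True by simp
      next
        case False
        then show ?thesis using permutes_not_in[OF wreathD(1)[OF w]] by blast
      qed
      then have "snd z = id" by auto
      then show ?thesis by (simp add: sign_img_def)
    qed
    show "\<exists>z\<in>L. config_action G n z a = a \<and> sign (snd z) = h"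
      if a: "a \<in> configs G n ?s" and h: "h \<in> carrier sign_img" for a h
    proof (cases "h = 1")
      case True
      then show ?thesis
        using one config_action_one[OF a] by (intro bexI[of _ "\<one>\<^bsub>wreath_product G n\<^esub>"]) (simp_all add: wreath_product_simps(3))
    next
      case False
      then have h1: "h = -1" using h by (simp add: sign_img_def)
      have "(\<Sum>(V, q)\<in>double_rows M. ?s' V q - t) < (\<Sum>(V, q)\<in>double_rows M. ?s V q - t)"
        using less sum_double_rows[OF M(1) kl(1), of t] sum_double_rows[OF M(2) kl(2), of t] by simp
      then have "\<exists>i\<in>{1..n}. \<exists>j\<in>{1..n}. i \<noteq> j \<and> fst (a i) = fst (a j) \<and> col i = col j"
        using col(1) subgroup_double_rows double_map_support[OF M(2) kl(2)]
        by (rule exists_collision[OF a T _ col(2) finite_double_rows _ finite_double_rows, rotated 3])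
      then obtain i j where ij: "i \<in> {1..n}" "j \<in> {1..n}" "i \<noteq> j" "fst (a i) = fst (a j)" "col i = col j" by blast
      have p: "transpose i j permutes {1..n}" using ij by (intro permutes_swap_id)
      have "fst (a (transpose i j x)) = fst (a x)" for x using ij(4) by (simp add: transpose_def)
      then obtain g where g: "(g, transpose i j) \<in> carrier (wreath_product G n)"
        "config_action G n (g, transpose i j) a = a"
        using config_transporter[OF a a p] by blast
      have "(g, transpose i j) \<in> L" using g(1) ij(5) by (simp add: L_def transpose_def)
      then show ?thesis using g(2) ij(3) h1
        by (intro bexI[of _ "(g, transpose i j)"]) (simp_all add: sign_swap_id)
    qed
  qed
qed

end

theorem theorem5p7:
  fixes G :: "('a, 'b) monoid_scheme" and n k l :: nat and \<sigma> \<tau> :: "nat \<Rightarrow> nat"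
  assumes "comm_group G" and "finite (carrier G)" and "n > 0"
    and "double_partition G n \<sigma> (one_row k)"
    and "double_partition G n \<tau> (one_row l)"
  shows "(\<forall>Y. Y \<subseteq> carrier (wreath_product G n) \<and> Y \<noteq> {} \<and>
               double_transitive G n \<sigma> (one_row k) Y \<longrightarrow>
               double_transitive G n \<tau> (one_row l) Y) \<longleftrightarrow>
         k \<le> l \<and> dominated (partition_union \<sigma> (one_row k)) (partition_union \<tau> (one_row l))"
proof -
  interpret comm_group G by fact
  have psize_row: "psize (one_row m) = m" for m
    using excess_zero[of "one_row m"] excess_one_row[of m 0] by simp
  have dp: "is_partition \<alpha>" "psize \<alpha> + m = n" "order G = 1 \<longrightarrow> m = 0"
    if "double_partition G n \<alpha> (one_row m)" for \<alpha> m
  proof -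
    show "is_partition \<alpha>" "psize \<alpha> + m = n" using that by (simp_all add: double_partition_def psize_row)
    have "m = 0" if "one_row m = empty_partition"
      using fun_cong[OF that, of 0] by (simp add: one_row_def empty_partition_def)
    then show "order G = 1 \<longrightarrow> m = 0" using that by (simp add: double_partition_def)
  qed
  note \<sigma> = dp[OF assms(4)] and \<tau> = dp[OF assms(5)]
  have fin: "finite {i. \<sigma> i \<noteq> 0}" "finite {i. \<tau> i \<noteq> 0}" using \<sigma>(1) \<tau>(1) by (simp_all add: is_partition_def)
  then obtain M where "{i. \<sigma> i \<noteq> 0} \<union> {i. \<tau> i \<noteq> 0} \<subseteq> {..<M}" using finite_nat_bounded by (meson finite_UnI)
  then have M: "{i. \<sigma> i \<noteq> 0} \<subseteq> {..<M}" "{i. \<tau> i \<noteq> 0} \<subseteq> {..<M}" by simp_all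
  have tr: "double_transitive G n \<sigma> (one_row k) Y \<longleftrightarrow>
        transitive_subset (config_action G n) (configs G n (double_map G \<sigma> (one_row k))) Y"
      "double_transitive G n \<tau> (one_row l) Y \<longleftrightarrow>
        transitive_subset (config_action G n) (configs G n (double_map G \<tau> (one_row l))) Y"
    if Y: "Y \<subseteq> carrier (wreath_product G n)" for Y
    unfolding double_transitive_def
    using boxes_double_map[OF M(1) \<sigma>(3)] boxes_double_map[OF M(2) \<tau>(3)] \<sigma>(2) \<tau>(2)
    by (intro tabloid_transitive_iff_configs assms(1) Y; simp)+
  \<comment> \<open>A single row of length k has excess k - t, and excesses add up under unions of
    partitions.\<close>
  have dom: "dominated (partition_union \<sigma> (one_row k)) (partition_union \<tau> (one_row l)) \<longleftrightarrow>
      (\<forall>t. excess \<sigma> t + (k - t) \<le> excess \<tau> t + (l - t))"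
    using \<sigma>(1) \<tau>(1)
    by (simp add: dominated_iff_excess is_partition_partition_union excess_partition_union
        is_partition_one_row excess_one_row)
  show ?thesis
  proof
    assume "k \<le> l \<and> dominated (partition_union \<sigma> (one_row k)) (partition_union \<tau> (one_row l))"
    then have kl: "k \<le> l" and le: "\<And>t. excess \<sigma> t + (k - t) \<le> excess \<tau> t + (l - t)" using dom by blast+
    have "excess \<sigma> 0 + k = excess \<tau> 0 + l" using \<sigma>(2) \<tau>(2) by (simp add: excess_zero)
    then show "\<forall>Y. Y \<subseteq> carrier (wreath_product G n) \<and> Y \<noteq> {} \<and>
        double_transitive G n \<sigma> (one_row k) Y \<longrightarrow> double_transitive G n \<tau> (one_row l) Y"
      using tr transitive_dominance[OF assms(2) _ \<tau>(3) fin kl le] by blast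
  next
    assume all: "\<forall>Y. Y \<subseteq> carrier (wreath_product G n) \<and> Y \<noteq> {} \<and>
        double_transitive G n \<sigma> (one_row k) Y \<longrightarrow> double_transitive G n \<tau> (one_row l) Y"
    have no: "\<not> (\<exists>Y\<subseteq>carrier (wreath_product G n). Y \<noteq> {} \<and>
        transitive_subset (config_action G n) (configs G n (double_map G \<sigma> (one_row k))) Y \<and>
        \<not> transitive_subset (config_action G n) (configs G n (double_map G \<tau> (one_row l))) Y)"
      using all tr by blast
    have "k \<le> l"
      using no exists_separating_labels[OF assms(2) M \<sigma>(3) \<tau>(3) \<sigma>(2) \<tau>(2)] not_le by blast
    moreover have "excess \<sigma> t + (k - t) \<le> excess \<tau> t + (l - t)" for t
      using no exists_separating_columns[OF assms(2) M \<sigma>(3) \<tau>(3) \<sigma>(2) \<tau>(2), of t] not_le by blast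
    ultimately show "k \<le> l \<and> dominated (partition_union \<sigma> (one_row k)) (partition_union \<tau> (one_row l))"
      using dom by blast
  qed
qed

end
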